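(* Let $n\ge 3$, let $\mathcal U\subset\mathbb R^n$ be open, and let $P$, $Q$, $\phi_+$, $\phi_-$, $\Sigma_+$, $\Sigma_-$, $\Omega$ be as in the context, satisfying all the assumptions (i)--(v) listed there. Let $u$ be a function in $C^2(\overline\Omega)$ such that: (1) there exists $C\ge 0$ such that for all $x\in\Omega$, $|(Pu)(x)|\le C\bigl(|(\nabla_x u)(x)|+|u(x)|\bigr)$; (2) $u_{|\partial\Omega}=0$. Then $u$ vanishes in a neighborhood of $\Sigma_+\cap\Sigma_-$ (that is, there is an open set $W\subset\mathcal U$ containing $\Sigma_+\cap\Sigma_-$ such that $u=0$ on $W\cap\overline\Omega$).
   Context: Setting. $n\ge 3$, $\mathcal U$ is an open subset of $\mathbb R^n$, and $\langle\cdot,\cdot\rangle$ is the standard bilinear pairing on $\mathbb R^n$ (covectors are identified with vectors of $\mathbb R^n$). (i) $P$ is a second-order linear differential operator on $\mathcal U$ with real principal symbol $p(x,\xi)=\langle Q(x)\xi,\xi\rangle$, i.e. $P=-\sum_{1\le j,k\le n}q_{jk}(x)\partial_{x_j}\partial_{x_k}+\sum_{1\le j\le n} b_j(x)\partial_{x_j}+c(x)$ (convention $D_x=-i\partial_x$), where $Q(x)=(q_{jk}(x))$ is a real symmetric $n\times n$ matrix which is a $C^1$ function of $x\in\mathcal U$, with signature $(n-1,1)$ for every $x$ (i.e. $n-1$ positive eigenvalues and 1 negative eigenvalue), and where the lower order coefficients $b_j$, $c$ are bounded measurable functions. (ii) $\phi_+,\phi_-:\mathcal U\to\mathbb R$ are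 $C^2$ functions with $d\phi_+\ne0$ at every point where $\phi_+=0$, $d\phi_-\neq 0$ at every point where $\phi_-=0$. (iii) $d\phi_+\wedge d\phi_-\ne0$ at every point where $\phi_+=\phi_-=0$. Define $\Sigma_\pm=\{x\in\mathcal U:\phi_\pm(x)=0\}$ and $\Omega=\{x\in\mathcal U:\phi_+(x)>0\text{ and }\phi_-(x)>0\}$. The boundary $\partial\Omega$ and closure $\overline\Omega$ are taken in $\mathcal U$; $\partial\Omega=\{x\in\mathcal U:\phi_+(x)=0,\ \phi_-(x)\ge0\}\cup\{x\in\mathcal U:\phi_-(x)=0,\ \phi_+(x)\ge0\}$. (iv) Both hypersurfaces are characteristic: $\langle Q(x)d\phi_+(x),d\phi_+(x)\rangle=0$ for all $x\in\Sigma_+$ and $\langle Q(x)d\phi_-(x),d\phi_-(x)\rangle=0$ for all $x\in\Sigma_-$. (v) $\langle Q(x)d\phi_+(x),d\phi_-(x)\rangle>0$ for all $x\in\Sigma_+\cap\Sigma_-$. Convention: $u\in C^2(\overline\Omega)$ means that $u$ is the restriction to $\overline\Omega$ of some function in $C^2(\mathcal U)$. *)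

theory Defs
  imports "HOL-Analysis.Analysis"
begin

definition partial_deriv :: "'n::finite \<Rightarrow> (real^'n \<Rightarrow> 'b::real_normed_vector) \<Rightarrow> real^'n \<Rightarrow> 'b"
  where "partial_deriv i f x = frechet_derivative f (at x) (axis i 1)"

text \<open>The gradient is used both for real-valued functions (giving \<^typ>\<open>real^'n\<close>) and for
  complex-valued ones (giving \<^typ>\<open>complex^'n\<close>, whose norm is the Hermitian Euclidean norm).\<close>

definition grad :: "(real^'n \<Rightarrow> 'b::real_normed_vector) \<Rightarrow> real^'n \<Rightarrow> 'b^'n"
  where "grad f x = (\<chi> i. partial_deriv i f x)"

text \<open>Meant for open sets: derivatives are taken at points of the full space.\<close>

primrec Ck_on :: "nat \<Rightarrow> (real^'n) set \<Rightarrow> (real^'n \<Rightarrow> 'b::real_normed_vector) \<Rightarrow> bool" where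
  "Ck_on 0 U f \<longleftrightarrow> continuous_on U f"
| "Ck_on (Suc k) U f \<longleftrightarrow>
     (\<forall>x\<in>U. f differentiable (at x)) \<and> (\<forall>i. Ck_on k U (partial_deriv i f))"

text \<open>\<^term>\<open>\<Omega>\<close> is a subset of the open set \<^term>\<open>U\<close>, and its closure is taken in \<^term>\<open>U\<close>.
  The values of \<^term>\<open>u\<close> outside that closure are irrelevant.\<close>

definition C2_on_closure ::
    "(real^'n) set \<Rightarrow> (real^'n) set \<Rightarrow> (real^'n \<Rightarrow> 'b::real_normed_vector) \<Rightarrow> bool"
  where "C2_on_closure U \<Omega> u \<longleftrightarrow>
    (\<exists>v. Ck_on 2 U v \<and> (\<forall>x\<in>top_of_set U closure_of \<Omega>. u x = v x))"

definition eigenspace :: "real^'n^'n \<Rightarrow> real \<Rightarrow> (real^'n) set"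
  where "eigenspace A l = {v. A *v v = l *\<^sub>R v}"

definition eigenvalues :: "real^'n^'n \<Rightarrow> real set"
  where "eigenvalues A = {l. \<exists>v. v \<noteq> 0 \<and> A *v v = l *\<^sub>R v}"

text \<open>Eigenvalues are counted with geometric multiplicity, which is the usual multiplicity
  for the symmetric matrices to which this is applied.\<close>

definition has_signature :: "real^'n^'n \<Rightarrow> nat \<Rightarrow> nat \<Rightarrow> bool"
  where "has_signature A p q \<longleftrightarrow>
    (\<Sum>l\<in>{l \<in> eigenvalues A. l > 0}. dim (eigenspace A l)) = p \<and>
    (\<Sum>l\<in>{l \<in> eigenvalues A. l < 0}. dim (eigenspace A l)) = q"

text \<open>The 2-form \<open>v \<and> w\<close>, given by its antisymmetric array of components.\<close>

definition wedge :: "real^'n \<Rightarrow> real^'n \<Rightarrow> real^'n^'n"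
  where "wedge v w = (\<chi> i j. v $ i * w $ j - v $ j * w $ i)"

definition second_order_op ::
    "(real^'n \<Rightarrow> real^'n^'n) \<Rightarrow> ('n \<Rightarrow> real^'n \<Rightarrow> complex) \<Rightarrow> (real^'n \<Rightarrow> complex) \<Rightarrow>
     (real^'n \<Rightarrow> complex) \<Rightarrow> real^'n \<Rightarrow> complex"
  where "second_order_op Q b c u x =
    - (\<Sum>j\<in>UNIV. \<Sum>k\<in>UNIV.
         complex_of_real (Q x $ j $ k) * partial_deriv j (partial_deriv k u) x)
    + (\<Sum>j\<in>UNIV. b j x * partial_deriv j u x) + c x * u x"

definition zero_set :: "(real^'n) set \<Rightarrow> (real^'n \<Rightarrow> real) \<Rightarrow> (real^'n) set"
  where "zero_set U \<phi> = {x \<in> U. \<phi> x = 0}"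

definition pos_region :: "(real^'n) set \<Rightarrow> (real^'n \<Rightarrow> real) \<Rightarrow> (real^'n \<Rightarrow> real) \<Rightarrow> (real^'n) set"
  where "pos_region U \<phi> \<psi> = {x \<in> U. \<phi> x > 0 \<and> \<psi> x > 0}"

end

theory Submission
  imports Defs
begin

text \<open>The proof is a Carleman estimate at each point \<open>x0\<close> of the corner, where both \<open>\<phi>p\<close> and
\<open>\<phi>m\<close> vanish. Write \<open>p\<close>, \<open>m\<close> for these two functions, \<open>q > 0\<close> for the value of
\<open>\<langle>Q dp, dm\<rangle>\<close> at \<open>x0\<close>, and \<open>L u = div (Q grad u)\<close>; since \<open>L\<close> differs from \<open>- P\<close> by a first-order
operator with locally bounded coefficients, \<open>|L u| \<le> C (|grad u| + |u|)\<close> in \<open>\<Omega>\<close> near \<open>x0\<close>.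

The weight. For a small constant \<open>a > 0\<close> let
\<open>g = a (p + m + |x - x0|\<^sup>2) + p m - (p + m)\<^sup>2\<close>. In \<open>\<Omega>\<close> near \<open>x0\<close> one has
\<open>g \<ge> a |x - x0|\<^sup>2\<close>, so \<open>exp (- 2 \<tau> g)\<close> is concentrated at \<open>x0\<close> as \<open>\<tau>\<close> grows. The Hessian of \<open>g\<close> is
\<open>dp dm + dm dp - 2 (dp + dm)\<^sup>2\<close> up to \<open>O(a)\<close>. Because \<open>dp\<close>, \<open>dm\<close> span a hyperbolic plane for
\<open>Q\<close> and the signature leaves \<open>Q\<close> positive definite on its orthogonal complement, adding a suitable
multiple of \<open>\<langle>Q \<xi>, \<xi>\<rangle>\<close> to \<open>- 4 Hess g (Q \<xi>, Q \<xi>)\<close> gives a positive definite form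
(\<open>lorentz_corner_form_positive\<close>, \<open>convex_weight_at_corner\<close>). This is the strict pseudoconvexity
of the level sets of \<open>g\<close>.

The estimate. Put \<open>v = exp (- \<tau> g) u\<close>, \<open>D = grad v\<close>, \<open>X = Q grad g\<close>, and multiply the
conjugated equation by \<open>2 (2 \<langle>X, D\<rangle> + \<rho> v)\<close> with a constant \<open>\<rho>\<close>. A pointwise product-rule computation
(\<open>divergence_energy_flux\<close>) writes the result as the divergence of a vector field \<open>F\<close> plus a
quadratic form that is positive definite in \<open>(D, \<tau> v)\<close>. For large \<open>\<tau>\<close> it absorbs the right-hand side,
and \<open>c \<tau>\<^sup>2 v\<^sup>2 + div F \<le> 0\<close> holds at each point of \<open>\<Omega>\<close> near \<open>x0\<close>
(\<open>carleman_pair_pointwise\<close>). A constant \<open>\<rho>\<close> is what keeps all of this within \<open>C\<^sup>1\<close> coefficients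
and \<open>C\<^sup>2\<close> defining functions.

The boundary. On a face \<open>u\<close> vanishes, so \<open>D\<close> is conormal, and as the face is characteristic the
field \<open>F\<close> is tangent to it (\<open>energy_flux_characteristic\<close>). Hence \<open>\<langle>F, dp\<rangle> = O(p)\<close> and
\<open>\<langle>F, dm\<rangle> = O(m)\<close> (\<open>flux_normal_bound\<close>), and cutting off with smooth steps in \<open>p\<close> and \<open>m\<close>
produces no boundary term in the limit (\<open>integral_divergence_over_corner\<close>).

The conclusion. Integrated against a cutoff that is 1 near \<open>x0\<close>, the inequality compares
\<open>\<tau>\<^sup>2 \<integral> exp (- 2 \<tau> g) u\<^sup>2\<close> near \<open>x0\<close> with an integral of size \<open>\<tau>\<^sup>2 sup exp (- 2 \<tau> g)\<close> over
the shell where the cutoff varies. The supremum there is exponentially smaller, so \<open>u = 0\<close> near \<open>x0\<close>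
(\<open>vanishing_near_corner\<close>). A complex \<open>u\<close> is treated through its real and imaginary parts, which the
differential inequality couples only through absolute values.\<close>

section \<open>Continuously differentiable maps\<close>

text \<open>The domain is Euclidean, so directionwise continuity of the derivative already amounts to
continuity in operator norm.\<close>
definition C1_on :: "'a::euclidean_space set \<Rightarrow> ('a \<Rightarrow> 'b::real_normed_vector) \<Rightarrow> bool"
  where "C1_on U f \<longleftrightarrow> (\<forall>x\<in>U. f differentiable (at x)) \<and>
    (\<forall>h. continuous_on U (\<lambda>x. frechet_derivative f (at x) h))"

lemma C1_onI:
  assumes "\<And>x. x \<in> U \<Longrightarrow> (f has_derivative f' x) (at x)"
    and "\<And>h. continuous_on U (\<lambda>x. f' x h)"
  shows "C1_on U f"
  unfolding C1_on_def
proof (intro conjI ballI allI)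
  fix x assume "x \<in> U"
  then show "f differentiable (at x)" using assms(1) differentiable_def by blast
next
  fix h
  have "frechet_derivative f (at x) = f' x" if "x \<in> U" for x
    using frechet_derivative_at[OF assms(1)[OF that]] by simp
  then show "continuous_on U (\<lambda>x. frechet_derivative f (at x) h)"
    using assms(2)[of h] by (simp cong: continuous_on_cong)
qed

lemma C1_on_has_derivative:
  "C1_on U f \<Longrightarrow> x \<in> U \<Longrightarrow> (f has_derivative frechet_derivative f (at x)) (at x)"
  by (simp add: C1_on_def frechet_derivative_works[symmetric])

lemma C1_on_continuous_on: "C1_on U f \<Longrightarrow> continuous_on U f"
  by (meson C1_on_has_derivative continuous_at_imp_continuous_on has_derivative_continuous)

lemma C1_on_subset: "C1_on U f \<Longrightarrow> V \<subseteq> U \<Longrightarrow> C1_on V f"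
  by (meson C1_on_def continuous_on_subset subsetD)

text \<open>Expanding the direction in the basis turns directionwise continuity into joint continuity in the
point and the direction, the form in which derivatives enter compactness arguments below.\<close>
lemma continuous_on_frechet_derivative:
  fixes f :: "'a::euclidean_space \<Rightarrow> 'b::real_normed_vector"
  assumes f: "C1_on U f"
    and a: "continuous_on S a" "a ` S \<subseteq> U" and b: "continuous_on S b"
  shows "continuous_on S (\<lambda>z. frechet_derivative f (at (a z)) (b z))"
proof -
  have "frechet_derivative f (at (a z)) (b z)
      = (\<Sum>i\<in>Basis. (b z \<bullet> i) *\<^sub>R frechet_derivative f (at (a z)) i)" if "z \<in> S" for z
  proof -
    have "linear (frechet_derivative f (at (a z)))"
      using C1_on_has_derivative[OF f] a that by (meson has_derivative_linear image_subset_iff)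
    then have "frechet_derivative f (at (a z)) (\<Sum>i\<in>Basis. (b z \<bullet> i) *\<^sub>R i)
        = (\<Sum>i\<in>Basis. (b z \<bullet> i) *\<^sub>R frechet_derivative f (at (a z)) i)"
      by (simp add: linear_sum linear_scale)
    then show ?thesis by (simp add: euclidean_representation)
  qed
  moreover have "continuous_on S (\<lambda>z. \<Sum>i\<in>Basis. (b z \<bullet> i) *\<^sub>R frechet_derivative f (at (a z)) i)"
  proof (intro continuous_intros b)
    fix i
    have "continuous_on U (\<lambda>x. frechet_derivative f (at x) i)" using f by (simp add: C1_on_def)
    then show "continuous_on S (\<lambda>z. frechet_derivative f (at (a z)) i)"
      using continuous_on_compose2[OF _ a(1) a(2)] by blast
  qed
  ultimately show ?thesis by (simp cong: continuous_on_cong)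
qed

lemma C1_on_bilinear:
  assumes b: "bounded_bilinear p" and f: "C1_on U f" and g: "C1_on U g"
  shows "C1_on U (\<lambda>x. p (f x) (g x))"
proof (rule C1_onI)
  fix x assume "x \<in> U"
  then show "((\<lambda>x. p (f x) (g x)) has_derivative
      (\<lambda>h. p (f x) (frechet_derivative g (at x) h) + p (frechet_derivative f (at x) h) (g x))) (at x)"
    by (intro bounded_bilinear.FDERIV[OF b] C1_on_has_derivative[OF f] C1_on_has_derivative[OF g])
next
  fix h
  show "continuous_on U (\<lambda>x. p (f x) (frechet_derivative g (at x) h) + p (frechet_derivative f (at x) h) (g x))"
    using f g C1_on_continuous_on[OF f] C1_on_continuous_on[OF g]
    by (auto intro!: continuous_intros bounded_bilinear.continuous_on[OF b] simp: C1_on_def)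
qed

lemma C1_on_linear:
  assumes p: "bounded_linear p" and f: "C1_on U f"
  shows "C1_on U (\<lambda>x. p (f x))"
proof (rule C1_onI)
  fix x assume "x \<in> U"
  then show "((\<lambda>x. p (f x)) has_derivative (\<lambda>h. p (frechet_derivative f (at x) h))) (at x)"
    by (intro bounded_linear.has_derivative[OF p] C1_on_has_derivative[OF f])
next
  fix h
  show "continuous_on U (\<lambda>x. p (frechet_derivative f (at x) h))"
    using f by (auto intro!: bounded_linear.continuous_on[OF p] simp: C1_on_def)
qed

lemma C1_on_const: "C1_on U (\<lambda>x. c)"
  by (rule C1_onI[where f' = "\<lambda>_ _. 0"]) (auto intro: has_derivative_const)

lemma C1_on_ident: "C1_on U (\<lambda>x. x)"
  by (rule C1_onI[where f' = "\<lambda>_ h. h"]) (auto intro: has_derivative_ident)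

lemma C1_on_add: assumes f: "C1_on U f" and g: "C1_on U g" shows "C1_on U (\<lambda>x. f x + g x)"
proof (rule C1_onI)
  fix x assume "x \<in> U"
  then show "((\<lambda>x. f x + g x) has_derivative
      (\<lambda>h. frechet_derivative f (at x) h + frechet_derivative g (at x) h)) (at x)"
    by (intro has_derivative_add C1_on_has_derivative[OF f] C1_on_has_derivative[OF g])
qed (use f g in \<open>auto intro!: continuous_intros simp: C1_on_def\<close>)

lemma C1_on_if_C1_gradient:
  assumes "\<And>x. x \<in> U \<Longrightarrow> (f has_derivative (\<lambda>h. d x \<bullet> h)) (at x)" and "C1_on U d"
  shows "C1_on U f"
  by (rule C1_onI[OF assms(1)])
    (auto intro!: continuous_on_inner continuous_on_const C1_on_continuous_on[OF assms(2)])

lemmas C1_on_scaleR = C1_on_bilinear[OF bounded_bilinear_scaleR]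
lemmas C1_on_inner = C1_on_bilinear[OF bounded_bilinear_inner]
lemmas C1_on_mult = C1_on_bilinear[OF bounded_bilinear_mult]

lemma C1_on_minus: "C1_on U f \<Longrightarrow> C1_on U (\<lambda>x. - f x)"
  by (rule C1_on_linear[OF bounded_linear_minus[OF bounded_linear_ident]])

lemma C1_on_diff: "C1_on U f \<Longrightarrow> C1_on U g \<Longrightarrow> C1_on U (\<lambda>x. f x - g x)"
  using C1_on_add[OF _ C1_on_minus, of U f g] by simp

lemma C1_on_power2: "C1_on U f \<Longrightarrow> C1_on U (\<lambda>x. (f x)\<^sup>2)" for f :: "_ \<Rightarrow> real"
  using C1_on_mult[of U f f] by (simp add: power2_eq_square)

lemma C1_on_compose_real:
  fixes f :: "'a::euclidean_space \<Rightarrow> real"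
  assumes f: "C1_on U f" and k: "\<And>s. (k has_real_derivative k' s) (at s)" "continuous_on UNIV k'"
  shows "C1_on U (\<lambda>x. k (f x))"
proof (rule C1_onI)
  fix x assume "x \<in> U"
  then show "((\<lambda>x. k (f x)) has_derivative (\<lambda>h. frechet_derivative f (at x) h * k' (f x))) (at x)"
    using has_derivative_compose[OF C1_on_has_derivative[OF f]
      k(1)[unfolded has_field_derivative_def]] by (simp add: mult.commute)
next
  fix h
  show "continuous_on U (\<lambda>x. frechet_derivative f (at x) h * k' (f x))"
    using f C1_on_continuous_on[OF f] continuous_on_compose2[OF k(2)]
    by (auto intro!: continuous_intros simp: C1_on_def)
qed

lemma C1_on_exp: "C1_on U f \<Longrightarrow> C1_on U (\<lambda>x. exp (f x :: real))"
  by (rule C1_on_compose_real[where k' = exp]) (auto intro!: continuous_intros derivative_eq_intros)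

lemma bounded_bilinear_matrix_vector: "bounded_bilinear ((*v) :: real^'n^'m \<Rightarrow> real^'n \<Rightarrow> real^'m)"
proof (rule bilinear_conv_bounded_bilinear[THEN iffD1])
  show "bilinear ((*v) :: real^'n^'m \<Rightarrow> real^'n \<Rightarrow> real^'m)"
    unfolding bilinear_def
    by (auto intro!: linearI simp: matrix_vector_right_distrib matrix_vector_mult_add_rdistrib
      scaleR_matrix_vector_assoc[symmetric] matrix_vector_mult_scaleR)
qed

lemmas C1_on_matrix_vector = C1_on_bilinear[OF bounded_bilinear_matrix_vector]

lemma C1_on_bounded_derivative:
  fixes f :: "'a::euclidean_space \<Rightarrow> 'b::real_normed_vector"
  assumes f: "C1_on U f" and K: "compact K" "K \<subseteq> U"
  shows "\<exists>B\<ge>0. \<forall>x\<in>K. \<forall>h. norm (frechet_derivative f (at x) h) \<le> B * norm h"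
proof -
  let ?S = "K \<times> sphere 0 1 :: ('a \<times> 'a) set"
  have "continuous_on ?S (\<lambda>z. frechet_derivative f (at (fst z)) (snd z))"
    by (rule continuous_on_frechet_derivative[OF f]) (use K in \<open>auto intro!: continuous_intros\<close>)
  moreover have "compact ?S" using K by (intro compact_Times) auto
  ultimately obtain B where B: "B \<ge> 0" "\<And>z. z \<in> ?S \<Longrightarrow> norm (frechet_derivative f (at (fst z)) (snd z)) \<le> B"
    using continuous_on_compact_bound by blast
  have "norm (frechet_derivative f (at x) h) \<le> B * norm h" if x: "x \<in> K" for x h
  proof (cases "h = 0")
    case True
    have "linear (frechet_derivative f (at x))"
      using C1_on_has_derivative[OF f] x K(2) has_derivative_linear by blast
    then show ?thesis using True by (simp add: linear_0)
  next
    case False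
    have lin: "linear (frechet_derivative f (at x))"
      using C1_on_has_derivative[OF f] x K(2) has_derivative_linear by blast
    have "frechet_derivative f (at x) (h /\<^sub>R norm h) = frechet_derivative f (at x) h /\<^sub>R norm h"
      by (rule linear_scale[OF lin])
    moreover have "norm (frechet_derivative f (at x) (h /\<^sub>R norm h)) \<le> B"
      using B(2)[of "(x, h /\<^sub>R norm h)"] x False by simp
    ultimately show ?thesis using False by (simp add: field_simps)
  qed
  with B(1) show ?thesis by (intro exI[of _ B]) auto
qed

lemma C1_on_Lipschitz:
  fixes f :: "'a::euclidean_space \<Rightarrow> 'b::real_normed_vector"
  assumes f: "C1_on U f" and K: "compact K" "convex K" "K \<subseteq> U"
  shows "\<exists>B\<ge>0. \<forall>x\<in>K. \<forall>y\<in>K. norm (f x - f y) \<le> B * norm (x - y)"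
proof -
  obtain B where B: "B \<ge> 0" "\<And>x h. x \<in> K \<Longrightarrow> norm (frechet_derivative f (at x) h) \<le> B * norm h"
    using C1_on_bounded_derivative[OF f K(1,3)] by blast
  have "norm (f x - f y) \<le> B * norm (x - y)" if "x \<in> K" "y \<in> K" for x y
  proof (rule differentiable_bound[OF K(2) _ _ that])
    show "(f has_derivative frechet_derivative f (at z)) (at z within K)" if "z \<in> K" for z
      using C1_on_has_derivative[OF f] K(3) that has_derivative_at_withinI by blast
    show "onorm (frechet_derivative f (at z)) \<le> B" if "z \<in> K" for z
      using B that by (intro onorm_bound) auto
  qed
  with B(1) show ?thesis by blast
qed

lemma linear_axis_sum:
  fixes L :: "real^'n \<Rightarrow> 'b::real_normed_vector"
  assumes "linear L"
  shows "L h = (\<Sum>i\<in>UNIV. h $ i *\<^sub>R L (axis i 1))"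
proof -
  have "L (\<Sum>i\<in>UNIV. h $ i *\<^sub>R axis i 1) = (\<Sum>i\<in>UNIV. h $ i *\<^sub>R L (axis i 1))"
    by (simp add: linear_sum[OF assms] linear_scale[OF assms])
  then show ?thesis
    using basis_expansion[of h] by (simp add: scalar_mult_eq_scaleR)
qed

lemma Ck_on_imp_continuous_on: "Ck_on k U f \<Longrightarrow> continuous_on U f"
proof (cases k)
  case (Suc m)
  assume "Ck_on k U f"
  then show ?thesis using Suc
    by (auto intro!: differentiable_imp_continuous_on simp: differentiable_on_def differentiable_at_withinI)
qed auto

lemma Ck_on_Suc_imp_C1_on:
  fixes f :: "real^'n \<Rightarrow> 'b::real_normed_vector"
  assumes "Ck_on (Suc k) U f"
  shows "C1_on U f"
proof (rule C1_onI)
  show "(f has_derivative frechet_derivative f (at x)) (at x)" if "x \<in> U" for x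
    using assms that by (simp add: frechet_derivative_works[symmetric])
next
  fix h
  have "frechet_derivative f (at x) h = (\<Sum>i\<in>UNIV. h $ i *\<^sub>R partial_deriv i f x)" if "x \<in> U" for x
    unfolding partial_deriv_def
    using assms that by (intro linear_axis_sum linear_frechet_derivative) simp
  moreover have "continuous_on U (\<lambda>x. \<Sum>i\<in>UNIV. h $ i *\<^sub>R partial_deriv i f x)"
    using assms by (intro continuous_intros Ck_on_imp_continuous_on[of k]) simp
  ultimately show "continuous_on U (\<lambda>x. frechet_derivative f (at x) h)"
    by (simp cong: continuous_on_cong)
qed

lemma has_derivative_grad:
  fixes f :: "real^'n \<Rightarrow> real"
  assumes "f differentiable (at x)"
  shows "(f has_derivative (\<lambda>h. grad f x \<bullet> h)) (at x)"
proof -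
  have "frechet_derivative f (at x) h = grad f x \<bullet> h" for h
    using linear_axis_sum[OF linear_frechet_derivative[OF assms], of h]
    by (simp add: grad_def partial_deriv_def inner_vec_def mult.commute)
  then show ?thesis
    using has_derivative_eq_rhs[OF assms[unfolded frechet_derivative_works]] by presburger
qed

lemma C1_on_vec_lambda:
  fixes f :: "'i::finite \<Rightarrow> 'a::euclidean_space \<Rightarrow> real"
  assumes "\<And>i. C1_on U (f i)"
  shows "C1_on U (\<lambda>x. \<chi> i. f i x)"
proof -
  have "C1_on U (\<lambda>x. \<Sum>i\<in>I. f i x *\<^sub>R axis i (1::real))" if "finite I" for I
    using that by induction (auto intro!: C1_on_add C1_on_scaleR C1_on_const assms)
  moreover have "(\<chi> i. f i x) = (\<Sum>i\<in>UNIV. f i x *\<^sub>R axis i (1::real))" for x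
    using basis_expansion[of "\<chi> i. f i x"] by (simp add: scalar_mult_eq_scaleR)
  ultimately show ?thesis by simp
qed

lemma Ck_on_2_imp_C1_on_grad:
  fixes f :: "real^'n \<Rightarrow> real"
  assumes "Ck_on 2 U f"
  shows "C1_on U (grad f)"
proof -
  have "\<forall>i. Ck_on (Suc 0) U (partial_deriv i f)"
    using assms unfolding numeral_2_eq_2 Ck_on.simps(2)[of "Suc 0"] by blast
  then have "C1_on U (\<lambda>x. \<chi> i. partial_deriv i f x)"
    by (intro C1_on_vec_lambda Ck_on_Suc_imp_C1_on[of 0]) blast
  then show ?thesis by (simp add: grad_def[abs_def])
qed

lemma has_derivative_along_line:
  assumes "(F has_derivative F') (at (p + s *\<^sub>R a))"
  shows "((\<lambda>s. F (p + s *\<^sub>R a)) has_derivative (\<lambda>h. F' (h *\<^sub>R a))) (at s)"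
proof -
  have line: "((\<lambda>s. p + s *\<^sub>R a) has_derivative (\<lambda>h. h *\<^sub>R a)) (at s)"
    by (auto intro!: derivative_eq_intros)
  show ?thesis
    using has_derivative_compose[where f = "\<lambda>s. p + s *\<^sub>R a" and g = F, OF line assms] .
qed

text \<open>Schwarz's theorem. The mean value theorem, applied twice, evaluates one and the same second
difference of \<open>f\<close> as \<open>D\<^sup>2 f\<close> at an intermediate point, once for each order of the two directions. Both
intermediate points tend to \<open>x\<close> as the step \<open>t n\<close> tends to 0.\<close>
lemma grad_field_derivative_symmetric:
  fixes f :: "'a::euclidean_space \<Rightarrow> real"
  assumes U: "open U" "x \<in> U"
    and f: "\<And>x. x \<in> U \<Longrightarrow> (f has_derivative (\<lambda>h. \<Gamma> x \<bullet> h)) (at x)"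
    and \<Gamma>: "C1_on U \<Gamma>"
  shows "frechet_derivative \<Gamma> (at x) a \<bullet> b = frechet_derivative \<Gamma> (at x) b \<bullet> a"
proof -
  define H where "H z = frechet_derivative \<Gamma> (at z)" for z
  obtain e where e: "e > 0" "ball x e \<subseteq> U" using U open_contains_ball by blast
  have *: "\<exists>z. dist x z \<le> t * (norm a + norm b) \<and>
      f (x + t *\<^sub>R a + t *\<^sub>R b) - f (x + t *\<^sub>R a) - f (x + t *\<^sub>R b) + f x = t * t * (H z b \<bullet> a)"
    if t: "0 < t" "t * (norm a + norm b) < e" for t and a b :: 'a
  proof -
    have inU: "x + s *\<^sub>R a + r *\<^sub>R b \<in> U" "dist x (x + s *\<^sub>R a + r *\<^sub>R b) \<le> t * (norm a + norm b)"
      if "0 \<le> s" "s \<le> t" "0 \<le> r" "r \<le> t" for s r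
    proof -
      have "norm (s *\<^sub>R a + r *\<^sub>R b) \<le> s * norm a + r * norm b"
        using norm_triangle_ineq[of "s *\<^sub>R a" "r *\<^sub>R b"] that by simp
      also have "\<dots> \<le> t * norm a + t * norm b"
        using that by (intro add_mono mult_right_mono) auto
      finally have 1: "norm (s *\<^sub>R a + r *\<^sub>R b) \<le> t * (norm a + norm b)" by (simp add: distrib_left)
      then show 2: "dist x (x + s *\<^sub>R a + r *\<^sub>R b) \<le> t * (norm a + norm b)"
        by (metis add.assoc add_diff_cancel_left' dist_commute dist_norm)
      show "x + s *\<^sub>R a + r *\<^sub>R b \<in> U" using 2 t e by (auto simp: subset_eq)
    qed
    define \<phi> where "\<phi> s = f (x + s *\<^sub>R a + t *\<^sub>R b) - f (x + s *\<^sub>R a)" for s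
    have "\<exists>s. 0 < s \<and> s < t \<and> \<phi> t - \<phi> 0 = (t - 0) * (\<Gamma> (x + s *\<^sub>R a + t *\<^sub>R b) \<bullet> a - \<Gamma> (x + s *\<^sub>R a) \<bullet> a)"
    proof (rule MVT2[OF t(1)])
      fix s assume s: "0 \<le> s" "s \<le> t"
      have 1: "((\<lambda>s. f (x + s *\<^sub>R a + t *\<^sub>R b)) has_derivative (\<lambda>h. \<Gamma> (x + s *\<^sub>R a + t *\<^sub>R b) \<bullet> (h *\<^sub>R a))) (at s)"
        using has_derivative_along_line[of f "\<lambda>h. \<Gamma> (x + s *\<^sub>R a + t *\<^sub>R b) \<bullet> h" "x + t *\<^sub>R b" s a] f[OF inU(1)[of s t]] s t
        by (simp add: add.commute add.left_commute)
      have 2: "((\<lambda>s. f (x + s *\<^sub>R a)) has_derivative (\<lambda>h. \<Gamma> (x + s *\<^sub>R a) \<bullet> (h *\<^sub>R a))) (at s)"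
        using has_derivative_along_line[of f "\<lambda>h. \<Gamma> (x + s *\<^sub>R a) \<bullet> h" x s a] f[OF inU(1)[of s 0]] s t by simp
      show "(\<phi> has_real_derivative \<Gamma> (x + s *\<^sub>R a + t *\<^sub>R b) \<bullet> a - \<Gamma> (x + s *\<^sub>R a) \<bullet> a) (at s)"
        using has_derivative_diff[OF 1 2] unfolding \<phi>_def has_field_derivative_def
        by (rule has_derivative_eq_rhs) (auto simp: algebra_simps)
    qed
    then obtain s where s: "0 < s" "s < t"
      "\<phi> t - \<phi> 0 = t * (\<Gamma> (x + s *\<^sub>R a + t *\<^sub>R b) \<bullet> a - \<Gamma> (x + s *\<^sub>R a) \<bullet> a)" by auto
    have "\<exists>r. 0 < r \<and> r < t \<and> \<Gamma> (x + s *\<^sub>R a + t *\<^sub>R b) \<bullet> a - \<Gamma> (x + s *\<^sub>R a + 0 *\<^sub>R b) \<bullet> a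
       = (t - 0) * (H (x + s *\<^sub>R a + r *\<^sub>R b) b \<bullet> a)"
    proof (rule MVT2[OF t(1)])
      fix r assume r: "0 \<le> r" "r \<le> t"
      have in': "x + s *\<^sub>R a + r *\<^sub>R b \<in> U" using inU(1)[of s r] s r by simp
      have 1: "((\<lambda>r. \<Gamma> (x + s *\<^sub>R a + r *\<^sub>R b)) has_derivative (\<lambda>h. H (x + s *\<^sub>R a + r *\<^sub>R b) (h *\<^sub>R b))) (at r)"
        unfolding H_def by (rule has_derivative_along_line[OF C1_on_has_derivative[OF \<Gamma> in']])
      have "linear (H (x + s *\<^sub>R a + r *\<^sub>R b))"
        unfolding H_def using C1_on_has_derivative[OF \<Gamma> in'] has_derivative_linear by blast
      then show "((\<lambda>r. \<Gamma> (x + s *\<^sub>R a + r *\<^sub>R b) \<bullet> a) has_real_derivative (H (x + s *\<^sub>R a + r *\<^sub>R b) b \<bullet> a)) (at r)"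
        using has_derivative_inner_left[OF 1, of a] unfolding has_field_derivative_def
        by (elim has_derivative_eq_rhs) (auto simp: linear_scale)
    qed
    then obtain r where r: "0 < r" "r < t"
      "\<Gamma> (x + s *\<^sub>R a + t *\<^sub>R b) \<bullet> a - \<Gamma> (x + s *\<^sub>R a) \<bullet> a = t * (H (x + s *\<^sub>R a + r *\<^sub>R b) b \<bullet> a)" by auto
    show ?thesis
      using s r inU(2)[of s r] by (intro exI[of _ "x + s *\<^sub>R a + r *\<^sub>R b"]) (auto simp: \<phi>_def)
  qed
  define m where "m = norm a + norm b + 1"
  have m: "m > 0" by (simp add: m_def add_nonneg_pos)
  define t where "t n = e / m / (2 + real n)" for n
  have t: "0 < t n" "t n * (norm a + norm b) < e" "t n * (norm b + norm a) < e" for n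
  proof -
    show 0: "0 < t n" using e m by (simp add: t_def)
    have "t n * (norm a + norm b) < t n * m" using 0 by (intro mult_strict_left_mono) (auto simp: m_def)
    also have "t n * m \<le> e" using e m by (auto simp: t_def divide_simps)
    finally show "t n * (norm a + norm b) < e" "t n * (norm b + norm a) < e" by (simp_all add: add.commute)
  qed
  have t0: "(\<lambda>n. t n * (norm a + norm b)) \<longlonglongrightarrow> 0"
  proof -
    have "(\<lambda>n. (norm a + norm b) * (e / m * inverse (real (n + 2)))) \<longlonglongrightarrow> (norm a + norm b) * (e / m * 0)"
      by (intro tendsto_intros LIMSEQ_ignore_initial_segment[OF lim_inverse_n])
    then show ?thesis by (simp add: t_def divide_inverse mult.commute add.commute)
  qed
  obtain z where z: "\<And>n. dist x (z n) \<le> t n * (norm a + norm b)"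
     "\<And>n. f (x + t n *\<^sub>R a + t n *\<^sub>R b) - f (x + t n *\<^sub>R a) - f (x + t n *\<^sub>R b) + f x = t n * t n * (H (z n) b \<bullet> a)"
    using *[OF t(1) t(2)] by metis
  obtain w where w: "\<And>n. dist x (w n) \<le> t n * (norm b + norm a)"
     "\<And>n. f (x + t n *\<^sub>R b + t n *\<^sub>R a) - f (x + t n *\<^sub>R b) - f (x + t n *\<^sub>R a) + f x = t n * t n * (H (w n) a \<bullet> b)"
    using *[OF t(1) t(3)] by metis
  have "t n * t n * (H (z n) b \<bullet> a) = t n * t n * (H (w n) a \<bullet> b)" for n
    using z(2)[of n] w(2)[of n] by (simp add: add.commute add.left_commute algebra_simps)
  note second_differences = this
  have eq: "H (z n) b \<bullet> a = H (w n) a \<bullet> b" for n using t(1)[of n] second_differences[of n] by simp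
  have "z \<longlonglongrightarrow> x" "w \<longlonglongrightarrow> x"
    using z(1) w(1) t0 unfolding tendsto_dist_iff[of _ x]
    by (auto intro!: tendsto_sandwich[OF _ _ tendsto_const t0] simp: dist_commute add.commute)
  moreover have "isCont (\<lambda>z. H z h) x" for h
    using \<Gamma> U unfolding H_def C1_on_def by (auto simp: continuous_on_eq_continuous_at)
  ultimately have "(\<lambda>n. H (z n) b) \<longlonglongrightarrow> H x b" "(\<lambda>n. H (w n) a) \<longlonglongrightarrow> H x a"
    using isCont_tendsto_compose by blast+
  then have "(\<lambda>n. H (z n) b \<bullet> a) \<longlonglongrightarrow> H x b \<bullet> a" "(\<lambda>n. H (w n) a \<bullet> b) \<longlonglongrightarrow> H x a \<bullet> b"
    by (auto intro: tendsto_intros)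
  then show ?thesis using eq LIMSEQ_unique unfolding H_def by force
qed

section \<open>Divergence and integration by parts on a domain with a corner\<close>

definition divergence :: "(real^'n \<Rightarrow> real^'n) \<Rightarrow> real^'n \<Rightarrow> real"
  where "divergence F x = (\<Sum>i\<in>UNIV. frechet_derivative F (at x) (axis i 1) $ i)"

lemma divergence_eq:
  "(F has_derivative F') (at x) \<Longrightarrow> divergence F x = (\<Sum>i\<in>UNIV. F' (axis i 1) $ i)"
  by (simp add: divergence_def frechet_derivative_at[symmetric])

lemma divergence_add:
  assumes "F differentiable (at x)" "G differentiable (at x)"
  shows "divergence (\<lambda>x. F x + G x) x = divergence F x + divergence G x"
  using divergence_eq[OF has_derivative_add[OF assms[unfolded frechet_derivative_works]]]
  by (simp add: divergence_def sum.distrib)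

lemma divergence_scaleR:
  fixes f :: "real^'n \<Rightarrow> real"
  assumes f: "(f has_derivative f') (at x)" and F: "F differentiable (at x)"
  shows "divergence (\<lambda>x. f x *\<^sub>R F x) x = f x * divergence F x + f' (F x)"
proof -
  have "divergence (\<lambda>x. f x *\<^sub>R F x) x
      = (\<Sum>i\<in>UNIV. (f x *\<^sub>R frechet_derivative F (at x) (axis i 1) + f' (axis i 1) *\<^sub>R F x) $ i)"
    by (rule divergence_eq[OF has_derivative_scaleR[OF f F[unfolded frechet_derivative_works]]])
  also have "\<dots> = f x * divergence F x + (\<Sum>i\<in>UNIV. F x $ i * f' (axis i 1))"
    by (simp add: sum.distrib divergence_def sum_distrib_left mult.commute)
  also have "(\<Sum>i\<in>UNIV. F x $ i * f' (axis i 1)) = f' (F x)"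
    using linear_axis_sum[OF has_derivative_linear[OF f], of "F x"] by simp
  finally show ?thesis .
qed

lemma C1_on_differentiable: "C1_on U f \<Longrightarrow> x \<in> U \<Longrightarrow> f differentiable (at x)"
  by (simp add: C1_on_def)

lemma continuous_on_divergence:
  assumes "C1_on U F" shows "continuous_on U (divergence F)"
  unfolding divergence_def
  using assms by (auto intro!: continuous_intros simp: C1_on_def)

lemma integral_translate:
  fixes f :: "'a::euclidean_space \<Rightarrow> real"
  assumes "f \<in> borel_measurable borel"
  shows "(\<integral>x. f (c + x) \<partial>lborel) = (\<integral>x. f x \<partial>lborel)"
proof -
  have "(\<integral>x. f x \<partial>lborel) = (\<integral>x. f x \<partial>distr lborel borel ((+) c))" by (simp add: lborel_distr_plus)
  also have "\<dots> = (\<integral>x. f (c + x) \<partial>lborel)" using assms by (intro integral_distr) auto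
  finally show ?thesis by simp
qed

lemma integrable_bounded_support:
  fixes f :: "'a::euclidean_space \<Rightarrow> real"
  assumes "f \<in> borel_measurable borel" "\<And>x. \<bar>f x\<bar> \<le> B * indicator (cball c R) x"
  shows "integrable lborel f"
proof (rule Bochner_Integration.integrable_bound)
  show "integrable lborel (\<lambda>x. B * indicator (cball c R) x :: real)"
    by (intro integrable_mult_right integrable_real_indicator) (auto simp: emeasure_lborel_cball_finite[simplified])
qed (use assms in \<open>auto intro!: AE_I2 order_trans[OF assms(2)]\<close>)

text \<open>Translation invariance makes the integral of every difference quotient vanish, and the difference
quotients are bounded by \<open>B\<close> on a common ball, so dominated convergence passes to the derivative.\<close>
lemma integral_directional_derivative_compact_support:
  fixes f :: "'a::euclidean_space \<Rightarrow> real"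
  assumes f: "\<And>x. (f has_derivative f' x) (at x)"
    and bd: "\<And>x. \<bar>f' x e\<bar> \<le> B"
    and supp: "\<And>x. x \<notin> cball c R \<Longrightarrow> f x = 0"
  shows "integrable lborel (\<lambda>x. f' x e)" "(\<integral>x. f' x e \<partial>lborel) = 0"
proof -
  define t where "t n = inverse (real (Suc n))" for n
  have t: "0 < t n" "t n \<le> 1" for n by (auto simp: t_def field_simps)
  have t0: "t \<longlonglongrightarrow> 0" unfolding t_def by (rule LIMSEQ_inverse_real_of_nat)
  have "continuous_on UNIV f"
    by (meson f continuous_at_imp_continuous_on has_derivative_continuous)
  then have meas[measurable]: "f \<in> borel_measurable borel" by (rule borel_measurable_continuous_onI)
  define q where "q n x = (f (t n *\<^sub>R e + x) - f x) / t n" for n x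
  have qmeas[measurable]: "q n \<in> borel_measurable borel" for n unfolding q_def by measurable
  have B0: "B \<ge> 0" using bd[of undefined] by linarith
  have lip: "\<bar>f (x + s *\<^sub>R e) - f x\<bar> \<le> B * s" if s: "s > 0" for x s
  proof -
    have "\<exists>z>0. z < s \<and> f (x + s *\<^sub>R e) - f (x + 0 *\<^sub>R e) = (s - 0) * f' (x + z *\<^sub>R e) e"
    proof (rule MVT2[OF s])
      fix r
      have "linear (f' (x + r *\<^sub>R e))" using f has_derivative_linear by blast
      then show "((\<lambda>s. f (x + s *\<^sub>R e)) has_real_derivative f' (x + r *\<^sub>R e) e) (at r)"
        using has_derivative_along_line[OF f, of x e r] unfolding has_field_derivative_def
        by (elim has_derivative_eq_rhs) (simp add: linear_scale mult.commute fun_eq_iff)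
    qed
    then show ?thesis using bd s by (auto simp: abs_mult mult.commute mult_left_mono)
  qed
  let ?R = "R + norm e"
  have qb: "\<bar>q n x\<bar> \<le> B * indicator (cball c ?R) x" for n x
  proof (cases "x \<in> cball c ?R")
    case True
    then show ?thesis using lip[OF t(1), of x n] t(1)[of n]
      by (simp add: q_def add.commute field_simps)
  next
    case False
    have "dist c x \<le> dist c (t n *\<^sub>R e + x) + norm (t n *\<^sub>R e)"
      using dist_triangle[of c x "t n *\<^sub>R e + x"] by (simp add: dist_norm)
    also have "norm (t n *\<^sub>R e) \<le> norm e" using t[of n] by (simp add: mult_left_le_one_le)
    finally have "t n *\<^sub>R e + x \<notin> cball c R" using False by auto
    moreover have "x \<notin> cball c R" using False norm_ge_zero[of e] unfolding mem_cball by linarith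
    ultimately show ?thesis using B0 by (simp add: q_def supp)
  qed
  have lim: "(\<lambda>n. q n x) \<longlonglongrightarrow> f' x e" for x
  proof -
    have "linear (f' x)" using f has_derivative_linear by blast
    then have "((\<lambda>s. f (x + s *\<^sub>R e)) has_real_derivative f' x e) (at 0)"
      using has_derivative_along_line[of f "f' x" x 0 e] f[of x] unfolding has_field_derivative_def
      by (simp add: linear_scale mult.commute[of _ "f' x e"])
    then have "(\<lambda>h. (f (x + h *\<^sub>R e) - f x) / h) \<midarrow>0\<rightarrow> f' x e"
      by (simp add: DERIV_def)
    moreover have "filterlim t (at 0) sequentially"
      using t0 t(1) by (auto simp: filterlim_at intro!: always_eventually less_imp_neq[symmetric])
    ultimately have "(\<lambda>n. (f (x + t n *\<^sub>R e) - f x) / t n) \<longlonglongrightarrow> f' x e"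
      by (rule filterlim_compose)
    then show ?thesis by (simp add: q_def add.commute)
  qed
  have fint: "integrable lborel f"
  proof -
    have "continuous_on (cball c R) f" using \<open>continuous_on UNIV f\<close> by (rule continuous_on_subset) simp
    then obtain M where M: "\<And>x. x \<in> cball c R \<Longrightarrow> norm (f x) \<le> M"
      using continuous_on_compact_bound[OF compact_cball] by blast
    show ?thesis
    proof (rule integrable_bounded_support[OF meas])
      show "\<bar>f x\<bar> \<le> M * indicator (cball c R) x" for x
        using M supp[of x] by (cases "x \<in> cball c R") auto
    qed
  qed
  have q0: "(\<integral>x. q n x \<partial>lborel) = 0" for n
  proof -
    have "integrable lborel (\<lambda>x. f (t n *\<^sub>R e + x))"
      using integrable_distr[of "(+) (t n *\<^sub>R e)" lborel borel f] fint by (simp add: lborel_distr_plus)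
    then have "(\<integral>x. q n x \<partial>lborel) = ((\<integral>x. f (t n *\<^sub>R e + x) \<partial>lborel) - (\<integral>x. f x \<partial>lborel)) / t n"
      unfolding q_def using fint by simp
    then show ?thesis by (simp add: integral_translate)
  qed
  have fm: "(\<lambda>x. f' x e) \<in> borel_measurable lborel"
    by (rule borel_measurable_LIMSEQ_real[OF lim]) simp
  have dom: "integrable lborel (\<lambda>x. B * indicator (cball c ?R) x :: real)"
    by (intro integrable_mult_right integrable_real_indicator) (auto simp: emeasure_lborel_cball_finite[simplified])
  have dc: "integrable lborel (\<lambda>x. f' x e) \<and> (\<lambda>n. \<integral>x. q n x \<partial>lborel) \<longlonglongrightarrow> (\<integral>x. f' x e \<partial>lborel)"
    using integrable_dominated_convergence[OF fm _ dom, of q]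
      integral_dominated_convergence[OF fm _ dom, of q] lim qb by auto
  then show "integrable lborel (\<lambda>x. f' x e)" by simp
  have "(\<lambda>n. 0::real) \<longlonglongrightarrow> (\<integral>x. f' x e \<partial>lborel)" using dc q0 by simp
  then show "(\<integral>x. f' x e \<partial>lborel) = 0" using LIMSEQ_unique tendsto_const by blast
qed

text \<open>Outside \<open>U\<close> the field \<open>F\<close> is arbitrary. Replacing it by 0 outside the ball gives a field that is
differentiable on the whole space, because \<open>F\<close> already vanishes on the part of \<open>U\<close> outside the ball.\<close>
lemma integral_divergence_compact_support:
  fixes F :: "real^'n \<Rightarrow> real^'n"
  assumes U: "open U" and F: "C1_on U F" and K: "cball c R \<subseteq> U"
    and supp: "\<And>x. x \<in> U \<Longrightarrow> x \<notin> cball c R \<Longrightarrow> F x = 0"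
  shows "(\<integral>x. indicator (cball c R) x * divergence F x \<partial>lborel) = 0"
proof -
  define D where "D x = (if x \<in> cball c R then frechet_derivative F (at x) else (\<lambda>_. 0))" for x
  define T where "T x = (if x \<in> cball c R then F x else 0)" for x
  have T: "(T has_derivative D x) (at x)" for x
  proof (cases "x \<in> cball c R")
    case True
    then have "(F has_derivative D x) (at x)"
      using C1_on_has_derivative[OF F] K by (auto simp: D_def)
    then show ?thesis
      by (rule has_derivative_transform_within_open[OF _ U]) (use K True supp in \<open>auto simp: T_def\<close>)
  next
    case False
    have "((\<lambda>_. 0) has_derivative D x) (at x)" using False by (simp add: D_def)
    then show ?thesis
      by (rule has_derivative_transform_within_open[OF _ open_Compl[OF closed_cball[of c R]]])
        (use False in \<open>auto simp: T_def\<close>)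
  qed
  obtain B where B: "B \<ge> 0" "\<And>x h. x \<in> cball c R \<Longrightarrow> norm (frechet_derivative F (at x) h) \<le> B * norm h"
    using C1_on_bounded_derivative[OF F compact_cball K] by blast
  have nD: "norm (D x (axis i 1)) \<le> B" for x i
    using B(2)[of x "axis i 1"] B(1) by (auto simp: D_def)
  have i: "integrable lborel (\<lambda>x. D x (axis i 1) $ i)" "(\<integral>x. D x (axis i 1) $ i \<partial>lborel) = 0" for i
  proof -
    have "((\<lambda>x. T x $ i) has_derivative (\<lambda>h. D x h $ i)) (at x)" for x
      by (rule bounded_linear.has_derivative[OF bounded_linear_vec_nth T])
    moreover have "\<bar>D x (axis i 1) $ i\<bar> \<le> B" for x
      using nD[of x i] component_le_norm_cart[of "D x (axis i 1)" i] by linarith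
    moreover have "T x $ i = 0" if "x \<notin> cball c R" for x using that by (simp add: T_def)
    ultimately show "integrable lborel (\<lambda>x. D x (axis i 1) $ i)" "(\<integral>x. D x (axis i 1) $ i \<partial>lborel) = 0"
      using integral_directional_derivative_compact_support[where f = "\<lambda>x. T x $ i" and
        f' = "\<lambda>x h. D x h $ i" and e = "axis i 1" and B = B and c = c and R = R] by blast+
  qed
  have "(\<integral>x. indicator (cball c R) x * divergence F x \<partial>lborel)
      = (\<integral>x. (\<Sum>i\<in>UNIV. D x (axis i 1) $ i) \<partial>lborel)"
    by (rule Bochner_Integration.integral_cong) (auto simp: divergence_def D_def indicator_def)
  also have "\<dots> = 0" using i by simp
  finally show ?thesis .
qed


text \<open>The positive part squared is a \<open>C\<^sup>1\<close> function that vanishes exactly on a half-line; all cutoffs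
below are built from it.\<close>
lemma DERIV_positive_part_squared: "((\<lambda>s. (max 0 s)\<^sup>2) has_real_derivative 2 * max 0 s) (at s)" for s :: real
proof -
  consider "s < 0" | "s > 0" | "s = 0" by linarith
  then show ?thesis
  proof cases
    case 1
    have "((\<lambda>s::real. 0) has_real_derivative 2 * max 0 s) (at s)" using 1 by simp
    then show ?thesis
      by (rule has_field_derivative_transform_within_open[where S = "{..<0}"]) (use 1 in auto)
  next
    case 2
    have "((\<lambda>s::real. s\<^sup>2) has_real_derivative 2 * max 0 s) (at s)"
      using 2 by (auto intro!: derivative_eq_intros)
    then show ?thesis
      by (rule has_field_derivative_transform_within_open[where S = "{0<..}"]) (use 2 in auto)
  next
    case 3
    have "((\<lambda>h::real. (max 0 h)\<^sup>2 / h) \<longlongrightarrow> 0) (at 0)"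
    proof (rule Lim_null_comparison)
      show "\<forall>\<^sub>F h::real in at 0. norm ((max 0 h)\<^sup>2 / h) \<le> \<bar>h\<bar>"
        by (intro always_eventually allI) (simp add: max_def power2_eq_square)
      show "((\<lambda>h::real. \<bar>h\<bar>) \<longlongrightarrow> 0) (at 0)" by (intro tendsto_rabs_zero tendsto_ident_at)
    qed
    then show ?thesis using 3 by (simp add: DERIV_def)
  qed
qed

text \<open>A \<open>C\<^sup>1\<close> approximation of the indicator of the positive half-line as \<open>e\<close> tends to 0. Its rational
form gives the scale-free bound \<open>1 / s\<close> for the derivative directly.\<close>
definition smooth_step :: "real \<Rightarrow> real \<Rightarrow> real"
  where "smooth_step e s = (max 0 s)\<^sup>2 / ((max 0 s)\<^sup>2 + e\<^sup>2)"

definition smooth_step_deriv :: "real \<Rightarrow> real \<Rightarrow> real"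
  where "smooth_step_deriv e s = 2 * max 0 s * e\<^sup>2 / ((max 0 s)\<^sup>2 + e\<^sup>2)\<^sup>2"

lemma smooth_step_denominator_pos: "e > 0 \<Longrightarrow> (max 0 s)\<^sup>2 + e\<^sup>2 > 0" for e s :: real
  by (intro add_nonneg_pos) auto

lemma DERIV_smooth_step:
  assumes e: "e > 0"
  shows "(smooth_step e has_real_derivative smooth_step_deriv e s) (at s)"
proof -
  have pos: "(max 0 s)\<^sup>2 + e\<^sup>2 \<noteq> 0" using smooth_step_denominator_pos[OF e, of s] by linarith
  have "((\<lambda>s. (max 0 s)\<^sup>2 / ((max 0 s)\<^sup>2 + e\<^sup>2)) has_real_derivative
     (2 * max 0 s * ((max 0 s)\<^sup>2 + e\<^sup>2) - (max 0 s)\<^sup>2 * (2 * max 0 s + 0)) / (((max 0 s)\<^sup>2 + e\<^sup>2) * ((max 0 s)\<^sup>2 + e\<^sup>2))) (at s)"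
    by (intro DERIV_divide DERIV_add DERIV_const DERIV_positive_part_squared pos)
  moreover have "(2 * max 0 s * ((max 0 s)\<^sup>2 + e\<^sup>2) - (max 0 s)\<^sup>2 * (2 * max 0 s + 0)) / (((max 0 s)\<^sup>2 + e\<^sup>2) * ((max 0 s)\<^sup>2 + e\<^sup>2))
     = smooth_step_deriv e s"
    unfolding smooth_step_deriv_def by (simp add: power2_eq_square algebra_simps)
  ultimately show ?thesis by (simp add: smooth_step_def[abs_def])
qed

lemma continuous_on_smooth_step_deriv: "e > 0 \<Longrightarrow> continuous_on UNIV (smooth_step_deriv e)"
  unfolding smooth_step_deriv_def
  by (intro continuous_intros ballI) (metis less_irrefl power_not_zero smooth_step_denominator_pos)

lemma smooth_step_bounds: "0 \<le> smooth_step e s" "smooth_step e s \<le> 1"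
proof -
  have 1: "(max 0 s)\<^sup>2 \<ge> 0" "e\<^sup>2 \<ge> 0" by simp_all
  show "0 \<le> smooth_step e s" by (simp add: smooth_step_def)
  show "smooth_step e s \<le> 1"
  proof (cases "(max 0 s)\<^sup>2 + e\<^sup>2 = 0")
    case False
    then have "(max 0 s)\<^sup>2 + e\<^sup>2 > 0" using 1 by linarith
    then show ?thesis using 1 unfolding smooth_step_def by (subst divide_le_eq_1_pos) auto
  qed (simp add: smooth_step_def)
qed

lemma smooth_step_nonpos: "s \<le> 0 \<Longrightarrow> smooth_step e s = 0" "s \<le> 0 \<Longrightarrow> smooth_step_deriv e s = 0"
  by (auto simp: smooth_step_def smooth_step_deriv_def)

text \<open>The bound \<open>1 / s\<close>, uniform in \<open>e\<close>, is what compensates a flux of size \<open>O(s)\<close> through the level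
sets of \<open>s\<close>.\<close>
lemma smooth_step_deriv_bound:
  assumes "e > 0" "s > 0"
  shows "0 \<le> smooth_step_deriv e s" "smooth_step_deriv e s * s \<le> 1"
proof -
  show "0 \<le> smooth_step_deriv e s" using assms by (simp add: smooth_step_deriv_def)
  have "2 * s * s * e\<^sup>2 \<le> (s\<^sup>2 + e\<^sup>2)\<^sup>2" 
    using sum_power2_ge_zero[of "s\<^sup>2" "e\<^sup>2"] by (simp add: power2_eq_square algebra_simps)
  then show "smooth_step_deriv e s * s \<le> 1"
    using assms by (simp add: smooth_step_deriv_def divide_le_eq mult.commute mult.left_commute)
qed

lemma smooth_step_tendsto:
  assumes "s > 0"
  shows "(\<lambda>n. smooth_step (inverse (real (Suc n))) s) \<longlonglongrightarrow> 1"
    "(\<lambda>n. smooth_step_deriv (inverse (real (Suc n))) s) \<longlonglongrightarrow> 0"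
proof -
  have "(\<lambda>n. s\<^sup>2 / (s\<^sup>2 + (inverse (real (Suc n)))\<^sup>2)) \<longlonglongrightarrow> s\<^sup>2 / (s\<^sup>2 + 0\<^sup>2)"
    using assms by (intro tendsto_intros LIMSEQ_inverse_real_of_nat) auto
  then show "(\<lambda>n. smooth_step (inverse (real (Suc n))) s) \<longlonglongrightarrow> 1"
    using assms by (simp add: smooth_step_def)
  have "(\<lambda>n. 2 * s * (inverse (real (Suc n)))\<^sup>2 / (s\<^sup>2 + (inverse (real (Suc n)))\<^sup>2)\<^sup>2) \<longlonglongrightarrow> 2 * s * 0\<^sup>2 / (s\<^sup>2 + 0\<^sup>2)\<^sup>2"
    using assms by (intro tendsto_intros LIMSEQ_inverse_real_of_nat) auto
  then show "(\<lambda>n. smooth_step_deriv (inverse (real (Suc n))) s) \<longlonglongrightarrow> 0"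
    using assms by (simp add: smooth_step_deriv_def)
qed

text \<open>Gauss' theorem on the corner domain, stated without surface integrals. The field
\<open>\<theta> F\<close> is multiplied by smooth steps in \<open>p\<close> and in \<open>m\<close>. Where a step varies, its derivative is at most
\<open>1 / p\<close>, while the component of \<open>F\<close> that it meets is at most \<open>C p\<close>; the product is bounded and tends
to 0 pointwise, so dominated convergence removes the steps.\<close>
lemma integral_divergence_over_corner:
  fixes F :: "real^'n \<Rightarrow> real^'n" and p m \<theta> :: "real^'n \<Rightarrow> real"
  assumes U: "open U" and F: "C1_on U F" and K: "cball c R \<subseteq> U"
    and p: "C1_on U p" and m: "C1_on U m" and \<theta>: "C1_on U \<theta>"
    and supp: "\<And>x. x \<notin> cball c R \<Longrightarrow> \<theta> x = 0"
    and bp: "\<And>x. x \<in> cball c R \<Longrightarrow> p x > 0 \<Longrightarrow> m x > 0 \<Longrightarrow> \<bar>frechet_derivative p (at x) (F x)\<bar> \<le> C * p x"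
    and bm: "\<And>x. x \<in> cball c R \<Longrightarrow> p x > 0 \<Longrightarrow> m x > 0 \<Longrightarrow> \<bar>frechet_derivative m (at x) (F x)\<bar> \<le> C * m x"
  defines "S \<equiv> {x \<in> cball c R. p x > 0 \<and> m x > 0}"
  shows "(\<integral>x. indicator S x * (\<theta> x * divergence F x + frechet_derivative \<theta> (at x) (F x)) \<partial>lborel) = 0"
    and "integrable lborel (\<lambda>x. indicator S x * (\<theta> x * divergence F x + frechet_derivative \<theta> (at x) (F x)))"
proof -
  let ?B = "cball c R"
  define e where "e n = inverse (real (Suc n))" for n
  have e: "e n > 0" for n by (simp add: e_def)
  define \<Phi> where "\<Phi> x = \<theta> x * divergence F x + frechet_derivative \<theta> (at x) (F x)" for x
  define w where "w n x = \<theta> x * (smooth_step (e n) (p x) * smooth_step (e n) (m x))" for n x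
  define T where "T n x = w n x *\<^sub>R F x" for n x
  define G where "G n x = smooth_step (e n) (p x) * smooth_step (e n) (m x) * \<Phi> x
      + \<theta> x * (smooth_step_deriv (e n) (p x) * frechet_derivative p (at x) (F x)) * smooth_step (e n) (m x)
      + \<theta> x * smooth_step (e n) (p x) * (smooth_step_deriv (e n) (m x) * frechet_derivative m (at x) (F x))" for n x
  have stepC1: "C1_on U (\<lambda>x. smooth_step (e n) (f x))" if "C1_on U f" for n and f :: "real^'n \<Rightarrow> real"
    by (rule C1_on_compose_real[OF that DERIV_smooth_step[OF e] continuous_on_smooth_step_deriv[OF e]])
  have TC1: "C1_on U (T n)" for n
    unfolding T_def w_def by (intro C1_on_scaleR C1_on_mult \<theta> stepC1 p m F)
  have divT: "divergence (T n) x = G n x" if x: "x \<in> U" for n x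
  proof -
    note d = C1_on_has_derivative[OF p x] C1_on_has_derivative[OF m x] C1_on_has_derivative[OF \<theta> x]
    have s: "((\<lambda>x. smooth_step (e n) (f x)) has_derivative (\<lambda>h. smooth_step_deriv (e n) (f x) * f' h)) (at x)"
      if "(f has_derivative f') (at x)" for f f'
      by (rule has_derivative_compose[OF that DERIV_smooth_step[OF e, unfolded has_field_derivative_def]])
    have "(w n has_derivative (\<lambda>h. \<theta> x *
         (smooth_step (e n) (p x) * (smooth_step_deriv (e n) (m x) * frechet_derivative m (at x) h)
         + smooth_step_deriv (e n) (p x) * frechet_derivative p (at x) h * smooth_step (e n) (m x))
       + frechet_derivative \<theta> (at x) h * (smooth_step (e n) (p x) * smooth_step (e n) (m x)))) (at x)"
      unfolding w_def by (intro has_derivative_mult s d)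
    from divergence_scaleR[OF this C1_on_differentiable[OF F x]]
    show ?thesis by (simp add: T_def[abs_def] G_def \<Phi>_def w_def algebra_simps)
  qed
  have G0: "indicator ?B x * divergence (T n) x = indicator S x * G n x" for n x
  proof (cases "x \<in> ?B")
    case True
    then have "divergence (T n) x = G n x" using divT K by auto
    moreover have "G n x = 0" if "x \<notin> S"
    proof -
      have "p x \<le> 0 \<or> m x \<le> 0" using that True by (auto simp: S_def)
      then show ?thesis by (auto simp: G_def smooth_step_nonpos)
    qed
    ultimately show ?thesis using True by (auto simp: indicator_def S_def)
  qed (auto simp: S_def)
  have zero: "(\<integral>x. indicator S x * G n x \<partial>lborel) = 0" for n
  proof -
    have "(\<integral>x. indicator ?B x * divergence (T n) x \<partial>lborel) = 0"
      by (rule integral_divergence_compact_support[OF U TC1 K]) (auto simp: T_def w_def supp)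
    then show ?thesis by (simp add: G0)
  qed
  have \<Phi>c: "continuous_on U \<Phi>"
    unfolding \<Phi>_def
    by (intro continuous_intros continuous_on_divergence[OF F] C1_on_continuous_on[OF \<theta>]
       continuous_on_frechet_derivative[OF \<theta>] C1_on_continuous_on[OF F]) auto
  note bdd = continuous_on_compact_bound[OF compact_cball continuous_on_subset[OF _ K]]
  obtain M1 where M1: "M1 \<ge> 0" "\<And>x. x \<in> ?B \<Longrightarrow> \<bar>\<Phi> x\<bar> \<le> M1"
    using bdd[OF \<Phi>c] unfolding real_norm_def by blast
  obtain M2 where M2: "M2 \<ge> 0" "\<And>x. x \<in> ?B \<Longrightarrow> \<bar>\<theta> x\<bar> \<le> M2"
    using bdd[OF C1_on_continuous_on[OF \<theta>]] unfolding real_norm_def by blast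
  define M where "M = M1 + 2 * (M2 * \<bar>C\<bar>)"
  have dom: "integrable lborel (\<lambda>x. M * indicator ?B x :: real)"
    by (intro integrable_mult_right integrable_real_indicator) (auto simp: emeasure_lborel_cball_finite[simplified])
  have bound: "\<bar>indicator S x * G n x\<bar> \<le> M * indicator ?B x" for n x
  proof (cases "x \<in> S")
    case True
    then have x: "x \<in> ?B" "p x > 0" "m x > 0" by (auto simp: S_def)
    let ?a = "smooth_step (e n) (p x)" and ?b = "smooth_step (e n) (m x)"
    have key: "\<bar>smooth_step_deriv (e n) s * d\<bar> \<le> \<bar>C\<bar>" if "s > 0" "\<bar>d\<bar> \<le> C * s" for s d
    proof -
      have "\<bar>smooth_step_deriv (e n) s * d\<bar> \<le> smooth_step_deriv (e n) s * (\<bar>C\<bar> * s)"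
        using smooth_step_deriv_bound[OF e that(1), of n] that
        by (auto simp: abs_mult intro!: mult_left_mono order_trans[OF that(2)] mult_right_mono)
      also have "\<dots> = \<bar>C\<bar> * (smooth_step_deriv (e n) s * s)" by simp
      also have "\<dots> \<le> \<bar>C\<bar> * 1"
        using smooth_step_deriv_bound[OF e that(1), of n] by (intro mult_left_mono) auto
      finally show ?thesis by simp
    qed
    have a: "\<bar>?a\<bar> \<le> 1" "\<bar>?b\<bar> \<le> 1" using smooth_step_bounds[of "e n"] by (simp_all add: abs_le_iff)
    have "\<bar>?a * ?b\<bar> \<le> 1 * 1" unfolding abs_mult using a by (intro mult_mono) auto
    then have 1: "\<bar>?a * ?b * \<Phi> x\<bar> \<le> 1 * M1"
      unfolding abs_mult[of "?a * ?b"] using M1(2)[OF x(1)] by (intro mult_mono) auto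
    have 2: "\<bar>\<theta> x * (smooth_step_deriv (e n) (p x) * frechet_derivative p (at x) (F x)) * ?b\<bar> \<le> (M2 * \<bar>C\<bar>) * 1"
      unfolding abs_mult[of _ ?b] abs_mult[of "\<theta> x"]
      using M2(2)[OF x(1)] key[OF x(2) bp[OF x]] a M2(1) by (intro mult_mono) auto
    have 3: "\<bar>\<theta> x * ?a * (smooth_step_deriv (e n) (m x) * frechet_derivative m (at x) (F x))\<bar> \<le> (M2 * 1) * \<bar>C\<bar>"
      unfolding abs_mult[of "\<theta> x * ?a"] abs_mult[of "\<theta> x"]
      using M2(2)[OF x(1)] key[OF x(3) bm[OF x]] a M2(1) by (intro mult_mono) auto
    have "\<bar>G n x\<bar> \<le> M" using 1 2 3 unfolding G_def M_def by linarith
    then show ?thesis using True x by simp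
  next
    case False
    then show ?thesis using M1(1) M2(1) by (simp add: M_def)
  qed
  have lim: "(\<lambda>n. indicator S x * G n x) \<longlonglongrightarrow> indicator S x * \<Phi> x" for x
  proof (cases "x \<in> S")
    case True
    then have x: "p x > 0" "m x > 0" by (auto simp: S_def)
    have "(\<lambda>n. G n x) \<longlonglongrightarrow> 1 * 1 * \<Phi> x + \<theta> x * (0 * frechet_derivative p (at x) (F x)) * 1
        + \<theta> x * 1 * (0 * frechet_derivative m (at x) (F x))"
      unfolding G_def e_def by (intro tendsto_intros smooth_step_tendsto x)
    then show ?thesis using True by simp
  qed auto
  have Gm: "(\<lambda>x. indicator S x * G n x) \<in> borel_measurable lborel" for n
  proof -
    have "continuous_on ?B (divergence (T n))"
      using continuous_on_subset[OF continuous_on_divergence[OF TC1] K] .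
    then have "(\<lambda>x. indicator ?B x *\<^sub>R divergence (T n) x) \<in> borel_measurable borel"
      by (intro borel_measurable_continuous_on_indicator) auto
    then show ?thesis by (simp add: G0)
  qed
  have fm: "(\<lambda>x. indicator S x * \<Phi> x) \<in> borel_measurable lborel"
    by (rule borel_measurable_LIMSEQ_real[OF lim Gm])
  have "integrable lborel (\<lambda>x. indicator S x * \<Phi> x)"
    by (rule integrable_dominated_convergence[where s = "\<lambda>n x. indicator S x * G n x", OF fm Gm dom])
      (use lim bound in auto)
  then show "integrable lborel (\<lambda>x. indicator S x * (\<theta> x * divergence F x + frechet_derivative \<theta> (at x) (F x)))"
    by (simp add: \<Phi>_def)
  have "(\<lambda>n. \<integral>x. indicator S x * G n x \<partial>lborel) \<longlonglongrightarrow> (\<integral>x. indicator S x * \<Phi> x \<partial>lborel)"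
    by (rule integral_dominated_convergence[OF fm Gm dom]) (use lim bound in auto)
  then have "(\<lambda>n. 0::real) \<longlonglongrightarrow> (\<integral>x. indicator S x * \<Phi> x \<partial>lborel)" using zero by simp
  then show "(\<integral>x. indicator S x * (\<theta> x * divergence F x + frechet_derivative \<theta> (at x) (F x)) \<partial>lborel) = 0"
    unfolding \<Phi>_def using LIMSEQ_unique tendsto_const by blast
qed

section \<open>The multiplier identity for the conjugated operator\<close>

text \<open>The first two terms are the energy-momentum tensor of the metric \<open>q\<close> contracted with \<open>X\<close>; the
other two come from the zeroth-order part of the multiplier and from the potential \<open>\<tau>\<^sup>2 G v\<close> of the
conjugated operator.\<close>
definition energy_flux ::
    "real^'n^'n \<Rightarrow> real^'n \<Rightarrow> real \<Rightarrow> real \<Rightarrow> real \<Rightarrow> real \<Rightarrow> real^'n \<Rightarrow> real^'n"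
  where "energy_flux q X G \<rho> \<tau> v D =
    (4 * (X \<bullet> D)) *\<^sub>R (q *v D) + (- 2 * ((q *v D) \<bullet> D)) *\<^sub>R X
      + (2 * \<rho> * v) *\<^sub>R (q *v D) + (2 * \<tau>\<^sup>2 * G * v\<^sup>2) *\<^sub>R X"

lemma energy_flux_scale:
  "energy_flux q X G \<rho> \<tau> (e * v) (e *\<^sub>R D) = e\<^sup>2 *\<^sub>R energy_flux q X G \<rho> \<tau> v D"
  by (simp add: energy_flux_def matrix_vector_mult_scaleR power2_eq_square algebra_simps)

text \<open>A function that vanishes on a face has a conormal gradient there. If the face is characteristic,
both \<open>\<langle>q d, d\<rangle>\<close> terms drop out and the flux is tangent to the face.\<close>
lemma energy_flux_characteristic:
  assumes "(q *v d) \<bullet> d = 0"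
  shows "energy_flux q X G \<rho> \<tau> 0 (t *\<^sub>R d) \<bullet> d = 0"
  using assms by (simp add: energy_flux_def matrix_vector_mult_scaleR inner_add_left)

lemma C1_on_energy_flux:
  assumes "C1_on U q" "C1_on U X" "C1_on U G" "C1_on U v" "C1_on U D"
  shows "C1_on U (\<lambda>x. energy_flux (q x) (X x) (G x) \<rho> \<tau> (v x) (D x))"
  unfolding energy_flux_def
  by (intro C1_on_add C1_on_scaleR C1_on_mult C1_on_const C1_on_inner C1_on_matrix_vector C1_on_power2 assms)

text \<open>The quadratic form in the gradient that the multiplier method leaves over. If \<open>X = Q grad g\<close>, then
it equals \<open>- 4 Hess g (Q \<xi>, Q \<xi>) + 2 (div X - \<rho>) \<langle>Q \<xi>, \<xi>\<rangle>\<close> up to terms that contain one derivative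
of \<open>Q\<close> and one of \<open>g\<close>; the constant \<open>\<rho>\<close> is free to adjust the multiple of \<open>\<langle>Q \<xi>, \<xi>\<rangle>\<close>.\<close>
definition commutator_form ::
    "(real^'n \<Rightarrow> real^'n^'n) \<Rightarrow> (real^'n \<Rightarrow> real^'n) \<Rightarrow> real \<Rightarrow> real^'n \<Rightarrow> real^'n \<Rightarrow> real"
  where "commutator_form Q X \<rho> x \<xi> =
    - 4 * (frechet_derivative X (at x) (Q x *v \<xi>) \<bullet> \<xi>)
    + 2 * ((frechet_derivative Q (at x) (X x) *v \<xi>) \<bullet> \<xi>)
    + 2 * (divergence X x - \<rho>) * ((Q x *v \<xi>) \<bullet> \<xi>)"

text \<open>The coefficient of \<open>2 \<tau>\<^sup>2 v\<^sup>2\<close> in the multiplier identity, namely \<open>\<rho> G - div (G X)\<close>.\<close>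
definition zeroth_order_coefficient ::
    "(real^'n \<Rightarrow> real^'n) \<Rightarrow> (real^'n \<Rightarrow> real) \<Rightarrow> real \<Rightarrow> real^'n \<Rightarrow> real"
  where "zeroth_order_coefficient X G \<rho> x =
    \<rho> * G x - G x * divergence X x - frechet_derivative G (at x) (X x)"

text \<open>The multiplier identity, obtained from the product rule alone. The second derivatives of \<open>v\<close> other
than those in \<open>div (Q D)\<close> cancel: the first term of the flux contributes \<open>\<langle>X, D' (Q D)\<rangle>\<close>, the second
contributes \<open>\<langle>Q D, D' X\<rangle>\<close>, and these agree because \<open>D'\<close> and \<open>Q\<close> are symmetric. As \<open>\<rho>\<close> is constant,
no derivative falls on it.\<close>
lemma divergence_energy_flux:
  fixes Q :: "real^'n \<Rightarrow> real^'n^'n" and \<rho> \<tau> :: real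
  assumes v: "(v has_derivative (\<lambda>h. D x \<bullet> h)) (at x)"
    and D: "(D has_derivative D') (at x)" and D'_sym: "\<And>a b. D' a \<bullet> b = D' b \<bullet> a"
    and Q: "Q differentiable (at x)" and Q_sym: "\<And>a b. (Q x *v a) \<bullet> b = a \<bullet> (Q x *v b)"
    and X: "X differentiable (at x)" and G: "G differentiable (at x)"
  defines "M \<equiv> 2 * (X x \<bullet> D x) + \<rho> * v x"
  shows "divergence (\<lambda>y. energy_flux (Q y) (X y) (G y) \<rho> \<tau> (v y) (D y)) x
    = 2 * M * (divergence (\<lambda>y. Q y *v D y) x + 2 * \<tau> * (X x \<bullet> D x)
        + \<tau> * v x * divergence X x + \<tau>\<^sup>2 * G x * v x)
      - commutator_form Q X \<rho> x (D x) - 2 * \<tau>\<^sup>2 * zeroth_order_coefficient X G \<rho> x * (v x)\<^sup>2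
      - 2 * \<tau> * M * (M + (divergence X x - \<rho>) * v x)"
proof -
  define Q' where "Q' = frechet_derivative Q (at x)"
  define X' where "X' = frechet_derivative X (at x)"
  define G' where "G' = frechet_derivative G (at x)"
  note [derivative_intros] = Q[unfolded frechet_derivative_works, folded Q'_def]
    X[unfolded frechet_derivative_works, folded X'_def] G[unfolded frechet_derivative_works, folded G'_def] v D
  let ?N = "\<lambda>y. Q y *v D y"
  have N: "(?N has_derivative (\<lambda>h. Q x *v D' h + Q' h *v D x)) (at x)"
    by (rule bounded_bilinear.FDERIV[OF bounded_bilinear_matrix_vector]) (rule derivative_intros)+
  then have Nd: "?N differentiable (at x)" using differentiable_def by blast
  have f1: "((\<lambda>y. 4 * (X y \<bullet> D y)) has_derivative (\<lambda>h. 4 * (X x \<bullet> D' h + X' h \<bullet> D x))) (at x)"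
    by (intro has_derivative_mult_right has_derivative_inner derivative_intros)
  have f2: "((\<lambda>y. - 2 * (?N y \<bullet> D y)) has_derivative
      (\<lambda>h. - 2 * (?N x \<bullet> D' h + (Q x *v D' h + Q' h *v D x) \<bullet> D x))) (at x)"
    by (intro has_derivative_mult_right has_derivative_inner N derivative_intros)
  have f3: "((\<lambda>y. 2 * \<rho> * v y) has_derivative (\<lambda>h. 2 * \<rho> * (D x \<bullet> h))) (at x)"
    by (intro has_derivative_mult_right v)
  have f4: "((\<lambda>y. 2 * \<tau>\<^sup>2 * G y * (v y)\<^sup>2) has_derivative
      (\<lambda>h. 2 * \<tau>\<^sup>2 * G x * (2 * v x * (D x \<bullet> h)) + 2 * \<tau>\<^sup>2 * G' h * (v x)\<^sup>2)) (at x)"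
    by (rule derivative_eq_intros refl | simp add: fun_eq_iff mult_ac)+
  have diff: "(\<lambda>y. f y *\<^sub>R Y y) differentiable (at x)"
    if "(f has_derivative f') (at x)" "Y differentiable (at x)" for f f' and Y :: "real^'n \<Rightarrow> real^'n"
    using has_derivative_scaleR[OF that(1) that(2)[unfolded frechet_derivative_works]] differentiable_def by blast
  have "divergence (\<lambda>y. energy_flux (Q y) (X y) (G y) \<rho> \<tau> (v y) (D y)) x =
    (4 * (X x \<bullet> D x)) * divergence ?N x + 4 * (X x \<bullet> D' (?N x) + X' (?N x) \<bullet> D x)
    + ((- 2 * (?N x \<bullet> D x)) * divergence X x + - 2 * (?N x \<bullet> D' (X x) + (Q x *v D' (X x) + Q' (X x) *v D x) \<bullet> D x))
    + ((2 * \<rho> * v x) * divergence ?N x + 2 * \<rho> * (D x \<bullet> ?N x))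
    + ((2 * \<tau>\<^sup>2 * G x * (v x)\<^sup>2) * divergence X x + (2 * \<tau>\<^sup>2 * G x * (2 * v x * (D x \<bullet> X x)) + 2 * \<tau>\<^sup>2 * G' (X x) * (v x)\<^sup>2))"
    unfolding energy_flux_def
    by (simp only: divergence_add differentiable_add diff[OF f1 Nd] diff[OF f2 X] diff[OF f3 Nd] diff[OF f4 X]
      divergence_scaleR[OF f1 Nd] divergence_scaleR[OF f2 X] divergence_scaleR[OF f3 Nd] divergence_scaleR[OF f4 X])
  moreover have "X x \<bullet> D' (?N x) = ?N x \<bullet> D' (X x)"
    using D'_sym[of "?N x" "X x"] by (simp add: inner_commute)
  moreover have "(Q x *v D' (X x)) \<bullet> D x = ?N x \<bullet> D' (X x)"
    using Q_sym[of "D' (X x)" "D x"] by (simp add: inner_commute)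
  moreover have "D x \<bullet> X x = X x \<bullet> D x" "D x \<bullet> ?N x = ?N x \<bullet> D x" by (simp_all add: inner_commute)
  ultimately show ?thesis
    unfolding M_def commutator_form_def zeroth_order_coefficient_def Q'_def[symmetric] X'_def[symmetric] G'_def[symmetric]
    by (simp add: inner_add_left power2_eq_square algebra_simps)
qed

text \<open>Half of \<open>2 \<tau> M\<^sup>2\<close> controls the source term through \<open>2 M h \<le> \<tau> M\<^sup>2 + h\<^sup>2 / \<tau>\<close>; the other half
controls \<open>2 \<tau> k M v\<close> at the cost of \<open>\<tau> k\<^sup>2 v\<^sup>2\<close>, which is of lower order than \<open>c \<tau>\<^sup>2 v\<^sup>2\<close>.\<close>
lemma absorb_cross_terms:
  fixes M h v c k \<tau> z d E \<delta> :: real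
  assumes \<tau>: "\<tau> > 0" "k\<^sup>2 \<le> c * \<tau>" and E: "c * d\<^sup>2 \<le> E" and z: "c \<le> z"
    and \<delta>: "\<delta> = 2 * M * h - E - 2 * \<tau>\<^sup>2 * z * v\<^sup>2 - 2 * \<tau> * M * (M + k * v)"
  shows "c * (d\<^sup>2 + \<tau>\<^sup>2 * v\<^sup>2) + \<delta> \<le> h\<^sup>2 / \<tau>"
proof -
  have "0 \<le> (\<tau> * M - h)\<^sup>2" "0 \<le> (M + k * v)\<^sup>2" by simp_all
  then have "0 \<le> (\<tau> * M - h)\<^sup>2 / \<tau>" "0 \<le> \<tau> * (M + k * v)\<^sup>2" using \<tau> by simp_all
  then have 1: "2 * M * h \<le> \<tau> * M\<^sup>2 + h\<^sup>2 / \<tau>"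
    using \<tau> by (simp add: power2_eq_square field_simps)
  have 2: "- 2 * \<tau> * M * (M + k * v) \<le> - \<tau> * M\<^sup>2 + \<tau> * k\<^sup>2 * v\<^sup>2"
    using \<open>0 \<le> \<tau> * (M + k * v)\<^sup>2\<close> by (simp add: power2_eq_square algebra_simps)
  have "\<tau> * k\<^sup>2 * v\<^sup>2 \<le> \<tau> * (c * \<tau>) * v\<^sup>2"
    using \<tau> by (intro mult_right_mono mult_left_mono) auto
  moreover have "\<tau>\<^sup>2 * v\<^sup>2 * c \<le> \<tau>\<^sup>2 * v\<^sup>2 * z" using z by (intro mult_left_mono) auto
  ultimately show ?thesis
    using 1 2 E unfolding \<delta> by (simp add: power2_eq_square algebra_simps)
qed

text \<open>The operator is \<open>u \<mapsto> div (Q grad u)\<close> and \<open>\<Gamma>\<close> is the gradient of the weight \<open>g\<close>. The field \<open>X\<close> below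
is the gradient of \<open>g\<close> for the metric \<open>Q\<close>, and \<open>G\<close> is its squared length, of either sign.\<close>
locale weighted_operator =
  fixes U :: "(real^'n) set" and Q :: "real^'n \<Rightarrow> real^'n^'n"
    and g :: "real^'n \<Rightarrow> real" and \<Gamma> :: "real^'n \<Rightarrow> real^'n"
  assumes open_U: "open U"
    and Q_C1: "C1_on U Q" and Q_sym: "\<And>x a b. x \<in> U \<Longrightarrow> (Q x *v a) \<bullet> b = a \<bullet> (Q x *v b)"
    and g_deriv: "\<And>x. x \<in> U \<Longrightarrow> (g has_derivative (\<lambda>h. \<Gamma> x \<bullet> h)) (at x)"
    and \<Gamma>_C1: "C1_on U \<Gamma>"
begin

definition X :: "real^'n \<Rightarrow> real^'n" where "X x = Q x *v \<Gamma> x"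

definition G :: "real^'n \<Rightarrow> real" where "G x = X x \<bullet> \<Gamma> x"

text \<open>The gradient of \<open>exp (- \<tau> g) u\<close>, by \<open>conj_deriv\<close> below.\<close>
definition conj_grad :: "real \<Rightarrow> (real^'n \<Rightarrow> real) \<Rightarrow> (real^'n \<Rightarrow> real^'n) \<Rightarrow> real^'n \<Rightarrow> real^'n"
  where "conj_grad \<tau> u du x = exp (- \<tau> * g x) *\<^sub>R (du x - (\<tau> * u x) *\<^sub>R \<Gamma> x)"

definition flux :: "real \<Rightarrow> real \<Rightarrow> (real^'n \<Rightarrow> real) \<Rightarrow> (real^'n \<Rightarrow> real^'n) \<Rightarrow> real^'n \<Rightarrow> real^'n"
  where "flux \<rho> \<tau> u du x =
    energy_flux (Q x) (X x) (G x) \<rho> \<tau> (exp (- \<tau> * g x) * u x) (conj_grad \<tau> u du x)"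

lemma X_C1: "C1_on U X"
  unfolding X_def[abs_def] by (intro C1_on_matrix_vector Q_C1 \<Gamma>_C1)

lemma G_C1: "C1_on U G"
  unfolding G_def[abs_def] by (intro C1_on_inner X_C1 \<Gamma>_C1)

lemma g_C1: "C1_on U g"
  by (rule C1_on_if_C1_gradient[OF g_deriv \<Gamma>_C1])

context
  fixes u :: "real^'n \<Rightarrow> real" and du :: "real^'n \<Rightarrow> real^'n"
  assumes u_deriv: "\<And>x. x \<in> U \<Longrightarrow> (u has_derivative (\<lambda>h. du x \<bullet> h)) (at x)"
    and du_C1: "C1_on U du"
begin

lemma u_C1: "C1_on U u"
  by (rule C1_on_if_C1_gradient[OF u_deriv du_C1])

lemma conj_deriv:
  assumes x: "x \<in> U"
  shows "((\<lambda>y. exp (- \<tau> * g y) * u y) has_derivative (\<lambda>h. conj_grad \<tau> u du x \<bullet> h)) (at x)"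
  unfolding conj_grad_def
  by (rule derivative_eq_intros g_deriv u_deriv x refl | simp add: algebra_simps inner_diff_left)+

lemma conj_grad_C1: "C1_on U (conj_grad \<tau> u du)"
  unfolding conj_grad_def[abs_def]
  by (intro C1_on_scaleR C1_on_exp C1_on_mult C1_on_const g_C1 C1_on_diff du_C1 u_C1 \<Gamma>_C1)

lemma flux_C1: "C1_on U (flux \<rho> \<tau> u du)"
  unfolding flux_def[abs_def]
  by (intro C1_on_energy_flux Q_C1 X_C1 G_C1 C1_on_mult C1_on_exp C1_on_const g_C1 u_C1 conj_grad_C1)

text \<open>The conjugated operator: the left-hand side is \<open>exp (- \<tau> g) L (exp (\<tau> g) v)\<close> expanded in powers of
\<open>\<tau>\<close>, for \<open>v = exp (- \<tau> g) u\<close>.\<close>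
lemma conjugated_divergence:
  assumes x: "x \<in> U"
  shows "divergence (\<lambda>y. Q y *v conj_grad \<tau> u du y) x + 2 * \<tau> * (X x \<bullet> conj_grad \<tau> u du x)
        + \<tau> * (exp (- \<tau> * g x) * u x) * divergence X x + \<tau>\<^sup>2 * G x * (exp (- \<tau> * g x) * u x)
      = exp (- \<tau> * g x) * divergence (\<lambda>y. Q y *v du y) x"
proof -
  let ?e = "\<lambda>y. exp (- \<tau> * g y)"
  have eq: "(\<lambda>y. Q y *v conj_grad \<tau> u du y) = (\<lambda>y. ?e y *\<^sub>R (Q y *v du y) + (- \<tau> * (?e y * u y)) *\<^sub>R X y)"
    by (simp add: conj_grad_def X_def matrix_vector_mult_scaleR matrix_vector_mult_diff_distrib algebra_simps)
  have e: "(?e has_derivative (\<lambda>h. - \<tau> * ?e x * (\<Gamma> x \<bullet> h))) (at x)"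
    by (rule derivative_eq_intros g_deriv x refl | simp add: fun_eq_iff mult_ac)+
  have f: "((\<lambda>y. - \<tau> * (?e y * u y)) has_derivative (\<lambda>h. - \<tau> * (conj_grad \<tau> u du x \<bullet> h))) (at x)"
    by (intro has_derivative_mult_right conj_deriv x)
  have N: "C1_on U (\<lambda>y. Q y *v du y)" by (intro C1_on_matrix_vector Q_C1 du_C1)
  note d = C1_on_differentiable[OF N x] C1_on_differentiable[OF X_C1 x]
  have s: "(\<lambda>y. a y *\<^sub>R Y y) differentiable (at x)"
    if "(a has_derivative a') (at x)" "Y differentiable (at x)" for a a' and Y :: "real^'n \<Rightarrow> real^'n"
    using has_derivative_scaleR[OF that(1) that(2)[unfolded frechet_derivative_works]] differentiable_def by blast
  have 1: "divergence (\<lambda>y. Q y *v conj_grad \<tau> u du y) x =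
     ?e x * divergence (\<lambda>y. Q y *v du y) x + - \<tau> * ?e x * (\<Gamma> x \<bullet> (Q x *v du x))
     + ((- \<tau> * (?e x * u x)) * divergence X x + - \<tau> * (conj_grad \<tau> u du x \<bullet> X x))"
    unfolding eq by (simp only: divergence_add s[OF e d(1)] s[OF f d(2)] divergence_scaleR[OF e d(1)] divergence_scaleR[OF f d(2)])
  have 2: "\<Gamma> x \<bullet> (Q x *v du x) = X x \<bullet> du x"
    using Q_sym[OF x, of "\<Gamma> x" "du x"] by (simp add: X_def)
  have 3: "X x \<bullet> conj_grad \<tau> u du x = ?e x * (X x \<bullet> du x - \<tau> * u x * G x)"
    by (simp add: conj_grad_def G_def inner_diff_right)
  show ?thesis
    unfolding 1 2 inner_commute[of _ "X x"] 3 by (simp add: power2_eq_square algebra_simps)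
qed

lemma carleman_pointwise:
  assumes x: "x \<in> U" and \<tau>: "\<tau> > 0" "(divergence X x - \<rho>)\<^sup>2 \<le> c * \<tau>"
    and form: "\<And>\<xi>. c * (norm \<xi>)\<^sup>2 \<le> commutator_form Q X \<rho> x \<xi>"
    and zeroth: "c \<le> zeroth_order_coefficient X G \<rho> x"
  shows "c * ((norm (conj_grad \<tau> u du x))\<^sup>2 + \<tau>\<^sup>2 * (exp (- \<tau> * g x) * u x)\<^sup>2) + divergence (flux \<rho> \<tau> u du) x
    \<le> (exp (- \<tau> * g x) * divergence (\<lambda>y. Q y *v du y) x)\<^sup>2 / \<tau>"
proof (rule absorb_cross_terms[OF \<tau> form zeroth])
  have sym: "frechet_derivative (conj_grad \<tau> u du) (at x) a \<bullet> b = frechet_derivative (conj_grad \<tau> u du) (at x) b \<bullet> a" for a b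
    by (rule grad_field_derivative_symmetric[OF open_U x conj_deriv conj_grad_C1])
  show "divergence (flux \<rho> \<tau> u du) x = 2 * (2 * (X x \<bullet> conj_grad \<tau> u du x) + \<rho> * (exp (- \<tau> * g x) * u x))
      * (exp (- \<tau> * g x) * divergence (\<lambda>y. Q y *v du y) x)
      - commutator_form Q X \<rho> x (conj_grad \<tau> u du x)
      - 2 * \<tau>\<^sup>2 * zeroth_order_coefficient X G \<rho> x * (exp (- \<tau> * g x) * u x)\<^sup>2
      - 2 * \<tau> * (2 * (X x \<bullet> conj_grad \<tau> u du x) + \<rho> * (exp (- \<tau> * g x) * u x))
      * (2 * (X x \<bullet> conj_grad \<tau> u du x) + \<rho> * (exp (- \<tau> * g x) * u x)
         + (divergence X x - \<rho>) * (exp (- \<tau> * g x) * u x))"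
    unfolding flux_def[abs_def]
    using divergence_energy_flux[where v = "\<lambda>y. exp (- \<tau> * g y) * u y" and D = "conj_grad \<tau> u du"
        and x = x and Q = Q and X = X and G = G and \<rho> = \<rho> and \<tau> = \<tau>,
      OF conj_deriv[OF x] C1_on_has_derivative[OF conj_grad_C1 x] sym
      C1_on_differentiable[OF Q_C1 x] Q_sym[OF x] C1_on_differentiable[OF X_C1 x] C1_on_differentiable[OF G_C1 x]]
    unfolding conjugated_divergence[OF x] .
qed

text \<open>Both arguments of the flux carry the factor \<open>exp (- \<tau> g)\<close> and the flux is quadratic in them.\<close>
lemma flux_eq:
  "flux \<rho> \<tau> u du x = exp (- 2 * \<tau> * g x) *\<^sub>R
     energy_flux (Q x) (X x) (G x) \<rho> \<tau> (u x) (du x - (\<tau> * u x) *\<^sub>R \<Gamma> x)"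
  unfolding flux_def conj_grad_def energy_flux_scale
  by (simp add: power2_eq_square exp_add[symmetric])

end

end

section \<open>Quadratic forms of Lorentzian signature\<close>

text \<open>Eigenspaces of a symmetric matrix for different eigenvalues are orthogonal, hence their dimensions
add up and the quadratic form is diagonal on their sum. The orthogonality to the remaining
eigenspaces carries the induction.\<close>
lemma positive_eigenspaces_sum:
  fixes A :: "real^'n^'n"
  assumes sym: "\<And>a b. (A *v a) \<bullet> b = a \<bullet> (A *v b)"
    and T: "finite T" "\<And>l. l \<in> T \<Longrightarrow> l > 0"
  shows "\<exists>V. subspace V \<and> dim V = (\<Sum>l\<in>T. dim (eigenspace A l))
    \<and> (\<forall>x\<in>V. x \<noteq> 0 \<longrightarrow> (A *v x) \<bullet> x > 0)
    \<and> (\<forall>x\<in>V. \<forall>l. l \<notin> T \<longrightarrow> (\<forall>y\<in>eigenspace A l. x \<bullet> y = 0))"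
  using T
proof (induction T rule: finite_induct)
  case empty
  show ?case by (rule exI[of _ "{0}"]) (simp add: subspace_single_0)
next
  case (insert l T)
  then obtain V where V: "subspace V" "dim V = (\<Sum>l\<in>T. dim (eigenspace A l))"
    "\<And>x. x \<in> V \<Longrightarrow> x \<noteq> 0 \<Longrightarrow> (A *v x) \<bullet> x > 0"
    "\<And>x l y. x \<in> V \<Longrightarrow> l \<notin> T \<Longrightarrow> y \<in> eigenspace A l \<Longrightarrow> x \<bullet> y = 0" by auto
  let ?E = "eigenspace A l"
  have E: "subspace ?E"
    by (auto simp: subspace_def eigenspace_def matrix_vector_right_distrib matrix_vector_mult_scaleR scaleR_add_right)
  let ?W = "{x + y |x y. x \<in> V \<and> y \<in> ?E}"
  have "V \<inter> ?E = {0}"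
  proof -
    have "x = 0" if "x \<in> V" "x \<in> ?E" for x
      using V(4)[OF that(1) insert.hyps(2) that(2)] by simp
    then show ?thesis using V(1) E by (auto simp: subspace_0)
  qed
  then have "dim (V \<inter> ?E) = 0" by simp
  then have dim: "dim ?W = (\<Sum>l\<in>insert l T. dim (eigenspace A l))"
    unfolding sum.insert[OF insert.hyps] using dim_sums_Int[OF V(1) E] V(2) by linarith
  have pos: "(A *v (x + y)) \<bullet> (x + y) > 0" if xy: "x \<in> V" "y \<in> ?E" "x + y \<noteq> 0" for x y
  proof -
    have o: "x \<bullet> y = 0" "A *v y = l *\<^sub>R y"
      using V(4)[OF xy(1) insert.hyps(2) xy(2)] xy(2) by (auto simp: eigenspace_def)
    then have eq: "(A *v (x + y)) \<bullet> (x + y) = (A *v x) \<bullet> x + l * (y \<bullet> y)"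
      using sym[of x y] by (simp add: matrix_vector_right_distrib inner_add_left inner_add_right inner_commute[of y x])
    moreover have "l > 0" using insert.prems by simp
    ultimately show ?thesis
    proof (cases "x = 0")
      case False
      then show ?thesis using V(3)[OF xy(1) False] \<open>l > 0\<close> eq
        by (simp add: add_pos_nonneg)
    qed (use \<open>x + y \<noteq> 0\<close> \<open>l > 0\<close> in simp)
  qed
  have ort: "(x + y) \<bullet> z = 0" if "x \<in> V" "y \<in> ?E" "k \<notin> insert l T" "z \<in> eigenspace A k" for x y z k
  proof -
    have "l * (y \<bullet> z) = k * (y \<bullet> z)"
      using sym[of y z] that by (simp add: eigenspace_def)
    then have "y \<bullet> z = 0" using that(3) by auto
    then show ?thesis using V(4)[of x k z] that by (simp add: inner_add_left)
  qed
  show ?case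
  proof (intro exI[of _ ?W] conjI ballI allI impI)
    show "subspace ?W" by (rule subspace_sums[OF V(1) E])
    show "dim ?W = (\<Sum>l\<in>insert l T. dim (eigenspace A l))" by (rule dim)
  next
    fix w assume "w \<in> ?W" "w \<noteq> 0"
    then show "(A *v w) \<bullet> w > 0" using pos by auto
  next
    fix w k z assume "w \<in> ?W" "k \<notin> insert l T" "z \<in> eigenspace A k"
    then show "w \<bullet> z = 0" using ort by blast
  qed
qed

text \<open>A subspace of dimension 2 meets the positive subspace of dimension \<open>n - 1\<close> nontrivially.\<close>
lemma lorentz_signature_positive_direction:
  fixes A :: "real^'n^'n"
  assumes sig: "has_signature A (CARD('n) - 1) 1" and n: "CARD('n) \<ge> 2"
    and sym: "\<And>a b. (A *v a) \<bullet> b = a \<bullet> (A *v b)"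
    and S: "subspace S" "dim S \<ge> 2"
  shows "\<exists>x\<in>S. (A *v x) \<bullet> x > 0"
proof -
  let ?T = "{l \<in> eigenvalues A. l > 0}"
  have sum: "(\<Sum>l\<in>?T. dim (eigenspace A l)) = CARD('n) - 1" using sig by (simp add: has_signature_def)
  have "finite ?T"
  proof (rule ccontr)
    assume "infinite ?T"
    then show False using sum n by simp
  qed
  moreover have "l > 0" if "l \<in> ?T" for l using that by simp
  ultimately obtain V where V: "subspace V" "dim V = (\<Sum>l\<in>?T. dim (eigenspace A l))"
    "\<forall>x\<in>V. x \<noteq> 0 \<longrightarrow> (A *v x) \<bullet> x > 0"
    using positive_eigenspaces_sum[OF sym, of ?T] by meson
  have "dim {x + y |x y. x \<in> V \<and> y \<in> S} \<le> CARD('n)"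
    using dim_subset_UNIV[of "{x + y |x y. x \<in> V \<and> y \<in> S}"] by simp
  then have "dim (V \<inter> S) \<ge> 1" using dim_sums_Int[OF V(1) S(1)] V(2) sum S(2) n by linarith
  then have "\<not> V \<inter> S \<subseteq> {0}" using dim_eq_0[of "V \<inter> S"] by linarith
  then show ?thesis using V(3) by blast
qed

text \<open>This form is the main part of the commutator form at a corner point, with \<open>d\<close>, \<open>e\<close> the two conormals.
Splitting \<open>\<xi>\<close> into its component \<open>\<zeta>\<close> orthogonal to the hyperbolic plane of \<open>d\<close>, \<open>e\<close> and the rest turns it
into \<open>2 q \<langle>A \<zeta>, \<zeta>\<rangle> + 2 a\<^sup>2 + 2 b\<^sup>2 + 6 (a + b)\<^sup>2\<close>, and \<open>A\<close> is positive on the orthogonal complement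
of a hyperbolic plane: otherwise \<open>\<zeta>\<close> and the timelike vector \<open>d - e\<close> would span a plane without
positive directions.\<close>
lemma lorentz_corner_form_positive:
  fixes A :: "real^'n^'n"
  assumes sig: "has_signature A (CARD('n) - 1) 1" and n: "CARD('n) \<ge> 2"
    and sym: "\<And>a b. (A *v a) \<bullet> b = a \<bullet> (A *v b)"
    and char: "(A *v d) \<bullet> d = 0" "(A *v e) \<bullet> e = 0" and q: "(A *v d) \<bullet> e > 0" and \<xi>: "\<xi> \<noteq> 0"
  shows "0 < 2 * ((A *v d) \<bullet> e) * ((A *v \<xi>) \<bullet> \<xi>) - 8 * ((A *v d) \<bullet> \<xi>) * ((A *v e) \<bullet> \<xi>)
      + 8 * ((A *v d) \<bullet> \<xi> + (A *v e) \<bullet> \<xi>)\<^sup>2"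
proof -
  define q where "q = (A *v d) \<bullet> e"
  define a where "a = (A *v d) \<bullet> \<xi>"
  define b where "b = (A *v e) \<bullet> \<xi>"
  \<comment> \<open>The coefficients make \<open>\<zeta>\<close> orthogonal to both \<open>d\<close> and \<open>e\<close> with respect to \<open>A\<close>.\<close>
  define \<zeta> where "\<zeta> = \<xi> - (b / q) *\<^sub>R d - (a / q) *\<^sub>R e"
  have qpos: "q > 0" using q by (simp add: q_def)
  have ed: "(A *v e) \<bullet> d = q" using sym[of e d] by (simp add: q_def inner_commute)
  have \<zeta>1: "(A *v d) \<bullet> \<zeta> = 0" "(A *v e) \<bullet> \<zeta> = 0"
    using qpos char ed by (simp_all add: \<zeta>_def inner_diff_right a_def[symmetric] b_def[symmetric] q_def[symmetric])
  have \<zeta>2: "(A *v \<zeta>) \<bullet> d = 0" "(A *v \<zeta>) \<bullet> e = 0"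
    using \<zeta>1 sym[of \<zeta>] by (simp_all add: inner_commute)
  have \<xi>_eq: "\<xi> = \<zeta> + (b / q) *\<^sub>R d + (a / q) *\<^sub>R e" by (simp add: \<zeta>_def)
  have form: "(A *v \<xi>) \<bullet> \<xi> = (A *v \<zeta>) \<bullet> \<zeta> + 2 * a * b / q"
    using qpos char ed \<zeta>1 \<zeta>2 unfolding \<xi>_eq
    by (simp add: matrix_vector_right_distrib matrix_vector_mult_scaleR inner_add_left inner_add_right q_def[symmetric] field_simps)
  have pos: "(A *v \<zeta>) \<bullet> \<zeta> > 0" if "\<zeta> \<noteq> 0"
  proof (rule ccontr)
    assume neg: "\<not> (A *v \<zeta>) \<bullet> \<zeta> > 0"
    let ?S = "span {d - e, \<zeta>}"
    have "d - e \<notin> span {\<zeta>}"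
    proof
      assume "d - e \<in> span {\<zeta>}"
      then obtain k where "d - e = k *\<^sub>R \<zeta>" by (auto simp: span_singleton)
      then have "(A *v d) \<bullet> (d - e) = 0" using \<zeta>1 by simp
      then show False using char qpos by (simp add: inner_diff_right q_def)
    qed
    then have "independent {d - e, \<zeta>}" "d - e \<noteq> \<zeta>"
      using that by (auto simp: independent_insert span_base)
    then have "dim ?S = 2" by (simp add: dim_eq_card_independent)
    then obtain x where x: "x \<in> ?S" "(A *v x) \<bullet> x > 0"
      using lorentz_signature_positive_direction[OF sig n sym subspace_span, of "{d - e, \<zeta>}"] by auto
    then obtain s where "x - s *\<^sub>R (d - e) \<in> span {\<zeta>}" by (auto simp: span_breakdown_eq)
    then obtain t where "x - s *\<^sub>R (d - e) = t *\<^sub>R \<zeta>" by (auto simp: span_singleton)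
    then have x_eq: "x = s *\<^sub>R (d - e) + t *\<^sub>R \<zeta>" by (simp add: diff_eq_eq add.commute)
    have "(A *v x) \<bullet> x = t\<^sup>2 * ((A *v \<zeta>) \<bullet> \<zeta>) - 2 * q * s\<^sup>2"
      unfolding x_eq using char ed \<zeta>1 \<zeta>2
      by (simp add: matrix_vector_right_distrib matrix_vector_mult_diff_distrib matrix_vector_mult_scaleR
          inner_add_left inner_add_right inner_diff_left inner_diff_right q_def[symmetric] power2_eq_square algebra_simps)
    moreover have "t\<^sup>2 * ((A *v \<zeta>) \<bullet> \<zeta>) \<le> 0" using neg by (intro mult_nonneg_nonpos) auto
    moreover have "2 * q * s\<^sup>2 \<ge> 0" using qpos by simp
    ultimately show False using x(2) by linarith
  qed
  have eq: "2 * q * ((A *v \<xi>) \<bullet> \<xi>) - 8 * a * b + 8 * (a + b)\<^sup>2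
      = 2 * q * ((A *v \<zeta>) \<bullet> \<zeta>) + 2 * a\<^sup>2 + 2 * b\<^sup>2 + 6 * (a + b)\<^sup>2"
    using qpos unfolding form by (simp add: power2_eq_square field_simps)
  have nn: "2 * a\<^sup>2 \<ge> 0" "2 * b\<^sup>2 \<ge> 0" "6 * (a + b)\<^sup>2 \<ge> 0" by auto
  have "0 < 2 * q * ((A *v \<zeta>) \<bullet> \<zeta>) + 2 * a\<^sup>2 + 2 * b\<^sup>2 + 6 * (a + b)\<^sup>2"
  proof (cases "\<zeta> = 0")
    case True
    then have "a \<noteq> 0 \<or> b \<noteq> 0" using \<xi> \<xi>_eq by auto
    then have "2 * a\<^sup>2 > 0 \<or> 2 * b\<^sup>2 > 0" by auto
    moreover have "2 * q * ((A *v \<zeta>) \<bullet> \<zeta>) = 0" using True by simp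
    ultimately show ?thesis using nn by linarith
  next
    case False
    then have "2 * q * ((A *v \<zeta>) \<bullet> \<zeta>) > 0" using qpos pos by simp
    then show ?thesis using nn by linarith
  qed
  then show ?thesis using eq by (simp add: q_def a_def b_def)
qed

text \<open>By homogeneity, bounds on the compact unit sphere extend to all vectors.\<close>
lemma quadratic_form_upper_bound:
  fixes f :: "'a::euclidean_space \<Rightarrow> real"
  assumes f: "continuous_on (sphere 0 1) f" and hom: "\<And>t \<xi>. f (t *\<^sub>R \<xi>) = t\<^sup>2 * f \<xi>"
  shows "\<exists>C>0. \<forall>\<xi>. f \<xi> \<le> C * (norm \<xi>)\<^sup>2"
proof -
  obtain M where M: "\<And>\<xi>. \<xi> \<in> sphere 0 1 \<Longrightarrow> norm (f \<xi>) \<le> M"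
    using continuous_on_compact_bound[OF compact_sphere f] by blast
  define C where "C = max M 1"
  have C: "f \<xi> \<le> C" if "norm \<xi> = 1" for \<xi>
    using M[of \<xi>] that by (simp add: C_def abs_le_iff le_max_iff_disj)
  have "f \<xi> \<le> C * (norm \<xi>)\<^sup>2" for \<xi>
  proof (cases "\<xi> = 0")
    case True then show ?thesis using hom[of 0 \<xi>] by simp
  next
    case False
    have "f \<xi> = (norm \<xi>)\<^sup>2 * f (\<xi> /\<^sub>R norm \<xi>)" using hom[of "norm \<xi>" "\<xi> /\<^sub>R norm \<xi>"] False by simp
    also have "\<dots> \<le> (norm \<xi>)\<^sup>2 * C" using False C[of "\<xi> /\<^sub>R norm \<xi>"] by (intro mult_left_mono) auto
    finally show ?thesis by (simp add: mult.commute)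
  qed
  moreover have "C > 0" by (simp add: C_def)
  ultimately show ?thesis by blast
qed

lemma quadratic_form_lower_bound:
  fixes f :: "'a::euclidean_space \<Rightarrow> real"
  assumes f: "continuous_on (sphere 0 1) f" and hom: "\<And>t \<xi>. f (t *\<^sub>R \<xi>) = t\<^sup>2 * f \<xi>"
    and pos: "\<And>\<xi>. \<xi> \<noteq> 0 \<Longrightarrow> f \<xi> > 0"
  shows "\<exists>c>0. \<forall>\<xi>. c * (norm \<xi>)\<^sup>2 \<le> f \<xi>"
proof -
  obtain z :: 'a where "norm z = 1" using vector_choose_size[of 1] by auto
  then have "z \<in> sphere 0 1" by simp
  then have ne: "sphere 0 1 \<noteq> ({} :: 'a set)" by blast
  obtain \<eta> where \<eta>: "\<eta> \<in> sphere 0 1" "\<forall>\<xi>\<in>sphere 0 1. f \<eta> \<le> f \<xi>"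
    using continuous_attains_inf[OF compact_sphere ne f] by (elim bexE)
  define c where "c = f \<eta>"
  have "c * (norm \<xi>)\<^sup>2 \<le> f \<xi>" for \<xi>
  proof (cases "\<xi> = 0")
    case True then show ?thesis using hom[of 0 \<xi>] by simp
  next
    case False
    have "f \<xi> = (norm \<xi>)\<^sup>2 * f (\<xi> /\<^sub>R norm \<xi>)" using hom[of "norm \<xi>" "\<xi> /\<^sub>R norm \<xi>"] False by simp
    moreover have "(norm \<xi>)\<^sup>2 * c \<le> (norm \<xi>)\<^sup>2 * f (\<xi> /\<^sub>R norm \<xi>)"
      using False bspec[OF \<eta>(2), of "\<xi> /\<^sub>R norm \<xi>"] by (intro mult_left_mono) (auto simp: c_def)
    ultimately show ?thesis by (simp add: mult.commute)
  qed
  moreover have "c > 0" 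
  proof -
    have "\<eta> \<noteq> 0" using \<eta>(1) by auto
    then show ?thesis using pos by (simp add: c_def)
  qed
  ultimately show ?thesis by blast
qed

section \<open>A strictly convex weight at a corner point\<close>

context weighted_operator
begin

lemma commutator_form_continuous:
  "continuous_on (U \<times> UNIV) (\<lambda>z. commutator_form Q X \<rho> (fst z) (snd z))"
proof -
  have c: "continuous_on (U \<times> UNIV) (\<lambda>z. f (fst z))" if "continuous_on U f" for f :: "real^'n \<Rightarrow> 'b::topological_space"
    by (rule continuous_on_compose2[OF that continuous_on_fst[OF continuous_on_id]]) auto
  have Q: "continuous_on (U \<times> UNIV) (\<lambda>z. Q (fst z) *v snd z)"
    by (intro bounded_bilinear.continuous_on[OF bounded_bilinear_matrix_vector] c C1_on_continuous_on Q_C1 continuous_intros)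
  have X': "continuous_on (U \<times> UNIV) (\<lambda>z. frechet_derivative X (at (fst z)) (Q (fst z) *v snd z))"
    by (rule continuous_on_frechet_derivative[OF X_C1 continuous_on_fst[OF continuous_on_id] _ Q]) auto
  have Q': "continuous_on (U \<times> UNIV) (\<lambda>z. frechet_derivative Q (at (fst z)) (X (fst z)))"
    by (rule continuous_on_frechet_derivative[OF Q_C1 continuous_on_fst[OF continuous_on_id] _ c[OF C1_on_continuous_on[OF X_C1]]]) auto
  show ?thesis
    unfolding commutator_form_def
    by (intro continuous_intros bounded_bilinear.continuous_on[OF bounded_bilinear_matrix_vector Q' ] X' Q
        c[OF continuous_on_divergence[OF X_C1]])
qed

lemma zeroth_order_coefficient_continuous: "continuous_on U (zeroth_order_coefficient X G \<rho>)"
  unfolding zeroth_order_coefficient_def[abs_def]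
  by (intro continuous_intros C1_on_continuous_on G_C1 continuous_on_divergence X_C1
      continuous_on_frechet_derivative[OF G_C1]) auto

lemma commutator_form_scale:
  assumes "x \<in> U"
  shows "commutator_form Q X \<rho> x (t *\<^sub>R \<xi>) = t\<^sup>2 * commutator_form Q X \<rho> x \<xi>"
proof -
  have "linear (frechet_derivative X (at x))"
    using C1_on_has_derivative[OF X_C1 assms] has_derivative_linear by blast
  then show ?thesis
    by (simp add: commutator_form_def matrix_vector_mult_scaleR linear_scale power2_eq_square algebra_simps)
qed

text \<open>Strict positivity at a point persists nearby with a uniform constant: the points over which the form
has some unit vector with value at most \<open>c\<close> form a relatively closed set that misses \<open>x0\<close>.\<close>
lemma positivity_near_point:
  assumes x0: "x0 \<in> U" and form: "\<And>\<xi>. \<xi> \<noteq> 0 \<Longrightarrow> commutator_form Q X \<rho> x0 \<xi> > 0"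
    and zeroth: "zeroth_order_coefficient X G \<rho> x0 > 0"
  shows "\<exists>c>0. \<exists>r>0. \<forall>x\<in>ball x0 r. x \<in> U \<longrightarrow>
    c \<le> zeroth_order_coefficient X G \<rho> x \<and> (\<forall>\<xi>. c * (norm \<xi>)\<^sup>2 \<le> commutator_form Q X \<rho> x \<xi>)"
proof -
  let ?E = "commutator_form Q X \<rho>" and ?Z = "zeroth_order_coefficient X G \<rho>"
  have cE: "continuous_on (sphere 0 1) (?E x)" if "x \<in> U" for x
  proof -
    have "continuous_on (sphere 0 1) (Pair x)" by (intro continuous_intros)
    moreover have "Pair x ` sphere 0 1 \<subseteq> U \<times> UNIV" using that by auto
    ultimately show ?thesis
      using continuous_on_compose2[OF commutator_form_continuous[of \<rho>], of "sphere 0 1" "Pair x"] by simp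
  qed
  obtain c0 where c0: "c0 > 0" "\<And>\<xi>. c0 * (norm \<xi>)\<^sup>2 \<le> ?E x0 \<xi>"
    using quadratic_form_lower_bound[OF cE[OF x0] commutator_form_scale[OF x0] form] by blast
  define c where "c = min (c0 / 2) (?Z x0 / 2)"
  have c: "c > 0" "c < c0" "c < ?Z x0" using c0 zeroth by (auto simp: c_def)
  obtain s where s: "s > 0" "cball x0 s \<subseteq> U" using open_U x0 open_contains_cball by blast
  let ?K = "cball x0 s \<times> sphere (0::real^'n) 1"
  have "continuous_on ?K (\<lambda>z. ?E (fst z) (snd z))"
    by (rule continuous_on_subset[OF commutator_form_continuous]) (use s in auto)
  then have "closed (?K \<inter> (\<lambda>z. ?E (fst z) (snd z)) -` {..c})"
    by (rule continuous_closed_preimage) (auto intro: closed_Times)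
  then have "compact (?K \<inter> (?K \<inter> (\<lambda>z. ?E (fst z) (snd z)) -` {..c}))"
    by (intro compact_Int_closed compact_Times compact_cball compact_sphere)
  then have cpt: "compact (?K \<inter> (\<lambda>z. ?E (fst z) (snd z)) -` {..c})" by (simp only: Int_left_absorb)
  define Z where "Z = fst ` (?K \<inter> (\<lambda>z. ?E (fst z) (snd z)) -` {..c})"
  have "compact Z" unfolding Z_def using cpt
    by (intro compact_continuous_image continuous_intros)
  then have cl: "closed Z" by (rule compact_imp_closed)
  have x0_Z: "x0 \<notin> Z"
  proof
    assume "x0 \<in> Z"
    then obtain \<xi> where "norm \<xi> = 1" "?E x0 \<xi> \<le> c" unfolding Z_def by auto
    then show False using c0(2)[of \<xi>] c(2) by simp
  qed
  have "open (- Z)" using cl by (rule open_Compl)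
  then obtain r1 where r1: "r1 > 0" "ball x0 r1 \<subseteq> - Z"
    using x0_Z open_contains_ball[of "- Z"] by blast
  have "isCont ?Z x0"
    using zeroth_order_coefficient_continuous x0 open_U by (simp add: continuous_on_eq_continuous_at)
  then have "\<forall>\<^sub>F x in at x0. c < ?Z x" using c(3) by (auto simp: isCont_def dest: order_tendstoD)
  then obtain r2 where r2: "r2 > 0" "\<And>x. x \<noteq> x0 \<Longrightarrow> dist x x0 < r2 \<Longrightarrow> c < ?Z x"
    unfolding eventually_at by auto
  have "c \<le> ?Z x \<and> (\<forall>\<xi>. c * (norm \<xi>)\<^sup>2 \<le> ?E x \<xi>)" if x: "x \<in> ball x0 (min s (min r1 r2))" for x
  proof (intro conjI allI)
    show "c \<le> ?Z x" using r2(2)[of x] c(3) x by (cases "x = x0") (auto simp: dist_commute less_imp_le)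
    fix \<xi>
    have xU: "x \<in> U" "x \<in> cball x0 s" using x s by auto
    have unit: "c < ?E x \<eta>" if "norm \<eta> = 1" for \<eta>
    proof (rule ccontr)
      assume "\<not> c < ?E x \<eta>"
      then have "(x, \<eta>) \<in> ?K \<inter> (\<lambda>z. ?E (fst z) (snd z)) -` {..c}" using that xU by auto
      from imageI[OF this, of fst] have "x \<in> Z" by (simp add: Z_def)
      moreover have "x \<in> ball x0 r1" using x by simp
      ultimately show False using r1(2) by blast
    qed
    show "c * (norm \<xi>)\<^sup>2 \<le> ?E x \<xi>"
    proof (cases "\<xi> = 0")
      case True then show ?thesis using commutator_form_scale[OF xU(1), of \<rho> 0 \<xi>] by simp
    next
      case False
      have "?E x \<xi> = (norm \<xi>)\<^sup>2 * ?E x (\<xi> /\<^sub>R norm \<xi>)"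
        using commutator_form_scale[OF xU(1), of \<rho> "norm \<xi>" "\<xi> /\<^sub>R norm \<xi>"] False by simp
      moreover have "(norm \<xi>)\<^sup>2 * c \<le> (norm \<xi>)\<^sup>2 * ?E x (\<xi> /\<^sub>R norm \<xi>)"
        using unit[of "\<xi> /\<^sub>R norm \<xi>"] False by (intro mult_left_mono) auto
      ultimately show ?thesis by (simp add: mult.commute)
    qed
  qed
  moreover have "min s (min r1 r2) > 0" using s r1 r2 by simp
  ultimately show ?thesis using c(1) by blast
qed

end

text \<open>The weight is \<open>g = a (p + m + |x - x0|\<^sup>2) + p m - (p + m)\<^sup>2\<close>. At \<open>x0\<close> its gradient is
\<open>a (dp + dm)\<close>, so every term of the commutator form that involves a derivative of \<open>Q\<close>, and every
second derivative of \<open>p\<close>, \<open>m\<close>, carries a factor \<open>a\<close>. With \<open>\<rho> = div X - q\<close> at \<open>x0\<close> the commutator form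
is \<open>E0 - a R\<close> with \<open>E0\<close> positive definite by hypothesis, and the zeroth-order coefficient is
\<open>a\<^sup>2 (10 q\<^sup>2 - a S)\<close>; here the concave term \<open>- (p + m)\<^sup>2\<close> provides the positive sign. Both are positive
for small \<open>a\<close>. Finally \<open>(p + m)\<^sup>2 \<le> a (p + m)\<close> near \<open>x0\<close>, which gives the lower bound for \<open>g\<close>.\<close>
lemma convex_weight_at_corner:
  fixes U :: "(real^'n) set" and Q :: "real^'n \<Rightarrow> real^'n^'n" and p m :: "real^'n \<Rightarrow> real"
    and dp dm :: "real^'n \<Rightarrow> real^'n"
  assumes U: "open U" and Q_C1: "C1_on U Q" and Q_sym: "\<And>x a b. x \<in> U \<Longrightarrow> (Q x *v a) \<bullet> b = a \<bullet> (Q x *v b)"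
    and p: "\<And>x. x \<in> U \<Longrightarrow> (p has_derivative (\<lambda>h. dp x \<bullet> h)) (at x)" and dp: "C1_on U dp"
    and m: "\<And>x. x \<in> U \<Longrightarrow> (m has_derivative (\<lambda>h. dm x \<bullet> h)) (at x)" and dm: "C1_on U dm"
    and x0: "x0 \<in> U" "p x0 = 0" "m x0 = 0"
    and char: "(Q x0 *v dp x0) \<bullet> dp x0 = 0" "(Q x0 *v dm x0) \<bullet> dm x0 = 0"
    and pos: "(Q x0 *v dp x0) \<bullet> dm x0 > 0"
    and form: "\<And>\<xi>. \<xi> \<noteq> 0 \<Longrightarrow> 0 < 2 * ((Q x0 *v dp x0) \<bullet> dm x0) * ((Q x0 *v \<xi>) \<bullet> \<xi>)
      - 8 * ((Q x0 *v dp x0) \<bullet> \<xi>) * ((Q x0 *v dm x0) \<bullet> \<xi>) + 8 * ((Q x0 *v dp x0) \<bullet> \<xi> + (Q x0 *v dm x0) \<bullet> \<xi>)\<^sup>2"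
  obtains g \<Gamma> \<rho> c r a where "weighted_operator U Q g \<Gamma>" "c > 0" "r > 0" "a > 0" "cball x0 r \<subseteq> U" "g x0 = 0"
    "\<forall>x\<in>cball x0 r. \<forall>\<xi>. c * (norm \<xi>)\<^sup>2 \<le> commutator_form Q (weighted_operator.X Q \<Gamma>) \<rho> x \<xi>"
    "\<forall>x\<in>cball x0 r. c \<le> zeroth_order_coefficient (weighted_operator.X Q \<Gamma>) (weighted_operator.G Q \<Gamma>) \<rho> x"
    "\<forall>x\<in>cball x0 r. p x > 0 \<longrightarrow> m x > 0 \<longrightarrow> a * (norm (x - x0))\<^sup>2 \<le> g x"
proof -
  define P' where "P' = frechet_derivative dp (at x0)"
  define M' where "M' = frechet_derivative dm (at x0)"
  define Q' where "Q' = frechet_derivative Q (at x0)"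
  define d where "d = dp x0" define e where "e = dm x0" define A where "A = Q x0"
  define q where "q = (A *v d) \<bullet> e"
  define H where "H h = P' h + M' h + 2 *\<^sub>R h" for h
  have lin: "linear P'" "linear M'" "linear Q'"
    unfolding P'_def M'_def Q'_def
    using C1_on_has_derivative[OF _ x0(1)] has_derivative_linear dp dm Q_C1 by blast+
  have H_lin: "linear H" unfolding H_def using lin(1,2)
    by (intro linear_compose_add linear_compose_scale_right linear_ident)
  have A_sym: "(A *v a) \<bullet> b = a \<bullet> (A *v b)" for a b unfolding A_def by (rule Q_sym[OF x0(1)])
  have qpos: "q > 0" using pos by (simp add: q_def A_def d_def e_def)
  have ch: "(A *v d) \<bullet> d = 0" "(A *v e) \<bullet> e = 0" "(A *v d) \<bullet> e = q" "(A *v e) \<bullet> d = q"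
    using char A_sym[of e d] by (simp_all add: q_def A_def d_def e_def inner_commute)
  define E0 where "E0 \<xi> = 2 * q * ((A *v \<xi>) \<bullet> \<xi>) - 8 * ((A *v d) \<bullet> \<xi>) * ((A *v e) \<bullet> \<xi>)
      + 8 * ((A *v d) \<bullet> \<xi> + (A *v e) \<bullet> \<xi>)\<^sup>2" for \<xi>
  define R where "R \<xi> = 4 * (H (A *v \<xi>) \<bullet> (A *v \<xi>) + (Q' (A *v \<xi>) *v (d + e)) \<bullet> \<xi>)
      - 2 * ((Q' (A *v (d + e)) *v \<xi>) \<bullet> \<xi>)" for \<xi>
  define S where "S = 2 * (H (A *v (d + e)) \<bullet> (A *v (d + e))) + (Q' (A *v (d + e)) *v (d + e)) \<bullet> (d + e)"
  have blH: "bounded_linear H" "bounded_linear Q'" using H_lin lin linear_conv_bounded_linear by auto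
  have cA: "continuous_on T (\<lambda>\<xi>. A *v \<xi>)" for T
    by (intro bounded_bilinear.continuous_on[OF bounded_bilinear_matrix_vector] continuous_intros)
  have E0_bound: "\<exists>c>0. \<forall>\<xi>. c * (norm \<xi>)\<^sup>2 \<le> E0 \<xi>"
  proof (rule quadratic_form_lower_bound)
    show "continuous_on (sphere 0 1) E0" unfolding E0_def[abs_def] by (intro continuous_intros cA)
    show "E0 (t *\<^sub>R \<xi>) = t\<^sup>2 * E0 \<xi>" for t \<xi>
      by (simp add: E0_def matrix_vector_mult_scaleR power2_eq_square algebra_simps)
    show "E0 \<xi> > 0" if "\<xi> \<noteq> 0" for \<xi> using form[OF that] by (simp add: E0_def q_def A_def d_def e_def)
  qed
  have R_bound: "\<exists>C>0. \<forall>\<xi>. R \<xi> \<le> C * (norm \<xi>)\<^sup>2"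
  proof (rule quadratic_form_upper_bound)
    show "continuous_on (sphere 0 1) R" unfolding R_def[abs_def]
      by (intro continuous_intros cA bounded_linear.continuous_on[OF blH(1)] bounded_linear.continuous_on[OF blH(2)]
          bounded_bilinear.continuous_on[OF bounded_bilinear_matrix_vector])
    have s: "c *\<^sub>R M *v y = c *\<^sub>R (M *v y)" for c and M :: "real^'n^'n" and y
      by (simp add: scaleR_matrix_vector_assoc)
    show "R (t *\<^sub>R \<xi>) = t\<^sup>2 * R \<xi>" for t \<xi>
      unfolding R_def matrix_vector_mult_scaleR linear_scale[OF H_lin] linear_scale[OF lin(3)] s
      by (simp add: matrix_vector_mult_scaleR power2_eq_square algebra_simps)
  qed
  obtain c0 where c0: "c0 > 0" "\<And>\<xi>. c0 * (norm \<xi>)\<^sup>2 \<le> E0 \<xi>" using E0_bound by blast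
  obtain C where C: "C > 0" "\<And>\<xi>. R \<xi> \<le> C * (norm \<xi>)\<^sup>2" using R_bound by blast
  \<comment> \<open>The two bounds make \<open>E0 - a R\<close> positive definite and \<open>10 q\<^sup>2 - a S\<close> positive.\<close>
  define a where "a = min (c0 / (2 * C)) (q\<^sup>2 / (\<bar>S\<bar> + 1))"
  have a: "a > 0" using c0 C qpos by (auto simp: a_def)
  have "a \<le> c0 / (2 * C)" by (simp add: a_def)
  then have aC: "a * C \<le> c0 / 2" using C by (simp add: field_simps)
  have "a \<le> q\<^sup>2 / (\<bar>S\<bar> + 1)" by (simp add: a_def)
  then have "a * (\<bar>S\<bar> + 1) \<le> q\<^sup>2" by (simp add: pos_le_divide_eq add_nonneg_pos)
  moreover have "a * S \<le> a * (\<bar>S\<bar> + 1)" using a by (intro mult_left_mono) auto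
  ultimately have aS: "a * S \<le> q\<^sup>2" by linarith
  define g where "g x = a * (p x + m x + (x - x0) \<bullet> (x - x0)) + p x * m x - (p x + m x)\<^sup>2" for x
  define \<Gamma> where "\<Gamma> x = a *\<^sub>R (dp x + dm x + 2 *\<^sub>R (x - x0)) + (m x *\<^sub>R dp x + p x *\<^sub>R dm x)
    - (2 * (p x + m x)) *\<^sub>R (dp x + dm x)" for x
  have g_deriv: "(g has_derivative (\<lambda>h. \<Gamma> x \<bullet> h)) (at x)" if x: "x \<in> U" for x
    unfolding g_def[abs_def]
    by (rule derivative_eq_intros p[OF x] m[OF x] refl)+
      (simp add: \<Gamma>_def fun_eq_iff inner_add_left inner_diff_left inner_commute power2_eq_square algebra_simps)
  have pC1: "C1_on U p" "C1_on U m"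
    by (rule C1_on_if_C1_gradient[OF p dp] C1_on_if_C1_gradient[OF m dm], assumption)+
  have \<Gamma>_C1: "C1_on U \<Gamma>"
    unfolding \<Gamma>_def[abs_def]
    by (intro C1_on_diff C1_on_add C1_on_scaleR C1_on_mult C1_on_const C1_on_ident dp dm pC1)
  interpret W: weighted_operator U Q g \<Gamma>
    by unfold_locales (use U Q_C1 Q_sym g_deriv \<Gamma>_C1 in auto)
  \<comment> \<open>\<open>B\<close> is the Hessian of \<open>g\<close> at \<open>x0\<close>, where \<open>p = m = 0\<close>.\<close>
  define B where "B h = a *\<^sub>R H h + ((e \<bullet> h) *\<^sub>R d + (d \<bullet> h) *\<^sub>R e) - (2 * ((d + e) \<bullet> h)) *\<^sub>R (d + e)" for h
  have \<Gamma>0: "\<Gamma> x0 = a *\<^sub>R (d + e)" by (simp add: \<Gamma>_def x0 d_def e_def)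
  have \<Gamma>': "(\<Gamma> has_derivative B) (at x0)"
  proof -
    note D = C1_on_has_derivative[OF dp x0(1), folded P'_def] C1_on_has_derivative[OF dm x0(1), folded M'_def]
    show ?thesis
      unfolding \<Gamma>_def[abs_def]
      by (rule derivative_eq_intros p[OF x0(1)] m[OF x0(1)] D refl)+
         (simp add: B_def H_def x0 d_def e_def fun_eq_iff inner_add_left algebra_simps scaleR_2)
  qed
  have X': "(W.X has_derivative (\<lambda>h. A *v B h + Q' h *v \<Gamma> x0)) (at x0)"
    unfolding W.X_def[abs_def] A_def Q'_def
    by (rule bounded_bilinear.FDERIV[OF bounded_bilinear_matrix_vector C1_on_has_derivative[OF Q_C1 x0(1)] \<Gamma>'])
  have G': "(W.G has_derivative (\<lambda>h. W.X x0 \<bullet> B h + (A *v B h + Q' h *v \<Gamma> x0) \<bullet> \<Gamma> x0)) (at x0)"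
    unfolding W.G_def[abs_def] by (rule has_derivative_inner[OF X' \<Gamma>'])
  have X0: "W.X x0 = a *\<^sub>R (A *v (d + e))" by (simp add: W.X_def \<Gamma>0 matrix_vector_mult_scaleR A_def)
  have nn: "(A *v (d + e)) \<bullet> (d + e) = 2 * q"
    using ch by (simp add: matrix_vector_right_distrib inner_add_left inner_add_right)
  have G0: "W.G x0 = a\<^sup>2 * (2 * q)" by (simp add: W.G_def X0 \<Gamma>0 nn power2_eq_square)
  \<comment> \<open>This choice puts exactly \<open>2 q \<langle>Q \<xi>, \<xi>\<rangle>\<close> into the commutator form at \<open>x0\<close>.\<close>
  define \<rho> where "\<rho> = divergence W.X x0 - q"
  have BA: "B h \<bullet> h = a * (H h \<bullet> h) + 2 * (d \<bullet> h) * (e \<bullet> h) - 2 * (d \<bullet> h + e \<bullet> h)\<^sup>2" for h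
    by (simp add: B_def inner_add_left inner_diff_left power2_eq_square algebra_simps)
  have "commutator_form Q W.X \<rho> x0 \<xi> = E0 \<xi> - a * R \<xi>" for \<xi>
  proof -
    have 1: "(A *v B (A *v \<xi>)) \<bullet> \<xi> = B (A *v \<xi>) \<bullet> (A *v \<xi>)" by (rule A_sym)
    have 2: "d \<bullet> (A *v \<xi>) = (A *v d) \<bullet> \<xi>" "e \<bullet> (A *v \<xi>) = (A *v e) \<bullet> \<xi>" by (simp_all add: A_sym)
    have 3: "Q' (a *\<^sub>R y) = a *\<^sub>R Q' y" for y by (rule linear_scale[OF lin(3)])
    have "commutator_form Q W.X \<rho> x0 \<xi> = - 4 * ((A *v B (A *v \<xi>)) \<bullet> \<xi> + a * ((Q' (A *v \<xi>) *v (d + e)) \<bullet> \<xi>))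
       + 2 * (a * ((Q' (A *v (d + e)) *v \<xi>) \<bullet> \<xi>)) + 2 * q * ((A *v \<xi>) \<bullet> \<xi>)"
      unfolding commutator_form_def frechet_derivative_at[OF X', symmetric] X0 Q'_def[symmetric] A_def[symmetric] \<Gamma>0 3 \<rho>_def
      by (simp add: inner_add_left matrix_vector_mult_scaleR scaleR_matrix_vector_assoc[symmetric])
    also have "\<dots> = E0 \<xi> - a * R \<xi>"
      unfolding 1 BA 2 E0_def R_def by (simp add: algebra_simps)
    finally show ?thesis .
  qed
  moreover have "E0 \<xi> - a * R \<xi> > 0" if "\<xi> \<noteq> 0" for \<xi>
  proof -
    have "a * R \<xi> \<le> a * (C * (norm \<xi>)\<^sup>2)" using C(2)[of \<xi>] a by (intro mult_left_mono) auto
    also have "\<dots> = (a * C) * (norm \<xi>)\<^sup>2" by simp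
    also have "\<dots> \<le> c0 / 2 * (norm \<xi>)\<^sup>2" using aC by (intro mult_right_mono) auto
    also have "\<dots> < c0 * (norm \<xi>)\<^sup>2" using c0 that by simp
    also have "\<dots> \<le> E0 \<xi>" by (rule c0)
    finally show ?thesis by simp
  qed
  ultimately have formpos: "commutator_form Q W.X \<rho> x0 \<xi> > 0" if "\<xi> \<noteq> 0" for \<xi> using that by simp
  have zpos: "zeroth_order_coefficient W.X W.G \<rho> x0 > 0"
  proof -
    define w where "w = A *v (d + e)"
    have lB: "B (a *\<^sub>R y) = a *\<^sub>R B y" for y
      using has_derivative_linear[OF \<Gamma>'] by (rule linear_scale)
    have lQ: "Q' (a *\<^sub>R y) = a *\<^sub>R Q' y" for y by (rule linear_scale[OF lin(3)])
    have 1: "(A *v B w) \<bullet> (d + e) = B w \<bullet> w" unfolding w_def by (rule A_sym)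
    have 2: "d \<bullet> w = q" "e \<bullet> w = q"
      unfolding w_def matrix_vector_right_distrib inner_add_right using ch by (simp_all add: inner_commute)
    have "frechet_derivative W.G (at x0) (W.X x0) = a\<^sup>2 * (2 * (B w \<bullet> w)) + a ^ 3 * ((Q' w *v (d + e)) \<bullet> (d + e))"
      unfolding frechet_derivative_at[OF G', symmetric] X0 w_def[symmetric] \<Gamma>0 lB lQ
      using arg_cong[OF 1, of "\<lambda>z. a * (a * z)"] by (simp add: inner_add_left inner_add_right matrix_vector_mult_scaleR scaleR_matrix_vector_assoc[symmetric]
          inner_commute[of w "B w"] power2_eq_square power3_eq_cube algebra_simps)
    also have "B w \<bullet> w = a * (H w \<bullet> w) - 6 * q\<^sup>2" unfolding BA 2 by (simp add: power2_eq_square)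
    finally have "zeroth_order_coefficient W.X W.G \<rho> x0 = a\<^sup>2 * (10 * q\<^sup>2 - a * S)"
      unfolding zeroth_order_coefficient_def G0 \<rho>_def S_def w_def[symmetric]
      by (simp add: power2_eq_square power3_eq_cube algebra_simps)
    moreover have "10 * q\<^sup>2 - a * S > 0" using aS zero_less_power[OF qpos, of 2] by linarith
    ultimately show ?thesis using a by simp
  qed
  obtain c r1 where c: "c > 0" "r1 > 0" "\<And>x. x \<in> ball x0 r1 \<Longrightarrow> x \<in> U \<Longrightarrow>
    c \<le> zeroth_order_coefficient W.X W.G \<rho> x \<and> (\<forall>\<xi>. c * (norm \<xi>)\<^sup>2 \<le> commutator_form Q W.X \<rho> x \<xi>)"
    using W.positivity_near_point[OF x0(1) formpos zpos] by blast
  obtain r2 where r2: "r2 > 0" "cball x0 r2 \<subseteq> U" using U x0(1) open_contains_cball by blast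
  have "isCont (\<lambda>x. p x + m x) x0"
    using has_derivative_continuous[OF p[OF x0(1)]] has_derivative_continuous[OF m[OF x0(1)]]
    by (intro continuous_intros) auto
  then have "\<forall>\<^sub>F x in at x0. p x + m x < a"
    using a x0 by (auto simp: isCont_def dest: order_tendstoD)
  then obtain r3 where r3: "r3 > 0" "\<And>x. x \<noteq> x0 \<Longrightarrow> dist x x0 < r3 \<Longrightarrow> p x + m x < a"
    unfolding eventually_at by auto
  define r where "r = min (r1 / 2) (min r2 (r3 / 2))"
  have r: "r > 0" "r < r1" "r \<le> r2" "r < r3" using c r2 r3 by (auto simp: r_def)
  have rU: "x \<in> U" "x \<in> ball x0 r1" if "x \<in> cball x0 r" for x
    using that r r2 by (auto simp: subset_eq)
  show ?thesis
  proof (rule that[of g \<Gamma> c r a \<rho>])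
    show "weighted_operator U Q g \<Gamma>" by (rule W.weighted_operator_axioms)
    show "cball x0 r \<subseteq> U" using r2 r by auto
    show "g x0 = 0" by (simp add: g_def x0)
    show "\<forall>x\<in>cball x0 r. \<forall>\<xi>. c * (norm \<xi>)\<^sup>2 \<le> commutator_form Q W.X \<rho> x \<xi>"
      using c(3) rU by blast
    show "\<forall>x\<in>cball x0 r. c \<le> zeroth_order_coefficient W.X W.G \<rho> x"
      using c(3) rU by blast
    show "\<forall>x\<in>cball x0 r. p x > 0 \<longrightarrow> m x > 0 \<longrightarrow> a * (norm (x - x0))\<^sup>2 \<le> g x"
    proof (intro ballI impI)
      fix x assume x: "x \<in> cball x0 r" "p x > 0" "m x > 0"
      have "x \<noteq> x0" using x x0 by auto
      then have "p x + m x < a" using r3(2)[of x] x r by (auto simp: dist_commute)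
      then have "0 \<le> (p x + m x) * (a - (p x + m x))" using x by simp
      moreover have "0 \<le> p x * m x" using x by simp
      ultimately show "a * (norm (x - x0))\<^sup>2 \<le> g x"
        unfolding g_def power2_norm_eq_inner by (simp add: power2_eq_square algebra_simps)
    qed
  qed (use c r a in auto)
qed

section \<open>Functions and gradients on the faces\<close>

lemma difference_quotient_along_ray:
  fixes p :: "'a::euclidean_space \<Rightarrow> real"
  assumes p: "(p has_derivative (\<lambda>h. d \<bullet> h)) (at y)" and "p y = 0"
  shows "((\<lambda>t. p (y + t *\<^sub>R \<xi>) / t) \<longlongrightarrow> d \<bullet> \<xi>) (at_right 0)"
proof -
  have "((\<lambda>t. p (y + t *\<^sub>R \<xi>)) has_real_derivative (d \<bullet> \<xi>)) (at 0)"
    using has_derivative_along_line[of p "\<lambda>h. d \<bullet> h" y 0 \<xi>] p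
    by (simp add: has_field_derivative_def mult.commute[of _ "d \<bullet> \<xi>"])
  then have "((\<lambda>t. p (y + t *\<^sub>R \<xi>) / t) \<longlongrightarrow> d \<bullet> \<xi>) (at 0)"
    using assms(2) by (simp add: DERIV_def)
  then show ?thesis by (rule filterlim_mono) (auto simp: at_within_le_at)
qed

lemma positive_along_ray:
  fixes p :: "'a::euclidean_space \<Rightarrow> real"
  assumes "(p has_derivative (\<lambda>h. d \<bullet> h)) (at y)" and "p y = 0" "d \<bullet> \<xi> > 0"
  shows "\<forall>\<^sub>F t in at_right 0. p (y + t *\<^sub>R \<xi>) > 0"
  using order_tendstoD(1)[OF difference_quotient_along_ray[OF assms(1,2)] assms(3)]
    eventually_at_right_less[of 0]
  by eventually_elim (simp add: zero_less_divide_iff)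

text \<open>Moving from \<open>x\<close> against \<open>e\<close> decreases \<open>p\<close> at a definite rate and increases \<open>m\<close>. So \<open>p\<close> reaches 0 after a
time comparable to \<open>p x\<close>, at a point that still has \<open>m > 0\<close>.\<close>
lemma projection_to_face:
  fixes p m :: "'a::euclidean_space \<Rightarrow> real"
  assumes p: "\<And>x. x \<in> ball x0 R \<Longrightarrow> (p has_derivative (\<lambda>h. dp x \<bullet> h)) (at x)" and dp: "isCont dp x0"
    and m: "\<And>x. x \<in> ball x0 R \<Longrightarrow> (m has_derivative (\<lambda>h. dm x \<bullet> h)) (at x)" and dm: "isCont dm x0"
    and R: "R > 0" and x0: "p x0 = 0" and e: "dp x0 \<bullet> e > 0" "dm x0 \<bullet> e < 0"
  obtains r C where "r > 0" "r \<le> R" "C \<ge> 0"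
    "\<And>x. x \<in> ball x0 r \<Longrightarrow> p x > 0 \<Longrightarrow> m x > 0 \<Longrightarrow> \<exists>y\<in>ball x0 R. p y = 0 \<and> m y > 0 \<and> norm (x - y) \<le> C * p x"
proof -
  define k where "k = (dp x0 \<bullet> e) / 2"
  have k: "k > 0" "dp x0 \<bullet> e > k" using e by (auto simp: k_def)
  have "isCont (\<lambda>x. dp x \<bullet> e) x0" "isCont (\<lambda>x. dm x \<bullet> e) x0" by (intro continuous_intros dp dm)+
  then have "\<forall>\<^sub>F x in at x0. dp x \<bullet> e > k" "\<forall>\<^sub>F x in at x0. dm x \<bullet> e < 0"
    using k e unfolding isCont_def by (auto dest: order_tendstoD)
  then have "\<forall>\<^sub>F x in at x0. dp x \<bullet> e > k \<and> dm x \<bullet> e < 0" by (rule eventually_conj)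
  then obtain s0 where s0: "s0 > 0" "\<And>x. x \<noteq> x0 \<Longrightarrow> dist x x0 < s0 \<Longrightarrow> dp x \<bullet> e > k \<and> dm x \<bullet> e < 0"
    unfolding eventually_at by auto
  define s where "s = min s0 R"
  have s: "s > 0" "s \<le> R" "\<And>x. x \<in> ball x0 s \<Longrightarrow> dp x \<bullet> e > k \<and> dm x \<bullet> e < 0"
    using s0 R k e by (auto simp: s_def dist_commute) (metis dist_commute s0(2))+
  define N where "N = norm e + 1"
  \<comment> \<open>If \<open>p x < \<eta>\<close>, then moving from \<open>x\<close> along \<open>- e\<close> for a time \<open>p x / k\<close> stays within \<open>s / 2\<close> of \<open>x\<close>.\<close>
  define \<eta> where "\<eta> = s * k / (2 * N)"
  have pos1: "N > 0" by (simp add: N_def add_nonneg_pos)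
  have \<eta>: "\<eta> > 0" using s k pos1 by (simp add: \<eta>_def)
  have "isCont p x0" using p[of x0] R has_derivative_continuous by force
  then have "\<forall>\<^sub>F x in at x0. p x < \<eta>" using \<eta> x0 unfolding isCont_def by (auto dest: order_tendstoD)
  then obtain r0 where r0: "r0 > 0" "\<And>x. x \<noteq> x0 \<Longrightarrow> dist x x0 < r0 \<Longrightarrow> p x < \<eta>"
    unfolding eventually_at by auto
  define r where "r = min r0 (s / 2)"
  show ?thesis
  proof (rule that[of r "norm e / k"])
    show "r > 0" "r \<le> R" using r0 s by (auto simp: r_def)
    show "norm e / k \<ge> 0" using k by simp
  next
    fix x assume x: "x \<in> ball x0 r" "p x > 0" "m x > 0"
    have "x \<noteq> x0" using x x0 by auto
    then have px: "p x < \<eta>" using r0(2)[of x] x by (auto simp: r_def dist_commute)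
    define T where "T = p x / k"
    have T: "T > 0" using x k by (simp add: T_def)
    have in_s: "x - t *\<^sub>R e \<in> ball x0 s" if "0 \<le> t" "t \<le> T" for t
    proof -
      have "dist x0 (x - t *\<^sub>R e) \<le> dist x0 x + norm (t *\<^sub>R e)"
        using dist_triangle[of x0 "x - t *\<^sub>R e" x] by (simp add: dist_norm)
      also have "norm (t *\<^sub>R e) \<le> T * N" using that by (simp add: N_def mult_mono)
      also have "T * N < \<eta> / k * N"
        unfolding T_def using px k pos1 by (intro mult_strict_right_mono divide_strict_right_mono)
      also have "\<eta> / k * N = s / 2" using k pos1 by (simp add: \<eta>_def field_simps)
      finally show ?thesis using x by (simp add: r_def)
    qed
    have D: "((\<lambda>t. f (x - t *\<^sub>R e)) has_real_derivative - (df (x - t *\<^sub>R e) \<bullet> e)) (at t)"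
      if "0 \<le> t" "t \<le> T" "\<And>x. x \<in> ball x0 R \<Longrightarrow> (f has_derivative (\<lambda>h. df x \<bullet> h)) (at x)" for f df t
    proof -
      have "x - t *\<^sub>R e \<in> ball x0 R" using in_s[OF that(1,2)] s(2) by auto
      then have "((\<lambda>t. f (x + t *\<^sub>R - e)) has_derivative (\<lambda>h. df (x - t *\<^sub>R e) \<bullet> (h *\<^sub>R - e))) (at t)"
        using that(3) by (intro has_derivative_along_line) simp
      then show ?thesis
        unfolding has_field_derivative_def by (auto elim!: has_derivative_eq_rhs simp: fun_eq_iff)
    qed
    have mono: "p x - p (x - T *\<^sub>R e) \<ge> k * T"
    proof -
      have "\<exists>z>0. z < T \<and> p (x - T *\<^sub>R e) - p (x - 0 *\<^sub>R e) = (T - 0) * - (dp (x - z *\<^sub>R e) \<bullet> e)"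
        by (rule MVT2[OF T]) (rule D[OF _ _ p])
      then obtain z where z: "0 < z" "z < T" "p (x - T *\<^sub>R e) - p x = - (T * (dp (x - z *\<^sub>R e) \<bullet> e))" by auto
      have "dp (x - z *\<^sub>R e) \<bullet> e > k" using s(3)[OF in_s[of z]] z by simp
      then have "T * (dp (x - z *\<^sub>R e) \<bullet> e) \<ge> T * k" using T by (intro mult_left_mono) auto
      then show ?thesis using z(3) by (simp add: mult.commute)
    qed
    have "k * T = p x" using k by (simp add: T_def)
    then have neg: "p (x - T *\<^sub>R e) \<le> 0" using mono by simp
    have cont: "\<forall>t. 0 \<le> t \<and> t \<le> T \<longrightarrow> isCont (\<lambda>t. p (x - t *\<^sub>R e)) t"
      using DERIV_isCont[OF D[OF _ _ p]] by blast
    have "\<exists>t\<ge>0. t \<le> T \<and> p (x - t *\<^sub>R e) = 0"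
      using IVT2[of "\<lambda>t. p (x - t *\<^sub>R e)" T 0 0] neg x(2) T cont by auto
    then obtain t where t: "0 \<le> t" "t \<le> T" "p (x - t *\<^sub>R e) = 0" by blast
    have "m (x - 0 *\<^sub>R e) \<le> m (x - t *\<^sub>R e)"
    proof (rule DERIV_nonneg_imp_nondecreasing[OF t(1)])
      fix z assume z: "0 \<le> z" "z \<le> t"
      have "- (dm (x - z *\<^sub>R e) \<bullet> e) \<ge> 0" using s(3)[OF in_s[of z]] z t(2) by simp
      moreover have "((\<lambda>t. m (x - t *\<^sub>R e)) has_real_derivative - (dm (x - z *\<^sub>R e) \<bullet> e)) (at z)"
        by (rule D[OF _ _ m]) (use z t in auto)
      ultimately show "\<exists>y. ((\<lambda>t. m (x - t *\<^sub>R e)) has_real_derivative y) (at z) \<and> 0 \<le> y" by blast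
    qed
    then have "m (x - t *\<^sub>R e) > 0" using x(3) by simp
    moreover have "norm (x - (x - t *\<^sub>R e)) \<le> norm e / k * p x"
      using t mult_right_mono[OF t(2) norm_ge_zero[of e]] by (simp add: T_def field_simps)
    moreover have "x - t *\<^sub>R e \<in> ball x0 R" using in_s[OF t(1,2)] s(2) by auto
    ultimately show "\<exists>y\<in>ball x0 R. p y = 0 \<and> m y > 0 \<and> norm (x - y) \<le> norm e / k * p x"
      using t(3) by blast
  qed
qed

text \<open>A Lipschitz function that vanishes on the face is controlled by the distance to the projection
onto it. The radius \<open>r\<close> comes before \<open>f\<close>, as the functions \<open>f\<close> to which this is applied depend on the
large parameter of the Carleman estimate.\<close>
lemma vanishing_on_face_bound:
  fixes p m :: "'a::euclidean_space \<Rightarrow> real"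
  assumes U: "cball x0 R \<subseteq> U"
    and p: "\<And>x. x \<in> U \<Longrightarrow> (p has_derivative (\<lambda>h. dp x \<bullet> h)) (at x)" and dp: "isCont dp x0"
    and m: "\<And>x. x \<in> U \<Longrightarrow> (m has_derivative (\<lambda>h. dm x \<bullet> h)) (at x)" and dm: "isCont dm x0"
    and R: "R > 0" and x0: "p x0 = 0" and e: "dp x0 \<bullet> e > 0" "dm x0 \<bullet> e < 0"
  obtains r where "r > 0" "r \<le> R"
    "\<And>f :: 'a \<Rightarrow> real. C1_on U f \<Longrightarrow> (\<And>y. y \<in> ball x0 R \<Longrightarrow> p y = 0 \<Longrightarrow> m y > 0 \<Longrightarrow> f y = 0) \<Longrightarrow>
      \<exists>C\<ge>0. \<forall>x\<in>ball x0 r. p x > 0 \<longrightarrow> m x > 0 \<longrightarrow> \<bar>f x\<bar> \<le> C * p x"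
proof -
  have sub: "ball x0 R \<subseteq> U" using U ball_subset_cball by blast
  obtain r C where r: "r > 0" "r \<le> R" "C \<ge> 0"
    "\<And>x. x \<in> ball x0 r \<Longrightarrow> p x > 0 \<Longrightarrow> m x > 0 \<Longrightarrow> \<exists>y\<in>ball x0 R. p y = 0 \<and> m y > 0 \<and> norm (x - y) \<le> C * p x"
    using projection_to_face[of x0 R p dp m dm e, OF _ dp _ dm R x0 e] p m sub by blast
  show ?thesis
  proof (rule that[OF r(1,2)])
    fix f :: "'a \<Rightarrow> real"
    assume f: "C1_on U f" and f0: "\<And>y. y \<in> ball x0 R \<Longrightarrow> p y = 0 \<Longrightarrow> m y > 0 \<Longrightarrow> f y = 0"
    obtain B where B: "B \<ge> 0" "\<And>x y. x \<in> cball x0 R \<Longrightarrow> y \<in> cball x0 R \<Longrightarrow> norm (f x - f y) \<le> B * norm (x - y)"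
      using C1_on_Lipschitz[OF f compact_cball convex_cball U] by blast
    have "\<bar>f x\<bar> \<le> (B * C) * p x" if x: "x \<in> ball x0 r" "p x > 0" "m x > 0" for x
    proof -
      obtain y where y: "y \<in> ball x0 R" "p y = 0" "m y > 0" "norm (x - y) \<le> C * p x" using r(4)[OF x] by blast
      have "x \<in> cball x0 R" "y \<in> cball x0 R" using x(1) r(2) y(1) by auto
      from B(2)[OF this] have "\<bar>f x\<bar> \<le> B * norm (x - y)" using f0[OF y(1,2,3)] by simp
      also have "\<dots> \<le> B * (C * p x)" by (rule mult_left_mono[OF y(4) B(1)])
      finally show ?thesis by simp
    qed
    then show "\<exists>C\<ge>0. \<forall>x\<in>ball x0 r. p x > 0 \<longrightarrow> m x > 0 \<longrightarrow> \<bar>f x\<bar> \<le> C * p x"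
      using B(1) r(3) by (intro exI[of _ "B * C"]) simp
  qed
qed

text \<open>Differentiating \<open>|u| \<le> C p\<close> at \<open>y\<close> along rays that enter the region gives
\<open>|\<langle>w, \<xi>\<rangle>| \<le> C \<langle>d, \<xi>\<rangle>\<close> whenever \<open>\<langle>d, \<xi>\<rangle> > 0\<close>. Tilting a tangential \<open>\<xi>\<close> slightly towards \<open>d\<close> shows that
\<open>w\<close> annihilates all tangential directions.\<close>
lemma gradient_parallel_on_face:
  fixes p m u :: "'a::euclidean_space \<Rightarrow> real"
  assumes V: "open V" "y \<in> V" and p: "(p has_derivative (\<lambda>h. d \<bullet> h)) (at y)" and m: "isCont m y"
    and u: "(u has_derivative (\<lambda>h. w \<bullet> h)) (at y)" and y: "u y = 0" "p y = 0" "m y > 0" and d: "d \<noteq> 0"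
    and bound: "\<And>x. x \<in> V \<Longrightarrow> p x > 0 \<Longrightarrow> m x > 0 \<Longrightarrow> \<bar>u x\<bar> \<le> C * p x"
  shows "\<exists>t. w = t *\<^sub>R d"
proof -
  have one: "\<bar>w \<bullet> \<xi>\<bar> \<le> C * (d \<bullet> \<xi>)" if \<xi>: "d \<bullet> \<xi> > 0" for \<xi>
  proof (rule tendsto_le)
    show "((\<lambda>t. \<bar>u (y + t *\<^sub>R \<xi>) / t\<bar>) \<longlongrightarrow> \<bar>w \<bullet> \<xi>\<bar>) (at_right 0)"
      by (intro tendsto_rabs difference_quotient_along_ray[OF u y(1)])
    show "((\<lambda>t. C * (p (y + t *\<^sub>R \<xi>) / t)) \<longlongrightarrow> C * (d \<bullet> \<xi>)) (at_right 0)"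
      by (intro tendsto_mult tendsto_const difference_quotient_along_ray[OF p y(2)])
    have lim: "((\<lambda>t. y + t *\<^sub>R \<xi>) \<longlongrightarrow> y + 0 *\<^sub>R \<xi>) (at_right 0)" by (intro tendsto_intros)
    then have lim: "((\<lambda>t. y + t *\<^sub>R \<xi>) \<longlongrightarrow> y) (at_right 0)" by simp
    have 1: "\<forall>\<^sub>F t in at_right 0. y + t *\<^sub>R \<xi> \<in> V" using topological_tendstoD[OF lim V] .
    have "((\<lambda>t. m (y + t *\<^sub>R \<xi>)) \<longlongrightarrow> m y) (at_right 0)" by (rule isCont_tendsto_compose[OF m lim])
    then have 2: "\<forall>\<^sub>F t in at_right 0. m (y + t *\<^sub>R \<xi>) > 0" using y(3) by (rule order_tendstoD)
    show "\<forall>\<^sub>F t in at_right 0. \<bar>u (y + t *\<^sub>R \<xi>) / t\<bar> \<le> C * (p (y + t *\<^sub>R \<xi>) / t)"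
      using 1 2 positive_along_ray[OF p y(2) \<xi>] eventually_at_right_less[of 0]
      by eventually_elim (use bound in \<open>auto simp: divide_simps mult.commute\<close>)
  qed (rule trivial_limit_at_right_real)
  have perp: "w \<bullet> \<xi> = 0" if \<xi>: "d \<bullet> \<xi> = 0" for \<xi>
  proof -
    \<comment> \<open>The tilt \<open>\<xi> + s d\<close> changes both sides of the bound by at most a multiple of \<open>s\<close>.\<close>
    define K where "K = \<bar>w \<bullet> d\<bar> + C * (d \<bullet> d)"
    have le: "\<bar>w \<bullet> \<xi>\<bar> \<le> s * K" if "s > 0" for s
    proof -
      have "d \<bullet> (\<xi> + s *\<^sub>R d) > 0" using \<xi> that d by (simp add: inner_add_right)
      from one[OF this] have "\<bar>w \<bullet> \<xi> + s * (w \<bullet> d)\<bar> \<le> C * (s * (d \<bullet> d))" using \<xi> by (simp add: inner_add_right)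
      moreover have "\<bar>w \<bullet> \<xi>\<bar> \<le> \<bar>w \<bullet> \<xi> + s * (w \<bullet> d)\<bar> + s * \<bar>w \<bullet> d\<bar>"
        using abs_triangle_ineq4[of "w \<bullet> \<xi> + s * (w \<bullet> d)" "s * (w \<bullet> d)"] that by (simp add: abs_mult)
      ultimately show ?thesis by (simp add: K_def algebra_simps)
    qed
    have "((\<lambda>s. s * K) \<longlongrightarrow> 0 * K) (at_right 0)" by (intro tendsto_intros)
    then have "\<bar>w \<bullet> \<xi>\<bar> \<le> 0 * K"
      by (rule tendsto_lowerbound) (use le eventually_at_right_less[of 0] in \<open>auto elim: eventually_mono\<close>)
    then show ?thesis by simp
  qed
  define t where "t = (w \<bullet> d) / (d \<bullet> d)"
  have "d \<bullet> (w - t *\<^sub>R d) = 0" using d by (simp add: t_def inner_diff_right inner_commute)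
  then have "w \<bullet> (w - t *\<^sub>R d) = 0" "d \<bullet> (w - t *\<^sub>R d) = 0" using perp by blast+
  then have "(w - t *\<^sub>R d) \<bullet> (w - t *\<^sub>R d) = 0" by (simp add: inner_diff_left)
  then show ?thesis by auto
qed

section \<open>The Carleman inequality\<close>

lemma smooth_cutoff:
  fixes x0 :: "'a::euclidean_space"
  assumes r: "r > 0"
  obtains \<theta> :: "'a \<Rightarrow> real" where "C1_on UNIV \<theta>" "\<And>x. 0 \<le> \<theta> x"
    "\<And>x. norm (x - x0) \<ge> r \<Longrightarrow> \<theta> x = 0" "\<And>x. norm (x - x0) \<le> r / 2 \<Longrightarrow> \<theta> x = 1"
    "\<And>x h. norm (x - x0) < r / 2 \<Longrightarrow> frechet_derivative \<theta> (at x) h = 0"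
proof -
  \<comment> \<open>\<open>s\<close> is affine in \<open>|x - x0|\<^sup>2\<close>, with value 0 at radius \<open>r / 2\<close> and 1 at radius \<open>r\<close>.\<close>
  define s where "s x = ((x - x0) \<bullet> (x - x0) - (r / 2)\<^sup>2) * (4 / (3 * r\<^sup>2))" for x :: 'a
  define \<theta> where "\<theta> x = (max 0 (1 - (max 0 (s x))\<^sup>2))\<^sup>2" for x
  have pp: "C1_on UNIV (\<lambda>x. (max 0 (f x))\<^sup>2)" if "C1_on UNIV f" for f :: "'a \<Rightarrow> real"
    by (rule C1_on_compose_real[OF that DERIV_positive_part_squared]) (intro continuous_intros)
  have C1: "C1_on UNIV \<theta>"
    unfolding \<theta>_def[abs_def] s_def
    by (intro pp C1_on_diff C1_on_const C1_on_mult C1_on_inner C1_on_ident)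
  have one: "\<theta> x = 1" if "norm (x - x0) \<le> r / 2" for x
  proof -
    have "(norm (x - x0))\<^sup>2 \<le> (r / 2)\<^sup>2" using that by (intro power_mono) auto
    then have "s x \<le> 0" unfolding s_def power2_norm_eq_inner[symmetric] by (intro mult_nonpos_nonneg) auto
    then show ?thesis by (simp add: \<theta>_def)
  qed
  have zero: "\<theta> x = 0" if "norm (x - x0) \<ge> r" for x
  proof -
    have "r\<^sup>2 \<le> (norm (x - x0))\<^sup>2" using that r by (intro power_mono) auto
    then have "(r\<^sup>2 - (r / 2)\<^sup>2) * (4 / (3 * r\<^sup>2)) \<le> s x"
      unfolding s_def power2_norm_eq_inner[symmetric] by (intro mult_right_mono) auto
    moreover have "(r\<^sup>2 - (r / 2)\<^sup>2) * (4 / (3 * r\<^sup>2)) = 1" using r by (simp add: field_simps power2_eq_square)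
    ultimately have "1 \<le> s x" by simp
    then have "1 \<le> (max 0 (s x))\<^sup>2" by (simp add: one_le_power)
    then show ?thesis by (simp add: \<theta>_def)
  qed
  have der: "frechet_derivative \<theta> (at x) h = 0" if "norm (x - x0) < r / 2" for x h
  proof -
    have "((\<lambda>_. 1) has_derivative (\<lambda>_. 0)) (at x)" by (rule has_derivative_const)
    then have "(\<theta> has_derivative (\<lambda>_. 0)) (at x)"
      by (rule has_derivative_transform_within_open[where s = "ball x0 (r / 2)"])
         (use that one in \<open>auto simp: dist_norm norm_minus_commute\<close>)
    then show ?thesis by (simp flip: frechet_derivative_at)
  qed
  show ?thesis by (rule that[OF C1 _ zero one der]) (auto simp: \<theta>_def)
qed

lemma energy_flux_rescale:
  assumes "\<tau> \<noteq> 0"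
  shows "energy_flux q X G \<rho> \<tau> v (\<tau> *\<^sub>R D) = \<tau>\<^sup>2 *\<^sub>R energy_flux q X G (\<rho> / \<tau>) 1 v D"
  using assms by (simp add: energy_flux_def matrix_vector_mult_scaleR power2_eq_square algebra_simps)

context weighted_operator
begin

context
  fixes u :: "real^'n \<Rightarrow> real" and du :: "real^'n \<Rightarrow> real^'n"
  assumes u_deriv: "\<And>x. x \<in> U \<Longrightarrow> (u has_derivative (\<lambda>h. du x \<bullet> h)) (at x)"
    and du_C1: "C1_on U du"
begin

text \<open>Divided by \<open>\<tau>\<^sup>2\<close>, the flux without its exponential factor is a continuous function of \<open>(x, 1 / \<tau>)\<close>
on the compact set \<open>K \<times> [0, 1]\<close>.\<close>
lemma flux_bound:
  assumes K: "compact K" "K \<subseteq> U"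
  shows "\<exists>M\<ge>0. \<forall>\<tau>\<ge>1. \<forall>x\<in>K. norm (flux \<rho> \<tau> u du x) \<le> M * \<tau>\<^sup>2 * exp (- 2 * \<tau> * g x)"
proof -
  define f where "f z = energy_flux (Q (fst z)) (X (fst z)) (G (fst z)) (\<rho> * snd z) 1 (u (fst z)) (snd z *\<^sub>R du (fst z) - u (fst z) *\<^sub>R \<Gamma> (fst z))" for z
  let ?K = "K \<times> {0..1::real}"
  have c: "continuous_on ?K (\<lambda>z. f (fst z))" if "C1_on U f" for f :: "real^'n \<Rightarrow> 'b::real_normed_vector"
    by (rule continuous_on_compose2[OF C1_on_continuous_on[OF that] continuous_on_fst[OF continuous_on_id]])
       (use K in auto)
  note c' = c[OF Q_C1] c[OF X_C1] c[OF G_C1] c[OF u_C1[OF u_deriv du_C1]] c[OF du_C1] c[OF \<Gamma>_C1]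
  have "continuous_on ?K f"
    unfolding f_def[abs_def] energy_flux_def
    by (intro continuous_on_add continuous_on_scaleR continuous_on_mult continuous_on_inner continuous_on_power
      continuous_on_diff continuous_on_const continuous_on_snd continuous_on_id bounded_bilinear.continuous_on[OF bounded_bilinear_matrix_vector] c')
  moreover have "compact ?K" using K by (intro compact_Times) auto
  ultimately obtain M where M: "M \<ge> 0" "\<And>z. z \<in> ?K \<Longrightarrow> norm (f z) \<le> M"
    using continuous_on_compact_bound by blast
  show ?thesis
  proof (intro exI[of _ M] conjI allI ballI impI)
    fix \<tau> :: real and x assume \<tau>: "\<tau> \<ge> 1" and x: "x \<in> K"
    have "du x - (\<tau> * u x) *\<^sub>R \<Gamma> x = \<tau> *\<^sub>R ((1 / \<tau>) *\<^sub>R du x - u x *\<^sub>R \<Gamma> x)"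
      using \<tau> by (simp add: scaleR_diff_right)
    then have "energy_flux (Q x) (X x) (G x) \<rho> \<tau> (u x) (du x - (\<tau> * u x) *\<^sub>R \<Gamma> x) = \<tau>\<^sup>2 *\<^sub>R f (x, 1 / \<tau>)"
      using \<tau> by (simp only: energy_flux_rescale f_def fst_conv snd_conv times_divide_eq_right mult_1_right)
    then have "flux \<rho> \<tau> u du x = exp (- 2 * \<tau> * g x) *\<^sub>R (\<tau>\<^sup>2 *\<^sub>R f (x, 1 / \<tau>))"
      by (simp only: flux_eq[OF u_deriv du_C1])
    moreover have "norm (f (x, 1 / \<tau>)) \<le> M" using x \<tau> by (intro M(2)) simp
    ultimately have "norm (flux \<rho> \<tau> u du x) \<le> exp (- 2 * \<tau> * g x) * (\<tau>\<^sup>2 * M)"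
      by (simp add: mult_left_mono)
    then show "norm (flux \<rho> \<tau> u du x) \<le> M * \<tau>\<^sup>2 * exp (- 2 * \<tau> * g x)"
      by (simp only: mult.commute mult.left_commute)
  qed (rule M(1))
qed

text \<open>First \<open>u = O(p)\<close> near the face makes the gradient of \<open>u\<close> conormal on the face, so that the normal
component of the flux vanishes there; then this component is itself \<open>O(p)\<close>. Each of the two steps
shrinks the ball, but the radius is the same for all \<open>\<tau>\<close>.\<close>
lemma flux_normal_bound:
  fixes p m :: "real^'n \<Rightarrow> real"
  assumes R: "R > 0" "cball x0 R \<subseteq> U"
    and p: "\<And>x. x \<in> U \<Longrightarrow> (p has_derivative (\<lambda>h. dp x \<bullet> h)) (at x)" and dp: "C1_on U dp"
    and m: "\<And>x. x \<in> U \<Longrightarrow> (m has_derivative (\<lambda>h. dm x \<bullet> h)) (at x)" and dm: "C1_on U dm"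
    and x0: "p x0 = 0" and e: "dp x0 \<bullet> e > 0" "dm x0 \<bullet> e < 0"
    and char: "\<And>y. y \<in> U \<Longrightarrow> p y = 0 \<Longrightarrow> dp y \<noteq> 0 \<and> (Q y *v dp y) \<bullet> dp y = 0"
    and u0: "\<And>y. y \<in> U \<Longrightarrow> p y = 0 \<Longrightarrow> m y > 0 \<Longrightarrow> u y = 0"
  shows "\<exists>r>0. \<forall>\<rho> \<tau>. \<exists>C. \<forall>x\<in>ball x0 r. p x > 0 \<longrightarrow> m x > 0 \<longrightarrow> \<bar>dp x \<bullet> flux \<rho> \<tau> u du x\<bar> \<le> C * p x"
proof -
  have x0U: "x0 \<in> U" using R by auto
  have cont: "isCont dp x0" "isCont dm x0"
    using C1_on_has_derivative[OF dp x0U] C1_on_has_derivative[OF dm x0U] has_derivative_continuous by blast+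
  obtain r1 where r1: "r1 > 0" "r1 \<le> R"
    "\<And>f :: real^'n \<Rightarrow> real. C1_on U f \<Longrightarrow> (\<And>y. y \<in> ball x0 R \<Longrightarrow> p y = 0 \<Longrightarrow> m y > 0 \<Longrightarrow> f y = 0) \<Longrightarrow>
      \<exists>C\<ge>0. \<forall>x\<in>ball x0 r1. p x > 0 \<longrightarrow> m x > 0 \<longrightarrow> \<bar>f x\<bar> \<le> C * p x"
    using vanishing_on_face_bound[OF R(2) p cont(1) m cont(2) R(1) x0 e] by blast
  have sub: "ball x0 r1 \<subseteq> U" using R r1(2) by (meson ball_subset_cball order_trans subset_ball)
  have "\<exists>C\<ge>0. \<forall>x\<in>ball x0 r1. p x > 0 \<longrightarrow> m x > 0 \<longrightarrow> \<bar>u x\<bar> \<le> C * p x"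
    using R(2) by (intro r1(3) u_C1[OF u_deriv du_C1] u0) auto
  then obtain C where C: "\<And>x. x \<in> ball x0 r1 \<Longrightarrow> p x > 0 \<Longrightarrow> m x > 0 \<Longrightarrow> \<bar>u x\<bar> \<le> C * p x" by blast
  have R2: "r1 / 2 > 0" "cball x0 (r1 / 2) \<subseteq> U" using r1 sub by auto
  obtain r2 where r2: "r2 > 0" "r2 \<le> r1 / 2"
    "\<And>f :: real^'n \<Rightarrow> real. C1_on U f \<Longrightarrow> (\<And>y. y \<in> ball x0 (r1 / 2) \<Longrightarrow> p y = 0 \<Longrightarrow> m y > 0 \<Longrightarrow> f y = 0) \<Longrightarrow>
      \<exists>C\<ge>0. \<forall>x\<in>ball x0 r2. p x > 0 \<longrightarrow> m x > 0 \<longrightarrow> \<bar>f x\<bar> \<le> C * p x"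
    using vanishing_on_face_bound[OF R2(2) p cont(1) m cont(2) R2(1) x0 e] by blast
  have flux0: "dp y \<bullet> flux \<rho> \<tau> u du y = 0" if y: "y \<in> ball x0 (r1 / 2)" "p y = 0" "m y > 0" for y \<rho> \<tau>
  proof -
    have yV: "y \<in> ball x0 r1" using y(1) r1(1) by auto
    then have yU: "y \<in> U" using sub by blast
    have uy: "u y = 0" by (rule u0[OF yU y(2,3)])
    have "\<exists>t. du y = t *\<^sub>R dp y"
      using gradient_parallel_on_face[OF open_ball yV p[OF yU] has_derivative_continuous[OF m[OF yU]]
        u_deriv[OF yU] uy y(2,3) _ C] char[OF yU y(2)] by blast
    then obtain t where t: "du y = t *\<^sub>R dp y" by blast
    show ?thesis
      using energy_flux_characteristic[of "Q y" "dp y" "X y" "G y" \<rho> \<tau> "exp (- \<tau> * g y) * t"] char[OF yU y(2)]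
      by (simp add: flux_def conj_grad_def uy t inner_commute)
  qed
  have "\<exists>C\<ge>0. \<forall>x\<in>ball x0 r2. p x > 0 \<longrightarrow> m x > 0 \<longrightarrow> \<bar>dp x \<bullet> flux \<rho> \<tau> u du x\<bar> \<le> C * p x" for \<rho> \<tau>
    by (rule r2(3)[OF C1_on_inner[OF dp flux_C1[OF u_deriv du_C1]] flux0])
  then show ?thesis using r2(1) by blast
qed

end

text \<open>Two functions are treated together because the differential inequality bounds the sum of the squares
of their images under the operator. Since \<open>exp (- \<tau> g) du\<close> is the conjugated gradient plus
\<open>\<tau> v \<Gamma>\<close>, the right-hand side is at most a constant multiple of the positive terms on the left, divided
by \<open>\<tau>\<close>; for large \<open>\<tau>\<close> half of those terms absorb it.\<close>
lemma carleman_pair_pointwise: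
  fixes u1 u2 :: "real^'n \<Rightarrow> real" and du1 du2 :: "real^'n \<Rightarrow> real^'n"
  assumes u1: "\<And>x. x \<in> U \<Longrightarrow> (u1 has_derivative (\<lambda>h. du1 x \<bullet> h)) (at x)" "C1_on U du1"
    and u2: "\<And>x. x \<in> U \<Longrightarrow> (u2 has_derivative (\<lambda>h. du2 x \<bullet> h)) (at x)" "C1_on U du2"
    and x: "x \<in> U" and \<tau>: "\<tau> \<ge> 1" "(divergence X x - \<rho>)\<^sup>2 \<le> c * \<tau>" "2 * C * (3 + 2 * B) \<le> c * \<tau>"
    and form: "\<And>\<xi>. c * (norm \<xi>)\<^sup>2 \<le> commutator_form Q X \<rho> x \<xi>"
    and zeroth: "c \<le> zeroth_order_coefficient X G \<rho> x"
    and cB: "c > 0" "C \<ge> 0" "(norm (\<Gamma> x))\<^sup>2 \<le> B"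
    and ineq: "(divergence (\<lambda>y. Q y *v du1 y) x)\<^sup>2 + (divergence (\<lambda>y. Q y *v du2 y) x)\<^sup>2
      \<le> C * ((norm (du1 x))\<^sup>2 + (norm (du2 x))\<^sup>2 + (u1 x)\<^sup>2 + (u2 x)\<^sup>2)"
  shows "c / 2 * \<tau>\<^sup>2 * exp (- 2 * \<tau> * g x) * ((u1 x)\<^sup>2 + (u2 x)\<^sup>2)
    + divergence (\<lambda>y. flux \<rho> \<tau> u1 du1 y + flux \<rho> \<tau> u2 du2 y) x \<le> 0"
proof -
  define E where "E = exp (- \<tau> * g x)"
  define h1 where "h1 = divergence (\<lambda>y. Q y *v du1 y) x"
  define h2 where "h2 = divergence (\<lambda>y. Q y *v du2 y) x"
  define P1 where "P1 = (norm (conj_grad \<tau> u1 du1 x))\<^sup>2 + \<tau>\<^sup>2 * (E * u1 x)\<^sup>2"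
  define P2 where "P2 = (norm (conj_grad \<tau> u2 du2 x))\<^sup>2 + \<tau>\<^sup>2 * (E * u2 x)\<^sup>2"
  have \<tau>0: "\<tau> > 0" using \<tau> by simp
  have 1: "c * P1 + divergence (flux \<rho> \<tau> u1 du1) x \<le> (E * h1)\<^sup>2 / \<tau>"
    "c * P2 + divergence (flux \<rho> \<tau> u2 du2) x \<le> (E * h2)\<^sup>2 / \<tau>"
    unfolding P1_def P2_def E_def h1_def h2_def
    using carleman_pointwise[OF u1 x \<tau>0 \<tau>(2) form zeroth] carleman_pointwise[OF u2 x \<tau>0 \<tau>(2) form zeroth] by blast+
  have grad_bound: "E\<^sup>2 * ((norm (du x))\<^sup>2 + (u x)\<^sup>2)
      \<le> (3 + 2 * B) * ((norm (conj_grad \<tau> u du x))\<^sup>2 + \<tau>\<^sup>2 * (E * u x)\<^sup>2)" for u :: "real^'n \<Rightarrow> real" and du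
  proof -
    define D where "D = conj_grad \<tau> u du x"
    define v where "v = E * u x"
    have "E *\<^sub>R du x = D + (\<tau> * v) *\<^sub>R \<Gamma> x"
      by (simp add: D_def v_def conj_grad_def E_def scaleR_diff_right algebra_simps)
    then have "norm (E *\<^sub>R du x) \<le> norm D + norm ((\<tau> * v) *\<^sub>R \<Gamma> x)" using norm_triangle_ineq by metis
    then have "(norm (E *\<^sub>R du x))\<^sup>2 \<le> (norm D + norm ((\<tau> * v) *\<^sub>R \<Gamma> x))\<^sup>2" by (intro power_mono) auto
    also have "\<dots> \<le> 2 * (norm D)\<^sup>2 + 2 * (norm ((\<tau> * v) *\<^sub>R \<Gamma> x))\<^sup>2"
      using zero_le_power2[of "norm D - norm ((\<tau> * v) *\<^sub>R \<Gamma> x)"] by (simp add: power2_eq_square algebra_simps)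
    also have "(norm ((\<tau> * v) *\<^sub>R \<Gamma> x))\<^sup>2 = \<tau>\<^sup>2 * v\<^sup>2 * (norm (\<Gamma> x))\<^sup>2" by (simp add: power_mult_distrib)
    also have "\<tau>\<^sup>2 * v\<^sup>2 * (norm (\<Gamma> x))\<^sup>2 \<le> \<tau>\<^sup>2 * v\<^sup>2 * B" using cB(3) by (intro mult_left_mono) auto
    finally have a: "E\<^sup>2 * (norm (du x))\<^sup>2 \<le> 2 * (norm D)\<^sup>2 + 2 * (\<tau>\<^sup>2 * v\<^sup>2 * B)"
      by (simp add: power_mult_distrib)
    have "1 \<le> \<tau>\<^sup>2" using \<tau>(1) by (simp add: one_le_power)
    then have b: "1 * v\<^sup>2 \<le> \<tau>\<^sup>2 * v\<^sup>2" by (intro mult_right_mono) auto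
    have B: "B \<ge> 0" using cB(3) zero_le_power2[of "norm (\<Gamma> x)"] by linarith
    then have nn: "0 \<le> B * (norm D)\<^sup>2" "0 \<le> \<tau>\<^sup>2 * v\<^sup>2" by simp_all
    have "E\<^sup>2 * (norm (du x))\<^sup>2 + v\<^sup>2 \<le> (3 + 2 * B) * ((norm D)\<^sup>2 + \<tau>\<^sup>2 * v\<^sup>2)"
    proof -
      have "(3 + 2 * B) * ((norm D)\<^sup>2 + \<tau>\<^sup>2 * v\<^sup>2)
          = 3 * (norm D)\<^sup>2 + 2 * (B * (norm D)\<^sup>2) + 3 * (\<tau>\<^sup>2 * v\<^sup>2) + 2 * (\<tau>\<^sup>2 * v\<^sup>2 * B)"
        by (simp add: algebra_simps)
      then show ?thesis using a b nn zero_le_power2[of "norm D"] by linarith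
    qed
    then show ?thesis by (simp add: D_def v_def power_mult_distrib distrib_left)
  qed
  have "(E * h1)\<^sup>2 + (E * h2)\<^sup>2 = E\<^sup>2 * (h1\<^sup>2 + h2\<^sup>2)" by (simp add: power_mult_distrib distrib_left)
  also have "\<dots> \<le> E\<^sup>2 * (C * ((norm (du1 x))\<^sup>2 + (norm (du2 x))\<^sup>2 + (u1 x)\<^sup>2 + (u2 x)\<^sup>2))"
    using ineq by (intro mult_left_mono) (auto simp: h1_def h2_def)
  also have "\<dots> = C * (E\<^sup>2 * ((norm (du1 x))\<^sup>2 + (u1 x)\<^sup>2) + E\<^sup>2 * ((norm (du2 x))\<^sup>2 + (u2 x)\<^sup>2))"
    by (simp add: algebra_simps)
  also have "\<dots> \<le> C * ((3 + 2 * B) * P1 + (3 + 2 * B) * P2)"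
    unfolding P1_def P2_def using cB(2) by (intro mult_left_mono add_mono grad_bound)
  also have "\<dots> = C * (3 + 2 * B) * (P1 + P2)" by (simp add: algebra_simps)
  also have "\<dots> \<le> (c * \<tau> / 2) * (P1 + P2)"
    using \<tau>(3) by (intro mult_right_mono) (auto simp: P1_def P2_def)
  finally have "((E * h1)\<^sup>2 + (E * h2)\<^sup>2) / \<tau> \<le> c / 2 * (P1 + P2)"
    using \<tau>0 by (simp add: divide_le_eq mult.commute mult.left_commute)
  then have 2: "c / 2 * (P1 + P2) + (divergence (flux \<rho> \<tau> u1 du1) x + divergence (flux \<rho> \<tau> u2 du2) x) \<le> 0"
    using 1 by (simp add: add_divide_distrib algebra_simps)
  have "E\<^sup>2 = exp (- 2 * \<tau> * g x)" by (simp add: E_def power2_eq_square exp_add[symmetric])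
  then have "\<tau>\<^sup>2 * exp (- 2 * \<tau> * g x) * ((u1 x)\<^sup>2 + (u2 x)\<^sup>2) = \<tau>\<^sup>2 * (E * u1 x)\<^sup>2 + \<tau>\<^sup>2 * (E * u2 x)\<^sup>2"
    by (simp add: power_mult_distrib distrib_left)
  also have "\<dots> \<le> P1 + P2" by (simp add: P1_def P2_def)
  finally have "c / 2 * (\<tau>\<^sup>2 * exp (- 2 * \<tau> * g x) * ((u1 x)\<^sup>2 + (u2 x)\<^sup>2)) \<le> c / 2 * (P1 + P2)"
    using cB(1) by (intro mult_left_mono) auto
  moreover have "divergence (\<lambda>y. flux \<rho> \<tau> u1 du1 y + flux \<rho> \<tau> u2 du2 y) x
      = divergence (flux \<rho> \<tau> u1 du1) x + divergence (flux \<rho> \<tau> u2 du2) x"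
    by (intro divergence_add C1_on_differentiable[OF flux_C1[OF u1] x] C1_on_differentiable[OF flux_C1[OF u2] x])
  ultimately show ?thesis using 2 unfolding mult.assoc by linarith
qed

end

section \<open>Vanishing near a corner point\<close>

text \<open>Let \<open>\<alpha> = a r\<^sup>2 / 4\<close>. The cutoff \<open>\<theta>\<close> varies only for \<open>|x - x0| \<ge> r / 2\<close>, where \<open>g \<ge> \<alpha>\<close> in the region, while
\<open>g \<le> \<alpha> / 2\<close> on the ball of radius \<open>s\<close>. If \<open>w = u1\<^sup>2 + u2\<^sup>2\<close> were positive at some point \<open>x1\<close> of that ball, the
integrated Carleman inequality would give \<open>k1 exp (- \<tau> \<alpha>) \<le> k2 exp (- 2 \<tau> \<alpha>)\<close> for all large \<open>\<tau>\<close> with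
\<open>k1 > 0\<close>, which is impossible.\<close>
lemma vanishing_near_corner:
  fixes U :: "(real^'n) set" and Q :: "real^'n \<Rightarrow> real^'n^'n" and p m u1 u2 :: "real^'n \<Rightarrow> real"
    and dp dm du1 du2 :: "real^'n \<Rightarrow> real^'n"
  assumes U: "open U" and Q_C1: "C1_on U Q" and Q_sym: "\<And>x a b. x \<in> U \<Longrightarrow> (Q x *v a) \<bullet> b = a \<bullet> (Q x *v b)"
    and p: "\<And>x. x \<in> U \<Longrightarrow> (p has_derivative (\<lambda>h. dp x \<bullet> h)) (at x)" and dp: "C1_on U dp"
    and m: "\<And>x. x \<in> U \<Longrightarrow> (m has_derivative (\<lambda>h. dm x \<bullet> h)) (at x)" and dm: "C1_on U dm"
    and x0: "x0 \<in> U" "p x0 = 0" "m x0 = 0"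
    and char_p: "\<And>y. y \<in> U \<Longrightarrow> p y = 0 \<Longrightarrow> dp y \<noteq> 0 \<and> (Q y *v dp y) \<bullet> dp y = 0"
    and char_m: "\<And>y. y \<in> U \<Longrightarrow> m y = 0 \<Longrightarrow> dm y \<noteq> 0 \<and> (Q y *v dm y) \<bullet> dm y = 0"
    and pos: "(Q x0 *v dp x0) \<bullet> dm x0 > 0"
    and form: "\<And>\<xi>. \<xi> \<noteq> 0 \<Longrightarrow> 0 < 2 * ((Q x0 *v dp x0) \<bullet> dm x0) * ((Q x0 *v \<xi>) \<bullet> \<xi>)
      - 8 * ((Q x0 *v dp x0) \<bullet> \<xi>) * ((Q x0 *v dm x0) \<bullet> \<xi>) + 8 * ((Q x0 *v dp x0) \<bullet> \<xi> + (Q x0 *v dm x0) \<bullet> \<xi>)\<^sup>2"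
    and u1: "\<And>x. x \<in> U \<Longrightarrow> (u1 has_derivative (\<lambda>h. du1 x \<bullet> h)) (at x)" "C1_on U du1"
    and u2: "\<And>x. x \<in> U \<Longrightarrow> (u2 has_derivative (\<lambda>h. du2 x \<bullet> h)) (at x)" "C1_on U du2"
    and face_p: "\<And>y. y \<in> U \<Longrightarrow> p y = 0 \<Longrightarrow> m y > 0 \<Longrightarrow> u1 y = 0 \<and> u2 y = 0"
    and face_m: "\<And>y. y \<in> U \<Longrightarrow> m y = 0 \<Longrightarrow> p y > 0 \<Longrightarrow> u1 y = 0 \<and> u2 y = 0"
    and ineq: "r0 > 0" "C \<ge> 0" "\<And>x. x \<in> ball x0 r0 \<Longrightarrow> x \<in> U \<Longrightarrow> p x > 0 \<Longrightarrow> m x > 0 \<Longrightarrow>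
      (divergence (\<lambda>y. Q y *v du1 y) x)\<^sup>2 + (divergence (\<lambda>y. Q y *v du2 y) x)\<^sup>2
      \<le> C * ((norm (du1 x))\<^sup>2 + (norm (du2 x))\<^sup>2 + (u1 x)\<^sup>2 + (u2 x)\<^sup>2)"
  shows "\<exists>s>0. \<forall>x\<in>ball x0 s \<inter> U. p x > 0 \<longrightarrow> m x > 0 \<longrightarrow> u1 x = 0 \<and> u2 x = 0"
proof -
  have cp: "(Q x0 *v dp x0) \<bullet> dp x0 = 0" and cm: "(Q x0 *v dm x0) \<bullet> dm x0 = 0"
    using char_p[OF x0(1,2)] char_m[OF x0(1,3)] by blast+
  obtain g \<Gamma> \<rho> c r1 a where W: "weighted_operator U Q g \<Gamma>" and c: "c > 0" and r1: "r1 > 0"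
    and a: "a > 0" and r1': "cball x0 r1 \<subseteq> U" and g0: "g x0 = 0"
    and cform': "\<forall>x\<in>cball x0 r1. \<forall>\<xi>. c * (norm \<xi>)\<^sup>2 \<le> commutator_form Q (weighted_operator.X Q \<Gamma>) \<rho> x \<xi>"
    and zeroth': "\<forall>x\<in>cball x0 r1. c \<le> zeroth_order_coefficient (weighted_operator.X Q \<Gamma>) (weighted_operator.G Q \<Gamma>) \<rho> x"
    and conv': "\<forall>x\<in>cball x0 r1. p x > 0 \<longrightarrow> m x > 0 \<longrightarrow> a * (norm (x - x0))\<^sup>2 \<le> g x"
    by (rule convex_weight_at_corner[OF U Q_C1 Q_sym p dp m dm x0 cp cm pos form];
      (assumption | (rule that; assumption)))
  interpret W: weighted_operator U Q g \<Gamma> by (rule W)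
  note cform = cform'[rule_format] and zeroth = zeroth'[rule_format] and conv = conv'[rule_format]
  \<comment> \<open>At \<open>x0\<close> this direction raises \<open>p\<close> and lowers \<open>m\<close>, because both conormals are null and \<open>\<langle>Q dp, dm\<rangle> > 0\<close>.\<close>
  define e where "e = Q x0 *v dm x0 - Q x0 *v dp x0"
  have e: "dp x0 \<bullet> e > 0" "dm x0 \<bullet> e < 0"
    using pos char_p[OF x0(1,2)] char_m[OF x0(1,3)] Q_sym[OF x0(1), of "dp x0" "dm x0"]
    by (auto simp: e_def inner_diff_right inner_commute)
  then have e': "dm x0 \<bullet> (- e) > 0" "dp x0 \<bullet> (- e) < 0" by simp_all
  have f1p: "u1 y = 0" and f2p: "u2 y = 0" if "y \<in> U" "p y = 0" "m y > 0" for y using face_p[OF that] by auto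
  have f1m: "u1 y = 0" and f2m: "u2 y = 0" if "y \<in> U" "m y = 0" "p y > 0" for y using face_m[OF that] by auto
  obtain ra where ra: "ra > 0" "\<forall>\<rho> \<tau>. \<exists>C. \<forall>x\<in>ball x0 ra. p x > 0 \<longrightarrow> m x > 0 \<longrightarrow> \<bar>dp x \<bullet> W.flux \<rho> \<tau> u1 du1 x\<bar> \<le> C * p x"
    using W.flux_normal_bound[OF u1 r1 r1' p dp m dm x0(2) e char_p f1p] by blast
  obtain rb where rb: "rb > 0" "\<forall>\<rho> \<tau>. \<exists>C. \<forall>x\<in>ball x0 rb. p x > 0 \<longrightarrow> m x > 0 \<longrightarrow> \<bar>dp x \<bullet> W.flux \<rho> \<tau> u2 du2 x\<bar> \<le> C * p x"
    using W.flux_normal_bound[OF u2 r1 r1' p dp m dm x0(2) e char_p f2p] by blast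
  obtain rc where rc: "rc > 0" "\<forall>\<rho> \<tau>. \<exists>C. \<forall>x\<in>ball x0 rc. m x > 0 \<longrightarrow> p x > 0 \<longrightarrow> \<bar>dm x \<bullet> W.flux \<rho> \<tau> u1 du1 x\<bar> \<le> C * m x"
    using W.flux_normal_bound[OF u1 r1 r1' m dm p dp x0(3) e' char_m f1m] by blast
  obtain rd where rd: "rd > 0" "\<forall>\<rho> \<tau>. \<exists>C. \<forall>x\<in>ball x0 rd. m x > 0 \<longrightarrow> p x > 0 \<longrightarrow> \<bar>dm x \<bullet> W.flux \<rho> \<tau> u2 du2 x\<bar> \<le> C * m x"
    using W.flux_normal_bound[OF u2 r1 r1' m dm p dp x0(3) e' char_m f2m] by blast
  define r where "r = min (min r0 r1) (min (min ra rb) (min rc rd)) / 2"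
  have r: "r > 0" "r < r0" "r < r1" "r < ra" "r < rb" "r < rc" "r < rd"
    using ineq(1) r1 ra(1) rb(1) rc(1) rd(1) by (auto simp: r_def)
  have K: "cball x0 r \<subseteq> U" using r1' r(3) by auto
  have inK: "x \<in> U" "x \<in> ball x0 r0" "x \<in> cball x0 r1" "x \<in> ball x0 ra" "x \<in> ball x0 rb" "x \<in> ball x0 rc" "x \<in> ball x0 rd"
    if "x \<in> cball x0 r" for x
    using that K r by auto
  define S where "S = {x \<in> cball x0 r. p x > 0 \<and> m x > 0}"
  note bdd = continuous_on_compact_bound[OF compact_cball continuous_on_subset[OF _ K]]
  have "continuous_on U (\<lambda>x. (norm (\<Gamma> x))\<^sup>2)" by (intro continuous_intros C1_on_continuous_on W.\<Gamma>_C1)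
  then obtain B where B: "\<And>x. x \<in> cball x0 r \<Longrightarrow> (norm (\<Gamma> x))\<^sup>2 \<le> B"
    using bdd by (metis abs_of_nonneg real_norm_def zero_le_power2)
  have "continuous_on U (\<lambda>x. (divergence W.X x - \<rho>)\<^sup>2)" by (intro continuous_intros continuous_on_divergence W.X_C1)
  then obtain B2 where B2: "\<And>x. x \<in> cball x0 r \<Longrightarrow> (divergence W.X x - \<rho>)\<^sup>2 \<le> B2"
    using bdd by (metis abs_of_nonneg real_norm_def zero_le_power2)
  obtain \<theta> :: "real^'n \<Rightarrow> real" where \<theta>: "C1_on UNIV \<theta>" "\<And>x. 0 \<le> \<theta> x"
    "\<And>x. norm (x - x0) \<ge> r \<Longrightarrow> \<theta> x = 0" "\<And>x. norm (x - x0) \<le> r / 2 \<Longrightarrow> \<theta> x = 1"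
    "\<And>x h. norm (x - x0) < r / 2 \<Longrightarrow> frechet_derivative \<theta> (at x) h = 0"
    by (fact smooth_cutoff[OF r(1), of x0])
  obtain N where N: "N \<ge> 0" "\<And>x h. x \<in> cball x0 r \<Longrightarrow> norm (frechet_derivative \<theta> (at x) h) \<le> N * norm h"
    using C1_on_bounded_derivative[OF \<theta>(1) compact_cball] by blast
  obtain M1 where M1: "M1 \<ge> 0" "\<And>\<tau> x. \<tau> \<ge> 1 \<Longrightarrow> x \<in> cball x0 r \<Longrightarrow> norm (W.flux \<rho> \<tau> u1 du1 x) \<le> M1 * \<tau>\<^sup>2 * exp (- 2 * \<tau> * g x)"
    using W.flux_bound[OF u1 compact_cball K] by blast
  obtain M2 where M2: "M2 \<ge> 0" "\<And>\<tau> x. \<tau> \<ge> 1 \<Longrightarrow> x \<in> cball x0 r \<Longrightarrow> norm (W.flux \<rho> \<tau> u2 du2 x) \<le> M2 * \<tau>\<^sup>2 * exp (- 2 * \<tau> * g x)"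
    using W.flux_bound[OF u2 compact_cball K] by blast
  define \<alpha> where "\<alpha> = a * r\<^sup>2 / 4"
  have \<alpha>: "\<alpha> > 0" using a r by (simp add: \<alpha>_def)
  have "isCont g x0" using W.g_deriv[OF x0(1)] has_derivative_continuous by blast
  then have "(g \<longlongrightarrow> 0) (at x0)" using g0 by (simp add: isCont_def)
  then have "\<forall>\<^sub>F x in at x0. g x < \<alpha> / 2" by (rule order_tendstoD) (use \<alpha> in simp)
  then obtain s0 where s0: "s0 > 0" "\<And>x. x \<noteq> x0 \<Longrightarrow> dist x x0 < s0 \<Longrightarrow> g x < \<alpha> / 2"
    unfolding eventually_at by auto
  define s where "s = min s0 (r / 2)"
  have s: "s > 0" "s \<le> r / 2" using s0 r by (auto simp: s_def)
  have g_small: "g x \<le> \<alpha> / 2" if "x \<in> ball x0 s" for x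
    using s0(2)[of x] that g0 \<alpha> by (cases "x = x0") (auto simp: s_def dist_commute less_imp_le)
  define w where "w x = (u1 x)\<^sup>2 + (u2 x)\<^sup>2" for x
  have w_zero: "w x1 = 0" if x1: "x1 \<in> ball x0 s" "x1 \<in> U" "p x1 > 0" "m x1 > 0" for x1
  proof (rule ccontr)
    assume "w x1 \<noteq> 0"
    moreover have "w x1 \<ge> 0" by (simp add: w_def)
    ultimately have wx1: "w x1 > 0" by simp
    define \<eta> where "\<eta> = w x1 / 2"
    have \<eta>: "\<eta> > 0" "\<eta> < w x1" using wx1 by (auto simp: \<eta>_def)
    have cont: "isCont p x1" "isCont m x1" "isCont w x1"
      using has_derivative_continuous[OF p[OF x1(2)]] has_derivative_continuous[OF m[OF x1(2)]]
        has_derivative_continuous[OF u1(1)[OF x1(2)]] has_derivative_continuous[OF u2(1)[OF x1(2)]]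
      unfolding w_def by (auto intro!: continuous_intros)
    have "\<forall>\<^sub>F x in nhds x1. x \<in> ball x0 s \<and> p x > 0 \<and> m x > 0 \<and> w x > \<eta>"
    proof (intro eventually_conj)
      have n: "(p \<longlongrightarrow> p x1) (nhds x1)" "(m \<longlongrightarrow> m x1) (nhds x1)" "(w \<longlongrightarrow> w x1) (nhds x1)"
        using cont by (simp_all add: isCont_def tendsto_at_iff_tendsto_nhds)
      show "\<forall>\<^sub>F x in nhds x1. p x > 0" by (rule order_tendstoD(1)[OF n(1) x1(3)])
      show "\<forall>\<^sub>F x in nhds x1. m x > 0" by (rule order_tendstoD(1)[OF n(2) x1(4)])
      show "\<forall>\<^sub>F x in nhds x1. w x > \<eta>" by (rule order_tendstoD(1)[OF n(3) \<eta>(2)])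
      show "\<forall>\<^sub>F x in nhds x1. x \<in> ball x0 s" by (rule eventually_nhds_in_open[OF open_ball x1(1)])
    qed
    then obtain \<epsilon> where \<epsilon>: "\<epsilon> > 0" "\<And>x. dist x x1 < \<epsilon> \<Longrightarrow> x \<in> ball x0 s \<and> p x > 0 \<and> m x > 0 \<and> w x > \<eta>"
      unfolding eventually_nhds_metric by blast
    define L where "L = ball x1 \<epsilon>"
    have L: "x \<in> ball x0 s" "x \<in> S" "w x > \<eta>" if "x \<in> L" for x
      using \<epsilon>(2)[of x] that s(2) r(1) by (auto simp: L_def S_def dist_commute)
    define k1 where "k1 = c / 2 * \<eta> * measure lborel L"
    define k2 where "k2 = N * (M1 + M2) * measure lborel (cball x0 r)"
    have "k1 > 0" using c \<eta> \<epsilon>(1) by (simp add: k1_def L_def content_ball_pos)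
    have k2: "k2 \<ge> 0" using N(1) M1(1) M2(1) by (simp add: k2_def)
    \<comment> \<open>Above \<open>\<tau>0\<close> the pointwise Carleman inequality holds on the whole region \<open>S\<close>.\<close>
    define \<tau>0 where "\<tau>0 = max 1 (max (B2 / c) (2 * C * (3 + 2 * B) / c))"
    have main: "k1 * exp (\<tau> * \<alpha>) \<le> k2" if \<tau>: "\<tau> \<ge> \<tau>0" for \<tau>
    proof -
      have \<tau>1: "\<tau> \<ge> 1" "B2 \<le> c * \<tau>" "2 * C * (3 + 2 * B) \<le> c * \<tau>"
        using \<tau> c by (auto simp: \<tau>0_def pos_divide_le_eq mult.commute)
      define F where "F y = W.flux \<rho> \<tau> u1 du1 y + W.flux \<rho> \<tau> u2 du2 y" for y
      have F_C1: "C1_on U F" unfolding F_def[abs_def] by (intro C1_on_add W.flux_C1 u1 u2)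
      have fr: "frechet_derivative p (at x) h = dp x \<bullet> h" "frechet_derivative m (at x) h = dm x \<bullet> h" if "x \<in> U" for x h
        using frechet_derivative_at[OF p[OF that]] frechet_derivative_at[OF m[OF that]] by (metis, metis)
      obtain Ca where Ca: "\<And>x. x \<in> ball x0 ra \<Longrightarrow> p x > 0 \<Longrightarrow> m x > 0 \<Longrightarrow> \<bar>dp x \<bullet> W.flux \<rho> \<tau> u1 du1 x\<bar> \<le> Ca * p x" using spec[OF spec[OF ra(2), of \<rho>], of \<tau>] by blast
      obtain Cb where Cb: "\<And>x. x \<in> ball x0 rb \<Longrightarrow> p x > 0 \<Longrightarrow> m x > 0 \<Longrightarrow> \<bar>dp x \<bullet> W.flux \<rho> \<tau> u2 du2 x\<bar> \<le> Cb * p x" using spec[OF spec[OF rb(2), of \<rho>], of \<tau>] by blast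
      obtain Cc where Cc: "\<And>x. x \<in> ball x0 rc \<Longrightarrow> p x > 0 \<Longrightarrow> m x > 0 \<Longrightarrow> \<bar>dm x \<bullet> W.flux \<rho> \<tau> u1 du1 x\<bar> \<le> Cc * m x" using spec[OF spec[OF rc(2), of \<rho>], of \<tau>] by blast
      obtain Cd where Cd: "\<And>x. x \<in> ball x0 rd \<Longrightarrow> p x > 0 \<Longrightarrow> m x > 0 \<Longrightarrow> \<bar>dm x \<bullet> W.flux \<rho> \<tau> u2 du2 x\<bar> \<le> Cd * m x" using spec[OF spec[OF rd(2), of \<rho>], of \<tau>] by blast
      define CC where "CC = \<bar>Ca\<bar> + \<bar>Cb\<bar> + \<bar>Cc\<bar> + \<bar>Cd\<bar>"
      have bp: "\<bar>frechet_derivative p (at x) (F x)\<bar> \<le> CC * p x" if x: "x \<in> cball x0 r" "p x > 0" "m x > 0" for x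
      proof -
        have "\<bar>dp x \<bullet> F x\<bar> \<le> (Ca + Cb) * p x"
          using Ca[OF inK(4)[OF x(1)] x(2,3)] Cb[OF inK(5)[OF x(1)] x(2,3)]
          by (simp add: F_def inner_add_right distrib_right)
        also have "\<dots> \<le> CC * p x" using x(2) by (intro mult_right_mono) (auto simp: CC_def)
        finally show ?thesis using fr[OF inK(1)[OF x(1)]] by simp
      qed
      have bm: "\<bar>frechet_derivative m (at x) (F x)\<bar> \<le> CC * m x" if x: "x \<in> cball x0 r" "p x > 0" "m x > 0" for x
      proof -
        have "\<bar>dm x \<bullet> F x\<bar> \<le> (Cc + Cd) * m x"
          using Cc[OF inK(6)[OF x(1)] x(2,3)] Cd[OF inK(7)[OF x(1)] x(2,3)]
          by (simp add: F_def inner_add_right distrib_right)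
        also have "\<dots> \<le> CC * m x" using x(3) by (intro mult_right_mono) (auto simp: CC_def)
        finally show ?thesis using fr[OF inK(1)[OF x(1)]] by simp
      qed
      have pC1: "C1_on U p" "C1_on U m"
        by (rule C1_on_if_C1_gradient[OF p dp] C1_on_if_C1_gradient[OF m dm], assumption)+
      have supp: "\<theta> x = 0" if "x \<notin> cball x0 r" for x
        using \<theta>(3)[of x] that by (auto simp: dist_norm norm_minus_commute)
      let ?\<Phi> = "\<lambda>x. indicator S x * (\<theta> x * divergence F x + frechet_derivative \<theta> (at x) (F x)) :: real"
      have int: "(\<integral>x. ?\<Phi> x \<partial>lborel) = 0" "integrable lborel ?\<Phi>"
        using integral_divergence_over_corner[OF U F_C1 K pC1 C1_on_subset[OF \<theta>(1) subset_UNIV] supp bp bm]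
        unfolding S_def by auto
      define E where "E = exp (- \<tau> * \<alpha>)"
      let ?\<Psi> = "\<lambda>x. \<tau>\<^sup>2 * (N * (M1 + M2) * (E * E)) * indicator (cball x0 r) x - \<tau>\<^sup>2 * (c / 2 * \<eta> * E) * indicator L x :: real"
      \<comment> \<open>\<open>E * E\<close> bounds the exponential weight on the shell where \<open>\<theta>\<close> varies, and \<open>E\<close> is a lower bound for it on \<open>L\<close>.\<close>
      have le: "?\<Phi> x \<le> ?\<Psi> x" for x
      proof (cases "x \<in> S")
        case True
        then have x: "x \<in> cball x0 r" "p x > 0" "m x > 0" by (auto simp: S_def)
        have "c / 2 * \<tau>\<^sup>2 * exp (- 2 * \<tau> * g x) * w x + divergence F x \<le> 0"
          unfolding w_def F_def[abs_def]
          using W.carleman_pair_pointwise[OF u1 u2 inK(1)[OF x(1)] \<tau>1(1) order_trans[OF B2[OF x(1)] \<tau>1(2)] \<tau>1(3)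
            cform[OF inK(3)[OF x(1)]] zeroth[OF inK(3)[OF x(1)]] c ineq(2) B[OF x(1)]
            ineq(3)[OF inK(2)[OF x(1)] inK(1)[OF x(1)] x(2,3)]] .
        then have "divergence F x \<le> - (c / 2 * \<tau>\<^sup>2 * exp (- 2 * \<tau> * g x) * w x)" by simp
        then have 1: "\<theta> x * divergence F x \<le> \<theta> x * - (c / 2 * \<tau>\<^sup>2 * exp (- 2 * \<tau> * g x) * w x)"
          using \<theta>(2) by (intro mult_left_mono) auto
        have 2: "\<theta> x * - (c / 2 * \<tau>\<^sup>2 * exp (- 2 * \<tau> * g x) * w x) \<le> - \<tau>\<^sup>2 * (c / 2 * \<eta> * E) * indicator L x"
        proof (cases "x \<in> L")
          case True
          have "norm (x - x0) < s" using L(1)[OF True] by (simp add: dist_norm norm_minus_commute)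
          then have th: "\<theta> x = 1" using s(2) by (intro \<theta>(4)) simp
          have "\<tau> * g x \<le> \<tau> * (\<alpha> / 2)" using g_small[OF L(1)[OF True]] \<tau>1(1) by (intro mult_left_mono) auto
          then have "E \<le> exp (- 2 * \<tau> * g x)" by (simp add: E_def)
          moreover have "\<eta> \<le> w x" using L(3)[OF True] by simp
          ultimately have "E * \<eta> \<le> exp (- 2 * \<tau> * g x) * w x"
            using \<eta>(1) by (intro mult_mono) (auto simp: E_def)
          then have "c / 2 * \<tau>\<^sup>2 * (E * \<eta>) \<le> c / 2 * \<tau>\<^sup>2 * (exp (- 2 * \<tau> * g x) * w x)"
            using c by (intro mult_left_mono) auto
          then show ?thesis using True th by (simp add: mult.assoc mult.commute mult.left_commute)
        next
          case False
          have "0 \<le> \<theta> x * (c / 2 * \<tau>\<^sup>2 * exp (- 2 * \<tau> * g x) * w x)"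
            using c \<theta>(2)[of x] by (simp add: w_def)
          then show ?thesis using False by simp
        qed
        have 3: "frechet_derivative \<theta> (at x) (F x) \<le> \<tau>\<^sup>2 * (N * (M1 + M2) * (E * E))"
        proof (cases "norm (x - x0) < r / 2")
          case True
          then show ?thesis using \<theta>(5)[OF True] N(1) M1(1) M2(1) by (simp add: E_def)
        next
          case False
          have "(r / 2)\<^sup>2 \<le> (norm (x - x0))\<^sup>2" using False r(1) by (intro power_mono) auto
          then have "a * (r / 2)\<^sup>2 \<le> a * (norm (x - x0))\<^sup>2" using a by (intro mult_left_mono) auto
          then have "\<alpha> \<le> g x" using conv[OF inK(3)[OF x(1)] x(2,3)] by (simp add: \<alpha>_def power_divide)
          then have "\<tau> * \<alpha> \<le> \<tau> * g x" using \<tau>1(1) by (intro mult_left_mono) auto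
          then have ex: "exp (- 2 * \<tau> * g x) \<le> E * E" by (simp add: E_def exp_add[symmetric] mult.commute)
          have "norm (F x) \<le> M1 * \<tau>\<^sup>2 * exp (- 2 * \<tau> * g x) + M2 * \<tau>\<^sup>2 * exp (- 2 * \<tau> * g x)"
            unfolding F_def using M1(2)[OF \<tau>1(1) x(1)] M2(2)[OF \<tau>1(1) x(1)] by (rule norm_triangle_le[OF add_mono])
          also have "\<dots> = (M1 + M2) * \<tau>\<^sup>2 * exp (- 2 * \<tau> * g x)" by (simp add: algebra_simps)
          also have "\<dots> \<le> (M1 + M2) * \<tau>\<^sup>2 * (E * E)" using ex M1(1) M2(1) by (intro mult_left_mono) auto
          finally have "N * norm (F x) \<le> N * ((M1 + M2) * \<tau>\<^sup>2 * (E * E))" using N(1) by (rule mult_left_mono)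
          then show ?thesis using N(2)[OF x(1), of "F x"] by (simp add: algebra_simps)
        qed
        show ?thesis using True x 1 2 3 by simp
      next
        case False
        then have "x \<notin> L" using L(2) by blast
        moreover have "0 \<le> \<tau>\<^sup>2 * (N * (M1 + M2) * (E * E))" using N(1) M1(1) M2(1) by (simp add: E_def)
        ultimately show ?thesis using False by (simp add: indicator_def)
      qed
      have fin: "emeasure lborel (cball x0 r) < \<infinity>" "emeasure lborel L < \<infinity>"
        unfolding L_def by (rule emeasure_lborel_cball_finite emeasure_lborel_ball_finite)+
      have i1: "integrable lborel (\<lambda>x. indicator (cball x0 r) x :: real)" "integrable lborel (\<lambda>x. indicator L x :: real)"
        using fin by (auto intro!: integrable_real_indicator simp: L_def)
      have "0 \<le> (\<integral>x. ?\<Psi> x \<partial>lborel)"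
        unfolding int(1)[symmetric]
        by (rule integral_mono[OF int(2)]) (intro Bochner_Integration.integrable_diff integrable_mult_right i1, rule le)
      also have "(\<integral>x. ?\<Psi> x \<partial>lborel) = \<tau>\<^sup>2 * (N * (M1 + M2) * (E * E)) * measure lborel (cball x0 r)
          - \<tau>\<^sup>2 * (c / 2 * \<eta> * E) * measure lborel L"
        using i1 by (simp add: L_def)
      also have "\<dots> = \<tau>\<^sup>2 * E * (k2 * E - k1)" by (simp add: k1_def k2_def algebra_simps)
      finally have "0 \<le> \<tau>\<^sup>2 * E * (k2 * E - k1)" .
      moreover have "\<tau>\<^sup>2 * E > 0" using \<tau>1(1) by (simp add: E_def)
      ultimately have "k1 \<le> k2 * E" by (simp add: zero_le_mult_iff)
      then have "k1 * exp (\<tau> * \<alpha>) \<le> k2 * E * exp (\<tau> * \<alpha>)" by (intro mult_right_mono) auto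
      also have "\<dots> = k2" by (simp add: E_def mult.assoc exp_add[symmetric])
      finally show ?thesis .
    qed
    \<comment> \<open>At this \<open>\<tau>\<close> already \<open>1 + \<tau> \<alpha> \<le> exp (\<tau> \<alpha>)\<close> contradicts \<open>main\<close>.\<close>
    define \<tau> where "\<tau> = max \<tau>0 (k2 / (k1 * \<alpha>))"
    have "k2 \<le> k1 * (\<tau> * \<alpha>)"
    proof -
      have "k2 / (k1 * \<alpha>) \<le> \<tau>" by (simp add: \<tau>_def)
      then show ?thesis using \<open>k1 > 0\<close> \<alpha> by (simp add: pos_divide_le_eq mult.commute mult.left_commute)
    qed
    also have "\<dots> < k1 * (1 + \<tau> * \<alpha>)" using \<open>k1 > 0\<close> by simp
    also have "\<dots> \<le> k1 * exp (\<tau> * \<alpha>)" using \<open>k1 > 0\<close> by (intro mult_left_mono exp_ge_add_one_self) auto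
    also have "\<dots> \<le> k2" by (rule main) (simp add: \<tau>_def)
    finally show False by simp
  qed
  show ?thesis
  proof (intro exI[of _ s] conjI ballI impI)
    fix x assume "x \<in> ball x0 s \<inter> U" "p x > 0" "m x > 0"
    then have "w x = 0" using w_zero by blast
    then show "u1 x = 0" "u2 x = 0" by (simp_all add: w_def sum_power2_eq_zero_iff)
  qed (rule s(1))
qed

section \<open>Reduction to real-valued functions in divergence form\<close>

lemma partial_deriv_cong_open:
  assumes "open S" "x \<in> S" "\<And>y. y \<in> S \<Longrightarrow> f y = g y"
  shows "partial_deriv i f x = partial_deriv i g x"
proof -
  have "(f has_derivative f') (at x) \<longleftrightarrow> (g has_derivative f') (at x)" for f'
    using has_derivative_transform_within_open[of f f' x UNIV S g]
      has_derivative_transform_within_open[of g f' x UNIV S f] assms by auto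
  then show ?thesis by (simp add: partial_deriv_def frechet_derivative_def)
qed

lemma grad_cong_open:
  assumes "open S" "x \<in> S" "\<And>y. y \<in> S \<Longrightarrow> f y = g y"
  shows "grad f x = grad g x"
  using partial_deriv_cong_open[OF assms] by (simp add: grad_def)

lemma second_order_op_cong_open:
  assumes S: "open S" "x \<in> S" and eq: "\<And>y. y \<in> S \<Longrightarrow> f y = g y"
  shows "second_order_op Q b c f x = second_order_op Q b c g x"
proof -
  have 1: "partial_deriv j f y = partial_deriv j g y" if "y \<in> S" for j y
    by (rule partial_deriv_cong_open[OF S(1) that eq])
  then have "partial_deriv i (partial_deriv j f) x = partial_deriv i (partial_deriv j g) x" for i j
    by (intro partial_deriv_cong_open[OF S]) auto
  then show ?thesis using 1[OF S(2)] eq[OF S(2)] by (simp add: second_order_op_def)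
qed

lemma has_derivative_vec_lambda:
  fixes F :: "'i::finite \<Rightarrow> 'a::real_normed_vector \<Rightarrow> real"
  assumes "\<And>k. (F k has_derivative F' k) (at x)"
  shows "((\<lambda>y. \<chi> k. F k y) has_derivative (\<lambda>h. \<chi> k. F' k h)) (at x)"
  using assms by (subst has_derivative_componentwise_within) (auto simp: Basis_vec_def inner_axis)

lemma has_derivative_linear_part:
  fixes v :: "real^'n \<Rightarrow> complex" and f :: "complex \<Rightarrow> real"
  assumes f: "bounded_linear f" and v: "v differentiable (at x)"
  shows "((\<lambda>x. f (v x)) has_derivative (\<lambda>h. (\<chi> k. f (partial_deriv k v x)) \<bullet> h)) (at x)"
proof -
  have d: "((\<lambda>x. f (v x)) has_derivative (\<lambda>h. f (frechet_derivative v (at x) h))) (at x)"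
    by (rule bounded_linear.has_derivative[OF f v[unfolded frechet_derivative_works]])
  have "f (frechet_derivative v (at x) h) = (\<chi> k. f (partial_deriv k v x)) \<bullet> h" for h
    using linear_axis_sum[OF has_derivative_linear[OF d], of h]
    by (simp add: partial_deriv_def inner_vec_def mult.commute)
  then show ?thesis using d by simp
qed

text \<open>The divergence of \<open>Q\<close> times the gradient of \<open>v\<close>, written out for complex-valued \<open>v\<close>: real and
imaginary parts are the divergences of real vector fields.\<close>
definition principal_divergence :: "(real^'n \<Rightarrow> real^'n^'n) \<Rightarrow> (real^'n \<Rightarrow> complex) \<Rightarrow> real^'n \<Rightarrow> complex"
  where "principal_divergence Q v x =
    (\<Sum>i\<in>UNIV. \<Sum>k\<in>UNIV. of_real (Q x $ i $ k) * partial_deriv i (partial_deriv k v) x)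
    + (\<Sum>i\<in>UNIV. \<Sum>k\<in>UNIV. of_real (frechet_derivative Q (at x) (axis i 1) $ i $ k) * partial_deriv k v x)"

lemma divergence_linear_part:
  fixes v :: "real^'n \<Rightarrow> complex" and f :: "complex \<Rightarrow> real"
  assumes f: "bounded_linear f" and Q: "Q differentiable (at x)"
    and v: "\<And>k. partial_deriv k v differentiable (at x)"
  shows "divergence (\<lambda>y. Q y *v (\<chi> k. f (partial_deriv k v y))) x = f (principal_divergence Q v x)"
proof -
  let ?D = "\<lambda>h. \<chi> k. f (frechet_derivative (partial_deriv k v) (at x) h)"
  have fs: "f (of_real t * z) = t * f z" for t z
    using linear_scale[OF bounded_linear.linear[OF f], of t z] by (simp add: scaleR_conv_of_real)
  have "((\<lambda>y. \<chi> k. f (partial_deriv k v y)) has_derivative ?D) (at x)"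
  proof (rule has_derivative_vec_lambda)
    fix k
    show "((\<lambda>y. f (partial_deriv k v y)) has_derivative (\<lambda>h. f (frechet_derivative (partial_deriv k v) (at x) h))) (at x)"
      by (rule bounded_linear.has_derivative[OF f v[unfolded frechet_derivative_works]])
  qed
  from bounded_bilinear.FDERIV[OF bounded_bilinear_matrix_vector Q[unfolded frechet_derivative_works] this]
  have "divergence (\<lambda>y. Q y *v (\<chi> k. f (partial_deriv k v y))) x
      = (\<Sum>i\<in>UNIV. (Q x *v ?D (axis i 1) + frechet_derivative Q (at x) (axis i 1) *v (\<chi> k. f (partial_deriv k v x))) $ i)"
    by (rule divergence_eq)
  also have "\<dots> = f (principal_divergence Q v x)"
    unfolding principal_divergence_def
    by (simp add: matrix_vector_mult_def sum.distrib linear_add[OF bounded_linear.linear[OF f]]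
        linear_sum[OF bounded_linear.linear[OF f]] fs partial_deriv_def[of _ "partial_deriv _ v"])
  finally show ?thesis .
qed

lemma norm_grad_component:
  fixes v :: "real^'n \<Rightarrow> complex"
  shows "norm (partial_deriv k v x) \<le> norm (grad v x)"
  using Finite_Cartesian_Product.norm_nth_le[of "grad v x" k] by (simp add: grad_def)

lemma norm_sum_le_const:
  fixes B :: real
  assumes "\<And>i. norm (f i) \<le> B" shows "norm (\<Sum>i\<in>(UNIV :: 'i::finite set). f i) \<le> CARD('i) * B"
  using sum_norm_bound[of UNIV f B] assms by simp

text \<open>Up to sign, \<open>principal_divergence\<close> and \<open>second_order_op\<close> have the same second-order part, and
they differ by a first-order operator whose coefficients are bounded in terms of \<open>Q'\<close>, \<open>b\<close> and \<open>c\<close>.\<close>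
lemma principal_divergence_bound:
  fixes Q :: "real^'n \<Rightarrow> real^'n^'n" and v :: "real^'n \<Rightarrow> complex" and A B Bb Bc :: real
  assumes P: "cmod (second_order_op Q b c v x) \<le> A * (norm (grad v x) + cmod (v x))"
    and Q': "\<And>i. norm (frechet_derivative Q (at x) (axis i 1)) \<le> B"
    and b: "\<And>j. cmod (b j x) \<le> Bb" and c: "cmod (c x) \<le> Bc" and nonneg: "B \<ge> 0" "Bb \<ge> 0" "Bc \<ge> 0"
  shows "cmod (principal_divergence Q v x)
    \<le> (A + CARD('n) * Bb + Bc + CARD('n) * (CARD('n) * B)) * (norm (grad v x) + cmod (v x))"
proof -
  let ?N = "norm (grad v x) + cmod (v x)"
  have N: "norm (grad v x) \<le> ?N" "cmod (v x) \<le> ?N" "?N \<ge> 0" by simp_all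
  have pd: "cmod (partial_deriv k v x) \<le> ?N" for k by (rule order_trans[OF norm_grad_component N(1)])
  let ?b = "\<Sum>j\<in>UNIV. b j x * partial_deriv j v x"
  let ?q = "\<Sum>i\<in>UNIV. \<Sum>k\<in>UNIV. of_real (frechet_derivative Q (at x) (axis i 1) $ i $ k) * partial_deriv k v x"
  have b': "cmod ?b \<le> CARD('n) * (Bb * ?N)"
  proof (rule norm_sum_le_const)
    fix j show "cmod (b j x * partial_deriv j v x) \<le> Bb * ?N"
      unfolding norm_mult by (intro mult_mono b pd norm_ge_zero nonneg)
  qed
  have c': "cmod (c x * v x) \<le> Bc * ?N"
    unfolding norm_mult by (intro mult_mono c N(2) norm_ge_zero nonneg)
  have q': "cmod ?q \<le> CARD('n) * (CARD('n) * (B * ?N))"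
  proof (rule norm_sum_le_const, rule norm_sum_le_const)
    fix i k :: 'n
    have "\<bar>frechet_derivative Q (at x) (axis i 1) $ i $ k\<bar> \<le> norm (frechet_derivative Q (at x) (axis i 1) $ i)"
      by (rule component_le_norm_cart)
    also have "\<dots> \<le> B" using Finite_Cartesian_Product.norm_nth_le[of "frechet_derivative Q (at x) (axis i 1)" i] Q'[of i] by linarith
    finally show "cmod (of_real (frechet_derivative Q (at x) (axis i 1) $ i $ k) * partial_deriv k v x) \<le> B * ?N"
      unfolding norm_mult norm_of_real by (intro mult_mono pd norm_ge_zero nonneg)
  qed
  have triangle: "cmod (- z1 + z2 + z3 + z4) \<le> cmod z1 + cmod z2 + cmod z3 + cmod z4" for z1 z2 z3 z4
    using norm_triangle_ineq[of "- z1 + z2 + z3" z4] norm_triangle_ineq[of "- z1 + z2" z3]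
      norm_triangle_ineq[of "- z1" z2] by simp
  have eq: "principal_divergence Q v x = - second_order_op Q b c v x + ?b + c x * v x + ?q"
  proof -
    have "z1 + z4 = - (- z1 + z2 + z3) + z2 + z3 + z4" for z1 z2 z3 z4 :: complex by simp
    then show ?thesis unfolding principal_divergence_def second_order_op_def .
  qed
  have "cmod (principal_divergence Q v x) \<le> cmod (second_order_op Q b c v x) + cmod ?b + cmod (c x * v x) + cmod ?q"
    unfolding eq by (rule triangle)
  note bound = order_trans[OF this add_mono[OF add_mono[OF add_mono[OF P b'] c'] q']]
  have dist: "(A + CARD('n) * Bb + Bc + CARD('n) * (CARD('n) * B)) * z
      = A * z + CARD('n) * (Bb * z) + Bc * z + CARD('n) * (CARD('n) * (B * z))" for z
    by (simp only: distrib_right mult.assoc)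
  show ?thesis unfolding dist by (rule bound)
qed

lemma closure_of_subspace:
  fixes S :: "'a::topological_space set"
  shows "S \<subseteq> U \<Longrightarrow> top_of_set U closure_of S = U \<inter> closure S"
  by (simp add: closure_of_subtopology Int_absorb1)

lemma frontier_of_subspaceI:
  fixes S :: "'a::topological_space set"
  shows "x \<in> U \<Longrightarrow> x \<in> closure S \<Longrightarrow> x \<notin> S \<Longrightarrow> S \<subseteq> U \<Longrightarrow> x \<in> top_of_set U frontier_of S"
  using interior_of_subset[of "top_of_set U" S] by (auto simp: frontier_of_def closure_of_subspace)

theorem theorem1p2:
  fixes U \<Omega> \<Sigma>p \<Sigma>m :: "(real^'n) set"
    and Q :: "real^'n \<Rightarrow> real^'n^'n"
    and b :: "'n \<Rightarrow> real^'n \<Rightarrow> complex"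
    and c :: "real^'n \<Rightarrow> complex"
    and \<phi>p \<phi>m :: "real^'n \<Rightarrow> real"
    and u :: "real^'n \<Rightarrow> complex"
  defines "\<Sigma>p \<equiv> zero_set U \<phi>p"
    and "\<Sigma>m \<equiv> zero_set U \<phi>m"
    and "\<Omega> \<equiv> pos_region U \<phi>p \<phi>m"
  assumes dimension: "CARD('n) \<ge> 3"
    and open_U: "open U"
    and Q_C1: "Ck_on 1 U Q"
    and Q_symmetric: "\<forall>x\<in>U. transpose (Q x) = Q x"
    and Q_signature: "\<forall>x\<in>U. has_signature (Q x) (CARD('n) - 1) 1"
    and b_measurable: "\<forall>j. b j \<in> borel_measurable (lebesgue_on U)"
    and b_bounded: "\<forall>j. bounded (b j ` U)"
    and c_measurable: "c \<in> borel_measurable (lebesgue_on U)"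
    and c_bounded: "bounded (c ` U)"
    and phi_C2: "Ck_on 2 U \<phi>p" "Ck_on 2 U \<phi>m"
    and dphi_p: "\<forall>x\<in>\<Sigma>p. grad \<phi>p x \<noteq> 0"
    and dphi_m: "\<forall>x\<in>\<Sigma>m. grad \<phi>m x \<noteq> 0"
    and transversal: "\<forall>x\<in>\<Sigma>p \<inter> \<Sigma>m. wedge (grad \<phi>p x) (grad \<phi>m x) \<noteq> 0"
    and characteristic_p: "\<forall>x\<in>\<Sigma>p. (Q x *v grad \<phi>p x) \<bullet> grad \<phi>p x = 0"
    and characteristic_m: "\<forall>x\<in>\<Sigma>m. (Q x *v grad \<phi>m x) \<bullet> grad \<phi>m x = 0"
    and positivity: "\<forall>x\<in>\<Sigma>p \<inter> \<Sigma>m. (Q x *v grad \<phi>p x) \<bullet> grad \<phi>m x > 0"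
    and u_C2: "C2_on_closure U \<Omega> u"
    and inequality: "\<exists>C\<ge>0. \<forall>x\<in>\<Omega>. cmod (second_order_op Q b c u x) \<le> C * (norm (grad u x) + cmod (u x))"
    and u_boundary: "\<forall>x\<in>top_of_set U frontier_of \<Omega>. u x = 0"
  shows "\<exists>W. open W \<and> W \<subseteq> U \<and> \<Sigma>p \<inter> \<Sigma>m \<subseteq> W \<and> (\<forall>x\<in>W \<inter> (top_of_set U closure_of \<Omega>). u x = 0)"
proof -
  obtain v where v: "Ck_on 2 U v" and uv: "\<And>x. x \<in> top_of_set U closure_of \<Omega> \<Longrightarrow> u x = v x"
    using u_C2 unfolding C2_on_closure_def by blast
  have v': "Ck_on (Suc (Suc 0)) U v" using v unfolding numeral_2_eq_2 .
  have v_diff: "v differentiable (at x)" if "x \<in> U" for x using v' that unfolding Ck_on.simps(2) by blast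
  have pv_C1: "C1_on U (partial_deriv k v)" for k
    using v' unfolding Ck_on.simps(2)[of "Suc 0"] by (intro Ck_on_Suc_imp_C1_on[of 0]) blast
  have phi_diff: "\<phi>p differentiable (at x)" "\<phi>m differentiable (at x)" if "x \<in> U" for x
    using phi_C2 that unfolding numeral_2_eq_2 Ck_on.simps(2) by blast+
  note phi_deriv = has_derivative_grad[OF phi_diff(1)] has_derivative_grad[OF phi_diff(2)]
  have phi_cont: "continuous_on U \<phi>p" "continuous_on U \<phi>m"
    by (rule Ck_on_imp_continuous_on[OF phi_C2(1)] Ck_on_imp_continuous_on[OF phi_C2(2)])+
  have \<Omega>U: "\<Omega> \<subseteq> U" by (auto simp: \<Omega>_def pos_region_def)
  have \<Omega>_open: "open \<Omega>"
  proof -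
    have "open (U \<inter> \<phi>p -` {0<..})" "open (U \<inter> \<phi>m -` {0<..})"
      using continuous_open_preimage[OF phi_cont(1) open_U open_greaterThan]
        continuous_open_preimage[OF phi_cont(2) open_U open_greaterThan] by blast+
    moreover have "\<Omega> = (U \<inter> \<phi>p -` {0<..}) \<inter> (U \<inter> \<phi>m -` {0<..})" by (auto simp: \<Omega>_def pos_region_def)
    ultimately show ?thesis by (simp only: open_Int)
  qed
  have clo: "top_of_set U closure_of \<Omega> = U \<inter> closure \<Omega>" by (rule closure_of_subspace[OF \<Omega>U])
  have u_frontier: "u x = 0" if "x \<in> U" "x \<in> closure \<Omega>" "x \<notin> \<Omega>" for x
    using bspec[OF u_boundary frontier_of_subspaceI[OF that \<Omega>U]] .
  have uv_\<Omega>: "u x = v x" if "x \<in> \<Omega>" for x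
    using that \<Omega>U closure_subset by (intro uv) (auto simp: clo)
  \<comment> \<open>Both faces are treated at once: a point with \<open>p = 0\<close> and \<open>m > 0\<close> is a limit of points of \<open>\<Omega>\<close> along \<open>grad p\<close>.\<close>
  have face: "v y = 0" if y: "y \<in> U" "p y = 0" "m y > 0"
    and p: "(p has_derivative (\<lambda>h. grad p y \<bullet> h)) (at y)" "grad p y \<noteq> 0" and m: "isCont m y"
    and \<Omega>_eq: "\<And>x. x \<in> U \<Longrightarrow> p x > 0 \<Longrightarrow> m x > 0 \<Longrightarrow> x \<in> \<Omega>" and "y \<notin> \<Omega>" for y and p m :: "real^'n \<Rightarrow> real"
  proof -
    have "((\<lambda>t. y + t *\<^sub>R grad p y) \<longlongrightarrow> y + 0 *\<^sub>R grad p y) (at_right 0)" by (intro tendsto_intros)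
    then have lim: "((\<lambda>t. y + t *\<^sub>R grad p y) \<longlongrightarrow> y) (at_right 0)" by simp
    have "\<forall>\<^sub>F t in at_right 0. p (y + t *\<^sub>R grad p y) > 0"
      by (rule positive_along_ray[OF p(1) y(2)]) (use p(2) in simp)
    moreover have "\<forall>\<^sub>F t in at_right 0. m (y + t *\<^sub>R grad p y) > 0"
      by (rule order_tendstoD(1)[OF isCont_tendsto_compose[OF m lim] y(3)])
    moreover have "\<forall>\<^sub>F t in at_right 0. y + t *\<^sub>R grad p y \<in> U"
      by (rule topological_tendstoD[OF lim open_U y(1)])
    ultimately have "\<forall>\<^sub>F t in at_right 0. y + t *\<^sub>R grad p y \<in> closure \<Omega>"
      by eventually_elim (use \<Omega>_eq closure_subset in blast)
    then have cl: "y \<in> closure \<Omega>"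
      by (rule Lim_in_closed_set[OF closed_closure _ trivial_limit_at_right_real lim])
    then have "u y = v y" using y(1) by (intro uv) (simp add: clo)
    then show ?thesis using u_frontier[OF y(1) cl \<open>y \<notin> \<Omega>\<close>] by simp
  qed
  have face_p: "v y = 0" if "y \<in> U" "\<phi>p y = 0" "\<phi>m y > 0" for y
    by (rule face[where p = \<phi>p and m = \<phi>m])
      (use that phi_deriv dphi_p has_derivative_continuous[OF phi_deriv(2)] in
        \<open>auto simp: \<Omega>_def pos_region_def \<Sigma>p_def zero_set_def\<close>)
  have face_m: "v y = 0" if "y \<in> U" "\<phi>m y = 0" "\<phi>p y > 0" for y
    by (rule face[where p = \<phi>m and m = \<phi>p])
      (use that phi_deriv dphi_m has_derivative_continuous[OF phi_deriv(1)] in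
        \<open>auto simp: \<Omega>_def pos_region_def \<Sigma>m_def zero_set_def\<close>)
  have Q_sym: "(Q x *v y) \<bullet> z = y \<bullet> (Q x *v z)" if "x \<in> U" for x y z
    using Q_symmetric that by (metis dot_lmul_matrix transpose_matrix_vector)
  have Q_C1': "C1_on U Q" using Q_C1 by (intro Ck_on_Suc_imp_C1_on[of 0]) simp
  define u1 where "u1 x = Re (v x)" for x
  define u2 where "u2 x = Im (v x)" for x
  define du1 where "du1 x = (\<chi> k. Re (partial_deriv k v x))" for x
  define du2 where "du2 x = (\<chi> k. Im (partial_deriv k v x))" for x
  have u1: "\<And>x. x \<in> U \<Longrightarrow> (u1 has_derivative (\<lambda>h. du1 x \<bullet> h)) (at x)" "C1_on U du1"
    unfolding u1_def[abs_def] du1_def[abs_def]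
    by (rule has_derivative_linear_part[OF bounded_linear_Re v_diff], assumption)
      (intro C1_on_vec_lambda C1_on_linear[OF bounded_linear_Re] pv_C1)
  have u2: "\<And>x. x \<in> U \<Longrightarrow> (u2 has_derivative (\<lambda>h. du2 x \<bullet> h)) (at x)" "C1_on U du2"
    unfolding u2_def[abs_def] du2_def[abs_def]
    by (rule has_derivative_linear_part[OF bounded_linear_Im v_diff], assumption)
      (intro C1_on_vec_lambda C1_on_linear[OF bounded_linear_Im] pv_C1)
  have norms: "(norm (grad v x))\<^sup>2 + (cmod (v x))\<^sup>2 = (norm (du1 x))\<^sup>2 + (norm (du2 x))\<^sup>2 + (u1 x)\<^sup>2 + (u2 x)\<^sup>2" for x
    by (simp add: norm_vec_def L2_set_def grad_def du1_def du2_def u1_def u2_def sum_nonneg cmod_power2 sum.distrib)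
  obtain A where A: "A \<ge> 0" "\<And>x. x \<in> \<Omega> \<Longrightarrow> cmod (second_order_op Q b c u x) \<le> A * (norm (grad u x) + cmod (u x))"
    using inequality by blast
  have "bounded (\<Union>j. b j ` U)" using b_bounded by (intro bounded_UN) auto
  then obtain Bb where Bb: "Bb > 0" "\<forall>z\<in>(\<Union>j. b j ` U). cmod z \<le> Bb" by (auto simp: bounded_pos)
  obtain Bc where Bc: "Bc > 0" "\<forall>z\<in>c ` U. cmod z \<le> Bc" using c_bounded by (auto simp: bounded_pos)
  have local: "\<exists>s>0. \<forall>x\<in>ball x0 s \<inter> U. \<phi>p x > 0 \<longrightarrow> \<phi>m x > 0 \<longrightarrow> u1 x = 0 \<and> u2 x = 0"
    if x0: "x0 \<in> \<Sigma>p \<inter> \<Sigma>m" for x0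
  proof -
    have x0': "x0 \<in> U" "\<phi>p x0 = 0" "\<phi>m x0 = 0" using x0 by (auto simp: \<Sigma>p_def \<Sigma>m_def zero_set_def)
    obtain r0 where r0: "r0 > 0" "cball x0 r0 \<subseteq> U" using open_U x0'(1) open_contains_cball by blast
    obtain B where B: "B \<ge> 0" "\<forall>x\<in>cball x0 r0. \<forall>h. norm (frechet_derivative Q (at x) h) \<le> B * norm h"
      using C1_on_bounded_derivative[OF Q_C1' compact_cball r0(2)] by blast
    define C where "C = A + CARD('n) * Bb + Bc + CARD('n) * (CARD('n) * B)"
    show ?thesis
    proof (rule vanishing_near_corner[where p = \<phi>p and m = \<phi>m and dp = "grad \<phi>p" and dm = "grad \<phi>m" and
          Q = Q and ?du1.0 = du1 and ?du2.0 = du2 and ?u1.0 = u1 and ?u2.0 = u2 and C = "2 * C\<^sup>2" and ?r0.0 = r0,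
          OF open_U Q_C1' Q_sym phi_deriv(1) Ck_on_2_imp_C1_on_grad[OF phi_C2(1)]
          phi_deriv(2) Ck_on_2_imp_C1_on_grad[OF phi_C2(2)] x0' _ _ _ _ u1 u2 _ _ r0(1)])
      show "grad \<phi>p y \<noteq> 0 \<and> (Q y *v grad \<phi>p y) \<bullet> grad \<phi>p y = 0" if "y \<in> U" "\<phi>p y = 0" for y
        using that dphi_p characteristic_p by (auto simp: \<Sigma>p_def zero_set_def)
      show "grad \<phi>m y \<noteq> 0 \<and> (Q y *v grad \<phi>m y) \<bullet> grad \<phi>m y = 0" if "y \<in> U" "\<phi>m y = 0" for y
        using that dphi_m characteristic_m by (auto simp: \<Sigma>m_def zero_set_def)
      show pos: "0 < (Q x0 *v grad \<phi>p x0) \<bullet> grad \<phi>m x0" using positivity x0 by blast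
      show "0 < 2 * ((Q x0 *v grad \<phi>p x0) \<bullet> grad \<phi>m x0) * ((Q x0 *v \<xi>) \<bullet> \<xi>)
          - 8 * ((Q x0 *v grad \<phi>p x0) \<bullet> \<xi>) * ((Q x0 *v grad \<phi>m x0) \<bullet> \<xi>)
          + 8 * ((Q x0 *v grad \<phi>p x0) \<bullet> \<xi> + (Q x0 *v grad \<phi>m x0) \<bullet> \<xi>)\<^sup>2" if "\<xi> \<noteq> 0" for \<xi>
        using x0 Q_signature characteristic_p characteristic_m dimension x0'(1)
        by (intro lorentz_corner_form_positive[OF _ _ Q_sym[OF x0'(1)] _ _ pos that]) auto
      show "u1 y = 0 \<and> u2 y = 0" if "y \<in> U" "\<phi>p y = 0" "\<phi>m y > 0" for y
        using face_p[OF that] by (simp add: u1_def u2_def)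
      show "u1 y = 0 \<and> u2 y = 0" if "y \<in> U" "\<phi>m y = 0" "\<phi>p y > 0" for y
        using face_m[OF that] by (simp add: u1_def u2_def)
      show "2 * C\<^sup>2 \<ge> 0" by simp
      show "(divergence (\<lambda>y. Q y *v du1 y) x)\<^sup>2 + (divergence (\<lambda>y. Q y *v du2 y) x)\<^sup>2
          \<le> 2 * C\<^sup>2 * ((norm (du1 x))\<^sup>2 + (norm (du2 x))\<^sup>2 + (u1 x)\<^sup>2 + (u2 x)\<^sup>2)"
        if x: "x \<in> ball x0 r0" "x \<in> U" "\<phi>p x > 0" "\<phi>m x > 0" for x
      proof -
        have x\<Omega>: "x \<in> \<Omega>" using x by (simp add: \<Omega>_def pos_region_def)
        let ?L = "principal_divergence Q v x" and ?N = "norm (grad v x) + cmod (v x)"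
        have "cmod (second_order_op Q b c v x) \<le> A * ?N"
          using A(2)[OF x\<Omega>] second_order_op_cong_open[OF \<Omega>_open x\<Omega> uv_\<Omega>]
            grad_cong_open[OF \<Omega>_open x\<Omega> uv_\<Omega>] uv_\<Omega>[OF x\<Omega>] by simp
        moreover have "norm (frechet_derivative Q (at x) (axis i 1)) \<le> B" for i
        proof -
          have "x \<in> cball x0 r0" using x(1) by simp
          then have "norm (frechet_derivative Q (at x) (axis i 1)) \<le> B * norm (axis i (1::real))" using B(2) by blast
          then show ?thesis by simp
        qed
        moreover have "cmod (b j x) \<le> Bb" for j using Bb(2) x(2) by blast
        moreover have "cmod (c x) \<le> Bc" using Bc(2) x(2) by blast
        ultimately have "cmod ?L \<le> C * ?N"
          unfolding C_def using B(1) Bb(1) Bc(1) by (intro principal_divergence_bound) auto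
        then have "(cmod ?L)\<^sup>2 \<le> (C * ?N)\<^sup>2" by (rule power_mono) simp
        also have "\<dots> = C\<^sup>2 * ?N\<^sup>2" by (rule power_mult_distrib)
        also have "?N\<^sup>2 \<le> 2 * ((norm (grad v x))\<^sup>2 + (cmod (v x))\<^sup>2)"
          using zero_le_power2[of "norm (grad v x) - cmod (v x)"] by (simp add: power2_eq_square algebra_simps)
        finally have L: "(cmod ?L)\<^sup>2 \<le> C\<^sup>2 * (2 * ((norm (grad v x))\<^sup>2 + (cmod (v x))\<^sup>2))"
          by (simp add: mult_left_mono)
        have divs: "divergence (\<lambda>y. Q y *v du1 y) x = Re ?L" "divergence (\<lambda>y. Q y *v du2 y) x = Im ?L"
          unfolding du1_def[abs_def] du2_def[abs_def]
          by (intro divergence_linear_part bounded_linear_Re bounded_linear_Im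
              C1_on_differentiable[OF Q_C1' x(2)] C1_on_differentiable[OF pv_C1 x(2)])+
        show ?thesis
          using L unfolding divs norms cmod_power2[of ?L] by (simp only: mult.commute mult.left_commute)
      qed
    qed
  qed
  then obtain s where s: "\<And>x0. x0 \<in> \<Sigma>p \<inter> \<Sigma>m \<Longrightarrow> s x0 > 0"
    "\<And>x0 x. x0 \<in> \<Sigma>p \<inter> \<Sigma>m \<Longrightarrow> x \<in> ball x0 (s x0) \<inter> U \<Longrightarrow> \<phi>p x > 0 \<Longrightarrow> \<phi>m x > 0 \<Longrightarrow> u1 x = 0 \<and> u2 x = 0"
    by metis
  define W where "W = (\<Union>x0\<in>\<Sigma>p \<inter> \<Sigma>m. ball x0 (s x0) \<inter> U)"
  have "open W" unfolding W_def using open_U by (intro open_UN ballI open_Int) auto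
  moreover have "W \<subseteq> U" by (auto simp: W_def)
  moreover have "\<Sigma>p \<inter> \<Sigma>m \<subseteq> W" using s(1) by (force simp: W_def \<Sigma>p_def zero_set_def)
  moreover have "u x = 0" if "x \<in> W \<inter> (top_of_set U closure_of \<Omega>)" for x
  proof (cases "x \<in> \<Omega>")
    case True
    then have "u1 x = 0 \<and> u2 x = 0" using that s(2) by (auto simp: W_def \<Omega>_def pos_region_def)
    then show ?thesis using uv_\<Omega>[OF True] by (simp add: u1_def u2_def complex_eq_iff)
  next
    case False
    then show ?thesis using that clo u_frontier by blast
  qed
  ultimately show ?thesis by blast
qed

end
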